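(* The problem QBFSAT (deciding whether a given QCNF formula $\mathcal{Q}.\phi$ is true) is fixed-parameter tractable when parameterized by $k + d$, where $k$ is the number of existentially quantified variables and $d$ is the maximum size of any clause of $\phi$. In particular, there is an algorithm that decides whether a QCNF formula $\mathcal{Q}.\phi$ with $k$ existential variables and clauses of size at most $d$ is true in time $(2^k d)^{O(2^k d)}\cdot|\phi|$.
   Context: A quantified Boolean formula is $\mathcal{Q}.\phi$ where $\mathcal{Q}=Q_1x_1\dots Q_nx_n$ with $Q_i\in\{\forall,\exists\}$ is the prefix and $\phi$ is a propositional formula over $x_1,\dots,x_n$ (the matrix); truth is defined recursively in the standard way ($\exists x$: true for some value in $\{0,1\}$; $\forall x$: true for both values). A QCNF is such a formula whose matrix is in conjunctive normal form. Clauses are sets of literals; no clause contains a literal twice or a literal together with its negation, and no clause is repeated in a formula. $|\phi|$ denotes the size (length) of the matrix. A parameterized problem is fixed-parameter tractable if it can be decided in time $f(k)\cdot |I|^{c}$ for a computable $f$ and a constant $c$. *)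

theory Defs
  imports Main
begin

section \<open>Quantified CNF formulas\<close>

datatype quant = Forall | Exists

text \<open>The variables are the natural numbers below the length of the prefix: the \<open>i\<close>-th entry
  of the prefix (from 0) quantifies variable \<open>i\<close>, the leftmost entry being the outermost.\<close>

datatype literal = Pos (var: nat) | Neg (var: nat)

type_synonym clause = "literal list"
type_synonym matrix = "clause list"
type_synonym qcnf = "quant list \<times> matrix"

text \<open>Clauses and matrices denote finite sets. They are represented by duplicate-free lists because
  an algorithm receives them written down in some order; results quantify over all orders.\<close>

definition wf_clause :: "nat \<Rightarrow> clause \<Rightarrow> bool" where
  "wf_clause n C \<longleftrightarrow>
     distinct C \<and> (\<forall>l \<in> set C. var l < n) \<and> (\<forall>v. \<not> (Pos v \<in> set C \<and> Neg v \<in> set C))"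

fun wf_qcnf :: "qcnf \<Rightarrow> bool" where
  "wf_qcnf (Q, \<phi>) \<longleftrightarrow> (\<forall>C \<in> set \<phi>. wf_clause (length Q) C) \<and> distinct (map set \<phi>)"

fun lit_true :: "(nat \<Rightarrow> bool) \<Rightarrow> literal \<Rightarrow> bool" where
  "lit_true \<sigma> (Pos v) \<longleftrightarrow> \<sigma> v"
| "lit_true \<sigma> (Neg v) \<longleftrightarrow> \<not> \<sigma> v"

definition matrix_true :: "(nat \<Rightarrow> bool) \<Rightarrow> matrix \<Rightarrow> bool" where
  "matrix_true \<sigma> \<phi> \<longleftrightarrow> (\<forall>C \<in> set \<phi>. \<exists>l \<in> set C. lit_true \<sigma> l)"

text \<open>In \<open>prefix_true i Q \<sigma> \<phi>\<close> the variables below \<open>i\<close> are already assigned by \<open>\<sigma>\<close>, and \<open>Q\<close>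
  quantifies the variables from \<open>i\<close> on.\<close>

fun prefix_true :: "nat \<Rightarrow> quant list \<Rightarrow> (nat \<Rightarrow> bool) \<Rightarrow> matrix \<Rightarrow> bool" where
  "prefix_true i [] \<sigma> \<phi> \<longleftrightarrow> matrix_true \<sigma> \<phi>"
| "prefix_true i (Exists # Q) \<sigma> \<phi> \<longleftrightarrow> (\<exists>b. prefix_true (Suc i) Q (\<sigma>(i := b)) \<phi>)"
| "prefix_true i (Forall # Q) \<sigma> \<phi> \<longleftrightarrow> (\<forall>b. prefix_true (Suc i) Q (\<sigma>(i := b)) \<phi>)"

text \<open>All variables of a well-formed formula are quantified, so the initial assignment is immaterial.\<close>

fun qbf_true :: "qcnf \<Rightarrow> bool" where
  "qbf_true (Q, \<phi>) \<longleftrightarrow> prefix_true 0 Q (\<lambda>_. False) \<phi>"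

fun num_exists :: "qcnf \<Rightarrow> nat" where
  "num_exists (Q, \<phi>) = count_list Q Exists"

fun max_clause_size :: "qcnf \<Rightarrow> nat" where
  "max_clause_size (Q, \<phi>) = Max (insert 0 (length ` set \<phi>))"


section \<open>Random access machines\<close>

text \<open>A register machine with a separate random access memory. The first argument of an instruction
  is its target, except that \<open>Store a s\<close> writes register \<open>s\<close> to the address held by register \<open>a\<close> and
  \<open>JumpZ r p\<close> jumps to \<open>p\<close> if register \<open>r\<close> is zero. Every step has unit cost. There is deliberately
  no multiplication, which would make unit cost unrealistic.\<close>

datatype instr =
    Const nat nat
  | Add nat nat nat
  | Sub nat nat nat
  | Load nat nat
  | Store nat nat
  | Jump nat
  | JumpZ nat nat

type_synonym program = "instr list"

record config =
  pc :: nat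
  reg :: "nat \<Rightarrow> nat"
  mem :: "nat \<Rightarrow> nat"

definition set_reg :: "nat \<Rightarrow> nat \<Rightarrow> config \<Rightarrow> config" where
  "set_reg r v s = s\<lparr>pc := Suc (pc s), reg := (reg s)(r := v)\<rparr>"

fun exec :: "instr \<Rightarrow> config \<Rightarrow> config" where
  "exec (Const r v) s = set_reg r v s"
| "exec (Add r a b) s = set_reg r (reg s a + reg s b) s"
| "exec (Sub r a b) s = set_reg r (reg s a - reg s b) s"
| "exec (Load r a) s = set_reg r (mem s (reg s a)) s"
| "exec (Store a r) s = s\<lparr>pc := Suc (pc s), mem := (mem s)(reg s a := reg s r)\<rparr>"
| "exec (Jump p) s = s\<lparr>pc := p\<rparr>"
| "exec (JumpZ r p) s = s\<lparr>pc := (if reg s r = 0 then p else Suc (pc s))\<rparr>"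

definition halted :: "program \<Rightarrow> config \<Rightarrow> bool" where
  "halted P s \<longleftrightarrow> pc s \<ge> length P"

definition step :: "program \<Rightarrow> config \<Rightarrow> config" where
  "step P s = (if halted P s then s else exec (P ! pc s) s)"

text \<open>The input occupies the initial memory cells and its length is in register 0; all other
  registers and cells are zero.\<close>

definition init :: "nat list \<Rightarrow> config" where
  "init xs = \<lparr>pc = 0, reg = (\<lambda>_. 0)(0 := length xs),
              mem = (\<lambda>a. if a < length xs then xs ! a else 0)\<rparr>"

text \<open>Halted configurations are fixed points of \<^const>\<open>step\<close>, so this says that \<open>P\<close> halts after
  at most \<open>t\<close> steps with \<open>y\<close> in register 0.\<close>

definition outputs_within :: "program \<Rightarrow> nat list \<Rightarrow> nat \<Rightarrow> nat \<Rightarrow> bool" where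
  "outputs_within P xs t y \<longleftrightarrow>
     (let s = (step P ^^ t) (init xs) in halted P s \<and> reg s 0 = y)"

definition decides_within :: "program \<Rightarrow> nat list \<Rightarrow> nat \<Rightarrow> bool \<Rightarrow> bool" where
  "decides_within P xs t b \<longleftrightarrow> outputs_within P xs t (if b then 1 else 0)"

definition computable :: "(nat \<Rightarrow> nat) \<Rightarrow> bool" where
  "computable f \<longleftrightarrow> (\<exists>P. \<forall>n. \<exists>t. outputs_within P [n] t (f n))"


section \<open>Fixed-parameter tractability\<close>

text \<open>A parameterized problem is given by its set of instances \<open>D\<close>, the encoding \<open>enc\<close> of instances
  as machine inputs, the property \<open>yes\<close> to be decided, and the parameter \<open>\<kappa>\<close>.\<close>

definition fpt :: "('a \<Rightarrow> nat list) \<Rightarrow> 'a set \<Rightarrow> ('a \<Rightarrow> bool) \<Rightarrow> ('a \<Rightarrow> nat) \<Rightarrow> bool" where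
  "fpt enc D yes \<kappa> \<longleftrightarrow>
     (\<exists>P f c. computable f \<and>
        (\<forall>x \<in> D. decides_within P (enc x) (f (\<kappa> x) * length (enc x) ^ c) (yes x)))"


section \<open>Formulas as machine inputs\<close>

fun encode_quant :: "quant \<Rightarrow> nat" where
  "encode_quant Forall = 0"
| "encode_quant Exists = 1"

fun encode_literal :: "literal \<Rightarrow> nat list" where
  "encode_literal (Pos v) = [v, 1]"
| "encode_literal (Neg v) = [v, 0]"

definition encode_clause :: "clause \<Rightarrow> nat list" where
  "encode_clause C = length C # concat (map encode_literal C)"

definition encode_matrix :: "matrix \<Rightarrow> nat list" where
  "encode_matrix \<phi> = length \<phi> # concat (map encode_clause \<phi>)"

fun encode_qcnf :: "qcnf \<Rightarrow> nat list" where
  "encode_qcnf (Q, \<phi>) = length Q # map encode_quant Q @ encode_matrix \<phi>"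

text \<open>The size of the matrix does not include the prefix.\<close>

definition matrix_size :: "matrix \<Rightarrow> nat" where
  "matrix_size \<phi> = length (encode_matrix \<phi>)"

end

theory Submission
  imports Defs
begin

text \<open>If the universal player wins, then in the play against each assignment \<open>z\<close> of the existential
  variables some clause \<open>C z\<close> gets falsified, and only the literals of these clauses matter. So the
  formula is false iff one can choose for each of the \<open>2 ^ k\<close> assignments \<open>z\<close> a clause whose existential
  literals are falsified by \<open>z\<close>, such that no universal variable occurs with opposite signs in the
  clauses for two assignments that agree on the existential variables to its left.

  Such a choice involves at most \<open>N = 2 ^ k * d\<close> literals and is found by a bounded search tree whose
  nodes are consistent sets \<open>\<tau>\<close> of literals. At a node and for an assignment \<open>z\<close>, greedily collect
  admissible clauses whose parts outside of \<open>\<tau>\<close> are disjoint. If there are more than \<open>N\<close> of them, or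
  one lies within \<open>\<tau>\<close>, then \<open>z\<close> can be served last, whatever is chosen for the other assignments. If
  this happens for all \<open>z\<close>, a choice exists. Otherwise each choice extending \<open>\<tau>\<close> contains one of the at
  most \<open>2 * d * N\<close> literals collected, up to negation, and the node branches on these. The depth is
  at most \<open>N\<close>, and a node costs time linear in the matrix.\<close>

section \<open>A while language for the machine\<close>

text \<open>The time bound counts the matrix but not the prefix, so the program may neither read the
  prefix from end to end nor initialise tables: it looks up quantifiers by random access, lists only
  the existential variables that occur in clauses, and clears tables by time stamps. A universal
  variable splits into copies, one for each assignment of the existential variables to its left. A
  copy is numbered injectively by doublings and additions alone, and this number serves directly as
  a memory address, so membership of a code is tested in constant time. Falsified existential
  literals get code 0, satisfied ones get code 1, and 0 belongs to every node; this merges both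
  conditions on a choice into one: no two selected codes are opposite. The threshold for serving an
  index last is \<open>m * d\<close> because the codes chosen for the other indices are at most that
  many. Nodes live in a queue with parent links, so no recursion stack has to be modelled, and time
  is controlled by a potential: each pending node holds a budget for its whole subtree.\<close>

datatype arr = Seen | Ev | Wt | Val | Tm | Hm | Nl | Np | La | Lb

fun aid :: "arr \<Rightarrow> nat" where
  "aid Seen = 0" | "aid Ev = 1" | "aid Wt = 2" | "aid Val = 3" | "aid Tm = 4"
| "aid Hm = 5" | "aid Nl = 6" | "aid Np = 7" | "aid La = 8" | "aid Lb = 9"

datatype exp = N nat | V nat | Plus exp exp | Minus exp exp | In exp | Rd arr exp

type_synonym vars = "nat \<Rightarrow> nat"
type_synonym arrs = "arr \<Rightarrow> nat \<Rightarrow> nat"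

text \<open>Reads by \<open>In\<close> are clamped to the last input cell because the arrays start
  right behind the input; the value of a read thus never depends on where the arrays lie.\<close>

fun eval :: "nat list \<Rightarrow> vars \<Rightarrow> arrs \<Rightarrow> exp \<Rightarrow> nat" where
  "eval xs v a (N n) = n"
| "eval xs v a (V x) = v x"
| "eval xs v a (Plus e f) = eval xs v a e + eval xs v a f"
| "eval xs v a (Minus e f) = eval xs v a e - eval xs v a f"
| "eval xs v a (In e) = xs ! min (eval xs v a e) (length xs - 1)"
| "eval xs v a (Rd b e) = a b (eval xs v a e)"

text \<open>These are the lengths of the code produced by \<open>cexp\<close>. That code has no
  jumps, so they are also its exact running times.\<close>

fun ecost :: "exp \<Rightarrow> nat" where
  "ecost (N n) = 1"
| "ecost (V x) = 2"
| "ecost (Plus e f) = ecost e + ecost f + 1"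
| "ecost (Minus e f) = ecost e + ecost f + 1"
| "ecost (In e) = ecost e + 5"
| "ecost (Rd b e) = ecost e + 8"

datatype com =
    Skip
  | Assign nat exp (infix "::=" 61)
  | Write arr exp exp
  | Seq com com (infixr ";;" 60)
  | Cond exp com com
  | While exp com

text \<open>The times are exact for the compiled code. \<open>CondT\<close> costs one step more than
  \<open>CondF\<close> for the jump over the other branch, and \<open>WhileT\<close> one more than
  \<open>WhileF\<close> for the jump back.\<close>

inductive runs :: "nat list \<Rightarrow> com \<Rightarrow> vars \<Rightarrow> arrs \<Rightarrow> nat \<Rightarrow> vars \<Rightarrow> arrs \<Rightarrow> bool" for xs where
  Skip: "runs xs Skip v a 0 v a"
| Assign: "runs xs (x ::= e) v a (ecost e + 2) (v(x := eval xs v a e)) a"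
| Write: "runs xs (Write b e f) v a (ecost e + ecost f + 8) v
    (a(b := (a b)(eval xs v a e := eval xs v a f)))"
| Seq: "runs xs c v a t v' a' \<Longrightarrow> runs xs d v' a' t' v'' a'' \<Longrightarrow> runs xs (c ;; d) v a (t + t') v'' a''"
| CondT: "eval xs v a e \<noteq> 0 \<Longrightarrow> runs xs c v a t v' a' \<Longrightarrow>
    runs xs (Cond e c d) v a (ecost e + 2 + t) v' a'"
| CondF: "eval xs v a e = 0 \<Longrightarrow> runs xs d v a t v' a' \<Longrightarrow>
    runs xs (Cond e c d) v a (ecost e + 1 + t) v' a'"
| WhileF: "eval xs v a e = 0 \<Longrightarrow> runs xs (While e c) v a (ecost e + 1) v a"
| WhileT: "eval xs v a e \<noteq> 0 \<Longrightarrow> runs xs c v a t v' a' \<Longrightarrow> runs xs (While e c) v' a' t' v'' a'' \<Longrightarrow>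
    runs xs (While e c) v a (ecost e + 2 + t + t') v'' a''"

section \<open>Weakest preconditions with elapsed time\<close>

text \<open>Being existential over runs, this is total correctness. The time is counted from the
  start of the whole program, so postconditions and loop invariants bound it like any other part of
  the state.\<close>

definition wp :: "nat list \<Rightarrow> com \<Rightarrow> (vars \<Rightarrow> arrs \<Rightarrow> nat \<Rightarrow> bool) \<Rightarrow> vars \<Rightarrow> arrs \<Rightarrow> nat \<Rightarrow> bool" where
  "wp xs c R v a t \<longleftrightarrow> (\<exists>t' v' a'. runs xs c v a t' v' a' \<and> R v' a' (t + t'))"

inductive_cases runs_SkipE: "runs xs Skip v a t v' a'"
inductive_cases runs_AssignE: "runs xs (x ::= e) v a t v' a'"
inductive_cases runs_WriteE: "runs xs (Write b e f) v a t v' a'"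
inductive_cases runs_SeqE: "runs xs (c ;; d) v a t v' a'"
inductive_cases runs_CondE: "runs xs (Cond e c d) v a t v' a'"

lemma wp_Skip [simp]: "wp xs Skip R v a t = R v a t"
  unfolding wp_def using Skip by (fastforce elim: runs_SkipE)

lemma wp_Assign [simp]:
  "wp xs (x ::= e) R v a t = R (v(x := eval xs v a e)) a (t + ecost e + 2)"
  unfolding wp_def using Assign by (fastforce elim: runs_AssignE simp: add.assoc)

lemma wp_Write [simp]:
  "wp xs (Write b e f) R v a t =
    R v (a(b := (a b)(eval xs v a e := eval xs v a f))) (t + ecost e + ecost f + 8)"
  unfolding wp_def using Write by (fastforce elim: runs_WriteE simp: add.assoc)

lemma wp_Seq [simp]: "wp xs (c ;; d) R v a t = wp xs c (wp xs d R) v a t"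
proof
  show "wp xs (c ;; d) R v a t \<Longrightarrow> wp xs c (wp xs d R) v a t"
    unfolding wp_def by (elim exE conjE runs_SeqE) (metis add.assoc)
  show "wp xs c (wp xs d R) v a t \<Longrightarrow> wp xs (c ;; d) R v a t"
    unfolding wp_def using Seq by (metis add.assoc)
qed

lemma wp_Cond [simp]:
  "wp xs (Cond e c d) R v a t =
    ((eval xs v a e \<noteq> 0 \<longrightarrow> wp xs c R v a (t + ecost e + 2)) \<and>
     (eval xs v a e = 0 \<longrightarrow> wp xs d R v a (t + ecost e + 1)))"
proof
  show "wp xs (Cond e c d) R v a t \<Longrightarrow> (eval xs v a e \<noteq> 0 \<longrightarrow> wp xs c R v a (t + ecost e + 2)) \<and>
     (eval xs v a e = 0 \<longrightarrow> wp xs d R v a (t + ecost e + 1))"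
    unfolding wp_def by (elim exE conjE runs_CondE) (auto simp: add.assoc)
  show "(eval xs v a e \<noteq> 0 \<longrightarrow> wp xs c R v a (t + ecost e + 2)) \<and>
     (eval xs v a e = 0 \<longrightarrow> wp xs d R v a (t + ecost e + 1)) \<Longrightarrow> wp xs (Cond e c d) R v a t"
    unfolding wp_def using CondT CondF by (cases "eval xs v a e = 0") (metis add.assoc)+
qed

text \<open>Keeps the simplifier from rewriting the rest of the program before its turn.\<close>

lemma wp_cong [cong]:
  "v = v' \<Longrightarrow> a = a' \<Longrightarrow> t = t' \<Longrightarrow> wp xs c R v a t = wp xs c R v' a' t'"
  by simp

text \<open>Elapsed time grows with every iteration, so a bound on it also yields termination.\<close>

lemma wp_While:
  assumes "I v a t"
    and body: "\<And>v a t. I v a t \<Longrightarrow> eval xs v a e \<noteq> 0 \<Longrightarrow> t \<le> T \<and> wp xs c I v a (t + ecost e + 2)"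
    and exit: "\<And>v a t. I v a t \<Longrightarrow> eval xs v a e = 0 \<Longrightarrow> R v a (t + ecost e + 1)"
  shows "wp xs (While e c) R v a t"
  using assms(1)
proof (induction "Suc T - t" arbitrary: v a t rule: less_induct)
  case less
  show ?case
  proof (cases "eval xs v a e = 0")
    case True
    then show ?thesis using exit[OF less.prems True] WhileF unfolding wp_def by (metis add.assoc)
  next
    case False
    from body[OF less.prems False] obtain t' v' a' where tT: "t \<le> T" and r: "runs xs c v a t' v' a'"
      and i: "I v' a' (t + ecost e + 2 + t')" unfolding wp_def by blast
    have "wp xs (While e c) R v' a' (t + ecost e + 2 + t')"
      using less.hyps[OF _ i] tT by simp
    then obtain t'' v'' a'' where r': "runs xs (While e c) v' a' t'' v'' a''"
      and R: "R v'' a'' (t + ecost e + 2 + t' + t'')" unfolding wp_def by blast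
    have "runs xs (While e c) v a (ecost e + 2 + t' + t'') v'' a''"
      using WhileT[OF False r r'] .
    then show ?thesis unfolding wp_def using R by (auto simp: add.assoc intro!: exI)
  qed
qed

section \<open>Compilation to the machine\<close>

text \<open>Program variables live in the even registers and temporaries in the odd ones from 3 on;
  register 1 holds the length of the input. The arrays are interleaved behind the input, with
  stride 16.\<close>

fun cexp :: "exp \<Rightarrow> nat \<Rightarrow> instr list" where
  "cexp (N n) t = [Const (2*t+3) n]"
| "cexp (V x) t = [Const (2*t+3) 0, Add (2*t+3) (2*x) (2*t+3)]"
| "cexp (Plus e f) t = cexp e t @ cexp f (Suc t) @ [Add (2*t+3) (2*t+3) (2*t+5)]"
| "cexp (Minus e f) t = cexp e t @ cexp f (Suc t) @ [Sub (2*t+3) (2*t+3) (2*t+5)]"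
| "cexp (In e) t = cexp e t @ [Const (2*t+5) 1, Sub (2*t+5) 1 (2*t+5), Sub (2*t+5) (2*t+3) (2*t+5),
     Sub (2*t+3) (2*t+3) (2*t+5), Load (2*t+3) (2*t+3)]"
| "cexp (Rd b e) t = cexp e t @
     [Add (2*t+3) (2*t+3) (2*t+3), Add (2*t+3) (2*t+3) (2*t+3),
      Add (2*t+3) (2*t+3) (2*t+3), Add (2*t+3) (2*t+3) (2*t+3), Const (2*t+5) (aid b), Add (2*t+3) (2*t+3) (2*t+5), Add (2*t+3) (2*t+3) 1, Load (2*t+3) (2*t+3)]"

lemma length_cexp [simp]: "length (cexp e t) = ecost e"
  by (induction e arbitrary: t) auto

text \<open>The second argument is the address at which the code will stand, since jump targets are
  absolute. Registers 3 and 5 are the temporaries of levels 0 and 1; with no move instruction,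
  copying is the addition of a zero.\<close>

fun compile :: "com \<Rightarrow> nat \<Rightarrow> instr list" where
  "compile Skip q = []"
| "compile (x ::= e) q = cexp e 0 @ [Const 5 0, Add (2*x) 3 5]"
| "compile (Write b e f) q = cexp e 0 @
     [Add 3 3 3, Add 3 3 3, Add 3 3 3, Add 3 3 3, Const 5 (aid b), Add 3 3 5, Add 3 3 1] @ cexp f 1 @ [Store 3 5]"
| "compile (c ;; d) q = (let c' = compile c q in c' @ compile d (q + length c'))"
| "compile (Cond e c d) q =
    (let c' = compile c (q + ecost e + 1); d' = compile d (q + ecost e + 2 + length c') in
     cexp e 0 @ [JumpZ 3 (q + ecost e + 2 + length c')] @ c' @
     [Jump (q + ecost e + 2 + length c' + length d')] @ d')"
| "compile (While e c) q =
    (let c' = compile c (q + ecost e + 1) in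
     cexp e 0 @ [JumpZ 3 (q + ecost e + 2 + length c')] @ c' @ [Jump q])"

fun straight :: "instr \<Rightarrow> bool" where
  "straight (Jump p) = False"
| "straight (JumpZ r p) = False"
| "straight _ = True"

definition exec_all :: "instr list \<Rightarrow> config \<Rightarrow> config" where
  "exec_all is s = fold exec is s"

lemma exec_all_simps [simp]:
  "exec_all [] s = s" "exec_all (i # is) s = exec_all is (exec i s)"
  "exec_all (is @ js) s = exec_all js (exec_all is s)"
  by (auto simp: exec_all_def)

lemma pc_exec: "straight i \<Longrightarrow> pc (exec i s) = Suc (pc s)"
  by (cases i) (auto simp: set_reg_def)

lemma steps_exec_all:
  "\<forall>i \<in> set is. straight i \<Longrightarrow> pc s = length pre \<Longrightarrow>
   (step (pre @ is @ post) ^^ length is) s = exec_all is s \<and>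
   pc (exec_all is s) = length pre + length is"
proof (induction "is" arbitrary: pre s)
  case (Cons i "is")
  have st: "step (pre @ (i # is) @ post) s = exec i s"
    using Cons.prems by (simp add: step_def halted_def)
  have pc: "pc (exec i s) = length (pre @ [i])"
    using Cons.prems pc_exec by simp
  show ?case using Cons.IH[OF _ pc] Cons.prems st
    by (simp add: funpow_Suc_right del: funpow.simps)
qed simp

text \<open>The program counter and the temporaries are left free, so the relation survives
  expression evaluation and jumps.\<close>

definition sim :: "nat list \<Rightarrow> vars \<Rightarrow> arrs \<Rightarrow> config \<Rightarrow> bool" where
  "sim xs v a s \<longleftrightarrow> (\<forall>x. reg s (2*x) = v x) \<and> reg s 1 = length xs \<and>
    (\<forall>i < length xs. mem s i = xs ! i) \<and>
    (\<forall>b i. mem s (length xs + 16 * i + aid b) = a b i)"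

lemma aid_less: "aid b < 16"
  by (cases b) auto

lemma aid_inj: "aid b = aid c \<longleftrightarrow> b = c"
  by (cases b; cases c) auto

lemma address_inj: "16 * i + aid b = 16 * j + aid c \<longleftrightarrow> i = j \<and> b = c"
proof -
  have "16 * i + p = 16 * j + q \<longleftrightarrow> i = j \<and> p = q" if "p < 16" "q < 16" for p q :: nat
    using that by presburger
  from this[OF aid_less aid_less] show ?thesis by (simp add: aid_inj)
qed

lemma straight_cexp: "i \<in> set (cexp e t) \<Longrightarrow> straight i"
  by (induction e arbitrary: t) auto

lemma even_reg_neq: "2 * x \<noteq> 2 * t + (3::nat)"
  by presburger

lemma next_temp: "2 * Suc t + 3 = 2 * t + 5"
  by simp

text \<open>Evaluation at level \<open>t\<close> spares all registers below \<open>2*t+3\<close>, so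
  the value of a left operand survives the evaluation of the right operand one level higher.\<close>

lemma exec_cexp:
  assumes "xs \<noteq> []" "sim xs v a s"
  shows "reg (exec_all (cexp e t) s) (2*t+3) = eval xs v a e \<and>
    mem (exec_all (cexp e t) s) = mem s \<and>
    (\<forall>r. r < 2*t+3 \<or> even r \<longrightarrow> reg (exec_all (cexp e t) s) r = reg s r)"
  using assms(2)
proof (induction e arbitrary: t s)
  case (N n)
  then show ?case by (auto simp: set_reg_def)
next
  case (V x)
  then show ?case using even_reg_neq by (auto simp: set_reg_def sim_def)
next
  case (Plus e f)
  let ?s = "exec_all (cexp e t) s"
  have s: "sim xs v a ?s" using Plus.IH(1)[OF Plus.prems, of t] Plus.prems by (auto simp: sim_def)
  show ?case using Plus.IH(1)[OF Plus.prems, of t] Plus.IH(2)[OF s, of "Suc t", unfolded next_temp]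
    by (auto simp: set_reg_def)
next
  case (Minus e f)
  let ?s = "exec_all (cexp e t) s"
  have s: "sim xs v a ?s" using Minus.IH(1)[OF Minus.prems, of t] Minus.prems by (auto simp: sim_def)
  show ?case using Minus.IH(1)[OF Minus.prems, of t] Minus.IH(2)[OF s, of "Suc t", unfolded next_temp]
    by (auto simp: set_reg_def)
next
  case (In e)
  let ?s = "exec_all (cexp e t) s"
  have s: "sim xs v a ?s" using In.IH(1)[OF In.prems, of t] In.prems by (auto simp: sim_def)
  \<comment> \<open>Two truncated subtractions compute the minimum, which is the clamping of
    \<open>In\<close>.\<close>
  have eq: "i - (i - (length xs - Suc 0)) = min i (length xs - Suc 0)" for i by auto
  have "min i (length xs - Suc 0) < length xs" for i using assms(1) by (simp add: min_less_iff_disj)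
  then show ?case using In.IH(1)[OF In.prems, of t] s
    by (auto simp: set_reg_def sim_def eq)
next
  case (Rd b e)
  let ?s = "exec_all (cexp e t) s"
  have s: "sim xs v a ?s" using Rd.IH(1)[OF Rd.prems, of t] Rd.prems by (auto simp: sim_def)
  \<comment> \<open>Four successive doublings multiply by the stride 16.\<close>
  have eq: "i + i + (i + i) + (i + i + (i + i)) + (i + i + (i + i) + (i + i + (i + i))) + aid b + length xs
      = length xs + 16 * i + aid b" for i by auto
  show ?case using Rd.IH(1)[OF Rd.prems, of t] s
    by (auto simp: set_reg_def sim_def eq)
qed

lemma funpow_step_trans:
  "(step P ^^ t) s = s' \<Longrightarrow> (step P ^^ t') s' = s'' \<Longrightarrow> (step P ^^ (t + t')) s = s''"
  by (metis add.commute comp_apply funpow_add)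

lemma exec_block:
  assumes "P = pre @ is @ post" "pc s = length pre" "\<forall>i \<in> set is. straight i"
  shows "(step P ^^ length is) s = exec_all is s"
    and "pc (exec_all is s) = length pre + length is"
  using steps_exec_all[of "is" s pre post] assms by auto

lemma sim_cexp:
  assumes "xs \<noteq> []" "sim xs v a s"
  shows "sim xs v a (exec_all (cexp e t) s)"
  using exec_cexp[OF assms, of e t] assms(2) by (auto simp: sim_def)

lemma sim_pc [simp]: "sim xs v a (s\<lparr>pc := p\<rparr>) = sim xs v a s"
  by (simp add: sim_def)

lemma step_at:
  assumes "P = pre @ i # post" "pc s = length pre"
  shows "step P s = exec i s"
  using assms by (simp add: step_def halted_def)

text \<open>The code may stand between arbitrary \<open>pre\<close> and \<open>post\<close>. This
  generality lets the induction hypotheses apply to subprograms in place, and to the second run of a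
  loop at the same address as the first.\<close>

theorem runs_comp:
  assumes "runs xs c v a t v' a'" "xs \<noteq> []" "sim xs v a s"
    and "P = pre @ compile c (length pre) @ post" "pc s = length pre"
  shows "\<exists>s'. (step P ^^ t) s = s' \<and> pc s' = length pre + length (compile c (length pre)) \<and> sim xs v' a' s'"
  using assms
proof (induction arbitrary: s pre post rule: runs.induct)
  case (Skip v a)
  then show ?case by simp
next
  case (Assign x e v a)
  let ?is = "compile (x ::= e) (length pre)"
  have st: "\<forall>i \<in> set ?is. straight i" using straight_cexp by auto
  note b = exec_block[OF Assign.prems(3,4) st]
  have "sim xs (v(x := eval xs v a e)) a (exec_all ?is s)"
    using sim_cexp[OF Assign.prems(1,2), of e 0] exec_cexp[OF Assign.prems(1,2), of e 0]
      even_reg_neq[of _ 1]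
    by (auto simp: sim_def set_reg_def)
  moreover have "length ?is = ecost e + 2" by simp
  ultimately show ?case using b by metis
next
  case (Write b e f v a)
  let ?is = "compile (Write b e f) (length pre)"
  have st: "\<forall>i \<in> set ?is. straight i" using straight_cexp by auto
  note bl = exec_block[OF Write.prems(3,4) st]
  let ?s = "exec_all ([Add 3 3 3, Add 3 3 3, Add 3 3 3, Add 3 3 3, Const 5 (aid b), Add 3 3 5, Add 3 3 1]) (exec_all (cexp e 0) s)"
  have r: "reg ?s 3 = length xs + 16 * eval xs v a e + aid b \<and> mem ?s = mem s \<and>
      (\<forall>r. r \<noteq> 3 \<and> r \<noteq> 5 \<longrightarrow> reg ?s r = reg (exec_all (cexp e 0) s) r)"
    using sim_cexp[OF Write.prems(1,2), of e 0] exec_cexp[OF Write.prems(1,2), of e 0]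
    by (auto simp: sim_def set_reg_def)
  have s: "sim xs v a ?s"
    using sim_cexp[OF Write.prems(1,2), of e 0] exec_cexp[OF Write.prems(1,2), of e 0] r
      even_reg_neq[of _ 0] even_reg_neq[of _ 1] by (simp add: sim_def)
  have ad: "length xs + 16 * i + aid c = length xs + 16 * j + aid d \<longleftrightarrow> i = j \<and> c = d" for i c j d
    using address_inj[of i c j d] by (simp add: add.assoc)
  have fin: "exec_all ?is s = exec (Store 3 5) (exec_all (cexp f 1) ?s)"
    by simp
  have "sim xs v (a(b := (a b)(eval xs v a e := eval xs v a f))) (exec_all ?is s)"
    unfolding fin using exec_cexp[OF Write.prems(1) s, of f 1] s r
    by (auto simp: sim_def ad)
  moreover have "length ?is = ecost e + ecost f + 8" by simp
  ultimately show ?case using bl by metis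
next
  case (Seq c v a t v' a' d t' v'' a'')
  from Seq.IH(1)[OF Seq.prems(1,2), of pre "compile d (length pre + length (compile c (length pre))) @ post"]
  obtain s' where s': "(step P ^^ t) s = s'" "pc s' = length pre + length (compile c (length pre))"
    "sim xs v' a' s'" using Seq.prems(3,4) by (auto simp: Let_def)
  from Seq.IH(2)[OF Seq.prems(1) s'(3), of "pre @ compile c (length pre)" post]
  obtain s'' where s'': "(step P ^^ t') s' = s''"
    "pc s'' = length pre + length (compile (c ;; d) (length pre))"
    "sim xs v'' a'' s''" using Seq.prems(3) s'(2) by (auto simp: Let_def)
  show ?case using funpow_step_trans[OF s'(1) s''(1)] s'' by blast
next
  case (CondT v a e c t v' a' d)
  define c' where "c' = compile c (length pre + ecost e + 1)"
  define d' where "d' = compile d (length pre + ecost e + 2 + length c')"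
  have P: "P = pre @ cexp e 0 @ (JumpZ 3 (length pre + ecost e + 2 + length c')) # c' @
      Jump (length pre + ecost e + 2 + length c' + length d') # d' @ post"
    using CondT.prems(3) by (simp add: c'_def d'_def Let_def)
  define s1 where "s1 = exec_all (cexp e 0) s"
  have s1: "(step P ^^ ecost e) s = s1" "pc s1 = length pre + ecost e" "sim xs v a s1"
    "reg s1 3 \<noteq> 0"
    using exec_block[OF P CondT.prems(4)] sim_cexp[OF CondT.prems(1,2), of e 0] straight_cexp
      exec_cexp[OF CondT.prems(1,2), of e 0] CondT.hyps(1) by (auto simp: s1_def)
  define s2 where "s2 = s1\<lparr>pc := Suc (pc s1)\<rparr>"
  have "step P s1 = s2"
    using step_at[of P "pre @ cexp e 0"] P s1 by (simp add: s2_def)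
  then have s2: "(step P ^^ (ecost e + 1)) s = s2"
    using funpow_step_trans[OF s1(1), of 1 s2] by simp
  from CondT.IH[OF CondT.prems(1), of s2 "pre @ cexp e 0 @ [JumpZ 3 (length pre + ecost e + 2 + length c')]"
      "Jump (length pre + ecost e + 2 + length c' + length d') # d' @ post"]
  obtain s3 where s3: "(step P ^^ t) s2 = s3" "pc s3 = length pre + ecost e + 1 + length c'" "sim xs v' a' s3"
    using P s1 by (auto simp: s2_def c'_def)
  define s4 where "s4 = s3\<lparr>pc := length pre + ecost e + 2 + length c' + length d'\<rparr>"
  have "step P s3 = s4"
    using step_at[of P "pre @ cexp e 0 @ JumpZ 3 (length pre + ecost e + 2 + length c') # c'"] P s3
    by (simp add: s4_def)
  then have "(step P ^^ (ecost e + 1 + (t + 1))) s = s4"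
    using funpow_step_trans[OF s2 funpow_step_trans[OF s3(1), of 1 s4]] by simp
  then show ?case using s3(3) by (auto simp: s4_def c'_def d'_def Let_def add_ac)
next
  case (CondF v a e d t v' a' c)
  define c' where "c' = compile c (length pre + ecost e + 1)"
  define d' where "d' = compile d (length pre + ecost e + 2 + length c')"
  have P: "P = pre @ cexp e 0 @ (JumpZ 3 (length pre + ecost e + 2 + length c')) # c' @
      Jump (length pre + ecost e + 2 + length c' + length d') # d' @ post"
    using CondF.prems(3) by (simp add: c'_def d'_def Let_def)
  define s1 where "s1 = exec_all (cexp e 0) s"
  have s1: "(step P ^^ ecost e) s = s1" "pc s1 = length pre + ecost e" "sim xs v a s1"
    "reg s1 3 = 0"
    using exec_block[OF P CondF.prems(4)] sim_cexp[OF CondF.prems(1,2), of e 0] straight_cexp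
      exec_cexp[OF CondF.prems(1,2), of e 0] CondF.hyps(1) by (auto simp: s1_def)
  define s2 where "s2 = s1\<lparr>pc := length pre + ecost e + 2 + length c'\<rparr>"
  have "step P s1 = s2"
    using step_at[of P "pre @ cexp e 0"] P s1 by (simp add: s2_def)
  then have s2: "(step P ^^ (ecost e + 1)) s = s2"
    using funpow_step_trans[OF s1(1), of 1 s2] by simp
  define pre2 where "pre2 = pre @ cexp e 0 @ JumpZ 3 (length pre + ecost e + 2 + length c') # c' @
      [Jump (length pre + ecost e + 2 + length c' + length d')]"
  have len: "length pre2 = length pre + ecost e + 2 + length c'" by (simp add: pre2_def)
  have P2: "P = pre2 @ compile d (length pre2) @ post"
    unfolding len d'_def[symmetric] using P by (simp add: pre2_def)
  have "sim xs v a s2" "pc s2 = length pre2" using s1(3) by (simp_all add: s2_def len)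
  from CondF.IH[OF CondF.prems(1) this(1) P2 this(2)]
  obtain s3 where s3: "(step P ^^ t) s2 = s3"
    "pc s3 = length pre + ecost e + 2 + length c' + length d'" "sim xs v' a' s3"
    unfolding len d'_def[symmetric] by blast
  have "(step P ^^ (ecost e + 1 + t)) s = s3"
    using funpow_step_trans[OF s2 s3(1)] by simp
  then show ?case using s3 by (auto simp: c'_def d'_def Let_def add_ac)
next
  case (WhileF v a e c)
  define c' where "c' = compile c (length pre + ecost e + 1)"
  have P: "P = pre @ cexp e 0 @ (JumpZ 3 (length pre + ecost e + 2 + length c')) # c' @
      Jump (length pre) # post"
    using WhileF.prems(3) by (simp add: c'_def Let_def)
  define s1 where "s1 = exec_all (cexp e 0) s"
  have s1: "(step P ^^ ecost e) s = s1" "pc s1 = length pre + ecost e" "sim xs v a s1"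
    "reg s1 3 = 0"
    using exec_block[OF P WhileF.prems(4)] sim_cexp[OF WhileF.prems(1,2), of e 0] straight_cexp
      exec_cexp[OF WhileF.prems(1,2), of e 0] WhileF.hyps(1) by (auto simp: s1_def)
  define s2 where "s2 = s1\<lparr>pc := length pre + ecost e + 2 + length c'\<rparr>"
  have "step P s1 = s2"
    using step_at[of P "pre @ cexp e 0"] P s1 by (simp add: s2_def)
  then have "(step P ^^ (ecost e + 1)) s = s2"
    using funpow_step_trans[OF s1(1), of 1 s2] by simp
  then show ?case using s1(3) by (auto simp: s2_def c'_def Let_def)
next
  case (WhileT v a e c t v' a' t' v'' a'')
  define c' where "c' = compile c (length pre + ecost e + 1)"
  have P: "P = pre @ cexp e 0 @ (JumpZ 3 (length pre + ecost e + 2 + length c')) # c' @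
      Jump (length pre) # post"
    using WhileT.prems(3) by (simp add: c'_def Let_def)
  define s1 where "s1 = exec_all (cexp e 0) s"
  have s1: "(step P ^^ ecost e) s = s1" "pc s1 = length pre + ecost e" "sim xs v a s1"
    "reg s1 3 \<noteq> 0"
    using exec_block[OF P WhileT.prems(4)] sim_cexp[OF WhileT.prems(1,2), of e 0] straight_cexp
      exec_cexp[OF WhileT.prems(1,2), of e 0] WhileT.hyps(1) by (auto simp: s1_def)
  define s2 where "s2 = s1\<lparr>pc := Suc (pc s1)\<rparr>"
  have "step P s1 = s2"
    using step_at[of P "pre @ cexp e 0"] P s1 by (simp add: s2_def)
  then have s2: "(step P ^^ (ecost e + 1)) s = s2"
    using funpow_step_trans[OF s1(1), of 1 s2] by simp
  from WhileT.IH(1)[OF WhileT.prems(1), of s2 "pre @ cexp e 0 @ [JumpZ 3 (length pre + ecost e + 2 + length c')]"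
      "Jump (length pre) # post"]
  obtain s3 where s3: "(step P ^^ t) s2 = s3" "pc s3 = length pre + ecost e + 1 + length c'" "sim xs v' a' s3"
    using P s1 by (auto simp: s2_def c'_def)
  define s4 where "s4 = s3\<lparr>pc := length pre\<rparr>"
  have "step P s3 = s4"
    using step_at[of P "pre @ cexp e 0 @ JumpZ 3 (length pre + ecost e + 2 + length c') # c'"] P s3
    by (simp add: s4_def)
  then have s4: "(step P ^^ (ecost e + 1 + (t + 1))) s = s4"
    using funpow_step_trans[OF s2 funpow_step_trans[OF s3(1), of 1 s4]] by simp
  from WhileT.IH(2)[OF WhileT.prems(1), of s4 pre post] s3(3) WhileT.prems(3)
  obtain s5 where s5: "(step P ^^ t') s4 = s5"
    "pc s5 = length pre + length (compile (While e c) (length pre))" "sim xs v'' a'' s5"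
    by (auto simp: s4_def)
  have "(step P ^^ (ecost e + 2 + t + t')) s = s5"
    using funpow_step_trans[OF s4 s5(1)] by (simp add: add_ac)
  then show ?case using s5 by blast
qed

text \<open>The prelude saves the input length in register 1, where array addressing expects it. It
  occupies two cells, hence the start address 2 and the two extra steps.\<close>

definition machine :: "com \<Rightarrow> program" where
  "machine c = [Const 1 0, Add 1 0 1] @ compile c 2"

lemma funpow_step_halted: "halted P s \<Longrightarrow> (step P ^^ t) s = s"
  by (induction t) (auto simp: step_def)

text \<open>The run takes an exact time, but a halted configuration is a fixed point, so any larger
  \<open>T\<close> will do.\<close>

theorem outputs_machine:
  assumes "xs \<noteq> []"
    and "wp xs c (\<lambda>v a t. v 0 = y \<and> t + 2 \<le> T) ((\<lambda>_. 0)(0 := length xs)) (\<lambda>_ _. 0) 0"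
  shows "outputs_within (machine c) xs T y"
proof -
  let ?v = "(\<lambda>_. 0)(0 := length xs) :: vars"
  let ?P = "machine c"
  from assms(2) obtain t v a where r: "runs xs c ?v (\<lambda>_ _. 0) t v a" and y: "v 0 = y" and t: "t + 2 \<le> T"
    unfolding wp_def by auto
  let ?is = "[Const 1 0, Add 1 0 1]"
  define s where "s = exec_all ?is (init xs)"
  have P: "?P = [] @ ?is @ compile c 2" by (simp add: machine_def)
  have s: "(step ?P ^^ 2) (init xs) = s" "pc s = 2"
    using exec_block[OF P, of "init xs"] by (auto simp: s_def init_def numeral_2_eq_2)
  have "sim xs ?v (\<lambda>_ _. 0) s"
    by (auto simp: s_def sim_def init_def set_reg_def)
  from runs_comp[OF r assms(1) this, of ?P ?is "[]"] obtain s'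
    where s': "(step ?P ^^ t) s = s'" "pc s' = length ?P" "sim xs v a s'"
    using s(2) by (auto simp: machine_def numeral_2_eq_2)
  have "(step ?P ^^ (2 + t)) (init xs) = s'"
    using funpow_step_trans[OF s(1) s'(1)] .
  then have "(step ?P ^^ (2 + t + (T - (2 + t)))) (init xs) = s'"
    by (rule funpow_step_trans) (simp add: funpow_step_halted halted_def s'(2))
  then have "(step ?P ^^ T) (init xs) = s'" using t
    by (metis add.commute le_add_diff_inverse)
  moreover have "reg s' 0 = y" using s'(3) y unfolding sim_def by (metis mult_0_right)
  ultimately show ?thesis using s'(2) by (simp add: outputs_within_def halted_def)
qed

section \<open>Refutations\<close>

text \<open>A refutation assigns to each play of the existential player (a total assignment \<open>\<rho>\<close>) a clause
  that the universal player falsifies. A universal variable must be set in the same way in two plays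
  unless they differ at an existential variable further left.\<close>

definition refutes :: "quant list \<Rightarrow> matrix \<Rightarrow> nat \<Rightarrow> (nat \<Rightarrow> bool) \<Rightarrow> ((nat \<Rightarrow> bool) \<Rightarrow> clause) \<Rightarrow> bool" where
  "refutes Q \<phi> i \<sigma> S \<longleftrightarrow>
    (\<forall>\<rho>. S \<rho> \<in> set \<phi> \<and> (\<forall>l \<in> set (S \<rho>). (var l < i \<longrightarrow> \<not> lit_true \<sigma> l) \<and>
       (i \<le> var l \<longrightarrow> Q ! var l = Exists \<longrightarrow> \<not> lit_true \<rho> l))) \<and>
    (\<forall>\<rho> \<rho>' u. i \<le> u \<longrightarrow> Q ! u = Forall \<longrightarrow> Pos u \<in> set (S \<rho>) \<longrightarrow> Neg u \<in> set (S \<rho>') \<longrightarrow>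
       (\<exists>e. i \<le> e \<and> e < u \<and> Q ! e = Exists \<and> \<rho> e \<noteq> \<rho>' e))"

lemma lit_true_cong: "\<sigma> (var l) = \<rho> (var l) \<Longrightarrow> lit_true \<sigma> l = lit_true \<rho> l"
  by (cases l) auto

lemma refutes_clash:
  assumes "refutes Q \<phi> i \<sigma> S" "i \<le> u" "Q ! u = Forall" "Pos u \<in> set (S \<rho>)" "Neg u \<in> set (S \<rho>')"
  shows "\<exists>e. i \<le> e \<and> e < u \<and> Q ! e = Exists \<and> \<rho> e \<noteq> \<rho>' e"
  using assms unfolding refutes_def by blast

text \<open>A refutation for each value of variable \<open>i\<close> is a refutation of both: the
  play tells the value \<open>\<rho> i\<close>, and two plays that differ at \<open>i\<close> owe
  each other no consistency, as \<open>i\<close> lies to the left of all remaining universal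
  variables. Conversely, overwrite \<open>i\<close> by \<open>b\<close> in every play.\<close>

lemma refutes_Exists:
  assumes "Q ! i = Exists"
  shows "(\<exists>S. refutes Q \<phi> i \<sigma> S) \<longleftrightarrow> (\<forall>b. \<exists>S. refutes Q \<phi> (Suc i) (\<sigma>(i := b)) S)"
proof
  assume "\<exists>S. refutes Q \<phi> i \<sigma> S"
  then obtain S where S: "refutes Q \<phi> i \<sigma> S" ..
  show "\<forall>b. \<exists>S. refutes Q \<phi> (Suc i) (\<sigma>(i := b)) S"
  proof
    fix b
    have "refutes Q \<phi> (Suc i) (\<sigma>(i := b)) (\<lambda>\<rho>. S (\<rho>(i := b)))"
      unfolding refutes_def
    proof (intro conjI allI ballI impI)
      fix \<rho> show "S (\<rho>(i := b)) \<in> set \<phi>" using S by (simp add: refutes_def)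
    next
      fix \<rho> l assume l: "l \<in> set (S (\<rho>(i := b)))" "var l < Suc i"
      show "\<not> lit_true (\<sigma>(i := b)) l"
      proof (cases "var l = i")
        case True
        then have "\<not> lit_true (\<rho>(i := b)) l" using S l assms by (auto simp: refutes_def)
        then show ?thesis using True lit_true_cong[of "\<rho>(i := b)" l "\<sigma>(i := b)"] by simp
      next
        case False
        then have "\<not> lit_true \<sigma> l" using S l assms by (auto simp: refutes_def)
        then show ?thesis using False lit_true_cong[of \<sigma> l "\<sigma>(i := b)"] by simp
      qed
    next
      fix \<rho> l assume l: "l \<in> set (S (\<rho>(i := b)))" "Suc i \<le> var l" "Q ! var l = Exists"
      then have "\<not> lit_true (\<rho>(i := b)) l" using S by (auto simp: refutes_def)
      then show "\<not> lit_true \<rho> l" using l lit_true_cong[of \<rho> l "\<rho>(i := b)"] by simp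
    next
      fix \<rho> \<rho>' u
      assume "Suc i \<le> u" "Q ! u = Forall" "Pos u \<in> set (S (\<rho>(i := b)))" "Neg u \<in> set (S (\<rho>'(i := b)))"
      then obtain e where "i \<le> e" "e < u" "Q ! e = Exists" "(\<rho>(i := b)) e \<noteq> (\<rho>'(i := b)) e"
        using refutes_clash[OF S, of u "\<rho>(i := b)" "\<rho>'(i := b)"] by auto
      then show "\<exists>e\<ge>Suc i. e < u \<and> Q ! e = Exists \<and> \<rho> e \<noteq> \<rho>' e"
        by (intro exI[of _ e]) (auto split: if_splits)
    qed
    then show "\<exists>S. refutes Q \<phi> (Suc i) (\<sigma>(i := b)) S" by blast
  qed
next
  assume "\<forall>b. \<exists>S. refutes Q \<phi> (Suc i) (\<sigma>(i := b)) S"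
  then obtain S where S: "\<And>b. refutes Q \<phi> (Suc i) (\<sigma>(i := b)) (S b)" by metis
  have "refutes Q \<phi> i \<sigma> (\<lambda>\<rho>. S (\<rho> i) \<rho>)"
    unfolding refutes_def
  proof (intro conjI allI ballI impI)
    fix \<rho> show "S (\<rho> i) \<rho> \<in> set \<phi>" using S by (simp add: refutes_def)
  next
    fix \<rho> l assume l: "l \<in> set (S (\<rho> i) \<rho>)" "var l < i"
    then have "\<not> lit_true (\<sigma>(i := \<rho> i)) l" using S[of "\<rho> i"] by (auto simp: refutes_def)
    then show "\<not> lit_true \<sigma> l" using l lit_true_cong[of \<sigma> l "\<sigma>(i := \<rho> i)"] by simp
  next
    fix \<rho> l assume l: "l \<in> set (S (\<rho> i) \<rho>)" "i \<le> var l" "Q ! var l = Exists"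
    show "\<not> lit_true \<rho> l"
    proof (cases "var l = i")
      case True
      then have "\<not> lit_true (\<sigma>(i := \<rho> i)) l" using S[of "\<rho> i"] l by (auto simp: refutes_def)
      then show ?thesis using True lit_true_cong[of \<rho> l "\<sigma>(i := \<rho> i)"] by simp
    next
      case False
      then show ?thesis using S[of "\<rho> i"] l by (auto simp: refutes_def)
    qed
  next
    fix \<rho> \<rho>' u
    assume u: "i \<le> u" "Q ! u = Forall" "Pos u \<in> set (S (\<rho> i) \<rho>)" "Neg u \<in> set (S (\<rho>' i) \<rho>')"
    with assms have iu: "Suc i \<le> u" by (metis le_eq_less_or_eq not_less_eq_eq quant.distinct(1) verit_comp_simplify1(3))
    show "\<exists>e\<ge>i. e < u \<and> Q ! e = Exists \<and> \<rho> e \<noteq> \<rho>' e"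
    proof (cases "\<rho> i = \<rho>' i")
      case True
      then have "Neg u \<in> set (S (\<rho> i) \<rho>')" using u(4) by simp
      from refutes_clash[OF S iu u(2,3) this]
      obtain e where "Suc i \<le> e" "e < u" "Q ! e = Exists" "\<rho> e \<noteq> \<rho>' e" by blast
      then show ?thesis by (intro exI[of _ e]) auto
    next
      case False
      then show ?thesis using assms iu by (intro exI[of _ i]) auto
    qed
  qed
  then show "\<exists>S. refutes Q \<phi> i \<sigma> S" by blast
qed

text \<open>No remaining existential variable lies to the left of \<open>i\<close>, so its two
  literals cannot both occur among the chosen clauses. Hence one value \<open>b\<close> falsifies
  all its occurrences: false if \<open>Pos i\<close> occurs, true otherwise.\<close>

lemma refutes_Forall:
  assumes "Q ! i = Forall"
  shows "(\<exists>S. refutes Q \<phi> i \<sigma> S) \<longleftrightarrow> (\<exists>b. \<exists>S. refutes Q \<phi> (Suc i) (\<sigma>(i := b)) S)"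
proof
  assume "\<exists>S. refutes Q \<phi> i \<sigma> S"
  then obtain S where S: "refutes Q \<phi> i \<sigma> S" ..
  define b where "b = (\<nexists>\<rho>. Pos i \<in> set (S \<rho>))"
  have b: "\<not> lit_true (\<sigma>(i := b)) l" if "l \<in> set (S \<rho>)" "var l = i" for l \<rho>
  proof (cases l)
    case (Pos x)
    then show ?thesis using that by (auto simp: b_def)
  next
    case (Neg x)
    then have "Pos i \<notin> set (S \<rho>')" for \<rho>'
      using S assms that unfolding refutes_def by (metis leD literal.sel(2) order_refl)
    then show ?thesis using that Neg by (auto simp: b_def)
  qed
  have "refutes Q \<phi> (Suc i) (\<sigma>(i := b)) S"
    unfolding refutes_def
  proof (intro conjI allI ballI impI)
    fix \<rho> show "S \<rho> \<in> set \<phi>" using S by (simp add: refutes_def)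
  next
    fix \<rho> l assume l: "l \<in> set (S \<rho>)" "var l < Suc i"
    show "\<not> lit_true (\<sigma>(i := b)) l"
    proof (cases "var l = i")
      case True
      then show ?thesis using b l by blast
    next
      case False
      then have "\<not> lit_true \<sigma> l" using S l by (auto simp: refutes_def)
      then show ?thesis using False lit_true_cong[of \<sigma> l "\<sigma>(i := b)"] by simp
    qed
  next
    fix \<rho> l assume "l \<in> set (S \<rho>)" "Suc i \<le> var l" "Q ! var l = Exists"
    then show "\<not> lit_true \<rho> l" using S by (auto simp: refutes_def)
  next
    fix \<rho> \<rho>' u
    assume "Suc i \<le> u" "Q ! u = Forall" "Pos u \<in> set (S \<rho>)" "Neg u \<in> set (S \<rho>')"
    then obtain e where e: "i \<le> e" "e < u" "Q ! e = Exists" "\<rho> e \<noteq> \<rho>' e"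
      using refutes_clash[OF S, of u \<rho> \<rho>'] by auto
    then have "e \<noteq> i" using assms by auto
    then show "\<exists>e\<ge>Suc i. e < u \<and> Q ! e = Exists \<and> \<rho> e \<noteq> \<rho>' e"
      using e by (intro exI[of _ e]) auto
  qed
  then show "\<exists>b. \<exists>S. refutes Q \<phi> (Suc i) (\<sigma>(i := b)) S" by blast
next
  assume "\<exists>b. \<exists>S. refutes Q \<phi> (Suc i) (\<sigma>(i := b)) S"
  then obtain b S where S: "refutes Q \<phi> (Suc i) (\<sigma>(i := b)) S" by blast
  have "refutes Q \<phi> i \<sigma> S"
    unfolding refutes_def
  proof (intro conjI allI ballI impI)
    fix \<rho> show "S \<rho> \<in> set \<phi>" using S by (simp add: refutes_def)
  next
    fix \<rho> l assume l: "l \<in> set (S \<rho>)" "var l < i"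
    then have "\<not> lit_true (\<sigma>(i := b)) l" using S by (auto simp: refutes_def)
    then show "\<not> lit_true \<sigma> l" using l lit_true_cong[of \<sigma> l "\<sigma>(i := b)"] by simp
  next
    fix \<rho> l assume l: "l \<in> set (S \<rho>)" "i \<le> var l" "Q ! var l = Exists"
    then have "var l \<noteq> i" using assms by auto
    then show "\<not> lit_true \<rho> l" using S l by (auto simp: refutes_def)
  next
    fix \<rho> \<rho>' u
    assume u: "i \<le> u" "Q ! u = Forall" "Pos u \<in> set (S \<rho>)" "Neg u \<in> set (S \<rho>')"
    have "u \<noteq> i"
    proof
      assume ui: "u = i"
      have "\<not> lit_true (\<sigma>(i := b)) (Pos u)" "\<not> lit_true (\<sigma>(i := b)) (Neg u)"
        using S u ui unfolding refutes_def by (metis lessI literal.sel)+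
      then show False by simp
    qed
    then have "Suc i \<le> u" using u by simp
    then obtain e where "Suc i \<le> e" "e < u" "Q ! e = Exists" "\<rho> e \<noteq> \<rho>' e"
      using S u unfolding refutes_def by metis
    then show "\<exists>e\<ge>i. e < u \<and> Q ! e = Exists \<and> \<rho> e \<noteq> \<rho>' e"
      by (intro exI[of _ e]) auto
  qed
  then show "\<exists>S. refutes Q \<phi> i \<sigma> S" by blast
qed

text \<open>The induction starts at the innermost level, where every variable is assigned and a
  single falsified clause can serve all plays.\<close>

lemma not_prefix_true_iff_refutes:
  assumes "\<forall>C \<in> set \<phi>. \<forall>l \<in> set C. var l < length Q" "i \<le> length Q"
  shows "\<not> prefix_true i (drop i Q) \<sigma> \<phi> \<longleftrightarrow> (\<exists>S. refutes Q \<phi> i \<sigma> S)"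
  using assms(2)
proof (induction arbitrary: \<sigma> rule: inc_induct)
  case base
  have "(\<exists>S. refutes Q \<phi> (length Q) \<sigma> S) \<longleftrightarrow> \<not> matrix_true \<sigma> \<phi>"
  proof
    assume "\<exists>S. refutes Q \<phi> (length Q) \<sigma> S"
    then show "\<not> matrix_true \<sigma> \<phi>" using assms(1) unfolding refutes_def matrix_true_def by metis
  next
    assume "\<not> matrix_true \<sigma> \<phi>"
    then obtain C where "C \<in> set \<phi>" "\<forall>l \<in> set C. \<not> lit_true \<sigma> l"
      by (auto simp: matrix_true_def)
    then have "refutes Q \<phi> (length Q) \<sigma> (\<lambda>_. C)"
      using assms(1) unfolding refutes_def by (metis leD literal.sel(1))
    then show "\<exists>S. refutes Q \<phi> (length Q) \<sigma> S" by blast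
  qed
  then show ?case by simp
next
  case (step i)
  have d: "drop i Q = Q ! i # drop (Suc i) Q" using step.hyps by (simp add: Cons_nth_drop_Suc)
  show ?case
  proof (cases "Q ! i")
    case Forall
    then show ?thesis unfolding d Forall prefix_true.simps refutes_Forall[OF Forall] step.IH[symmetric] by blast
  next
    case Exists
    then show ?thesis unfolding d Exists prefix_true.simps refutes_Exists[OF Exists] step.IH[symmetric] by blast
  qed
qed

section \<open>Numbering the copies of literals\<close>

fun lit_sign :: "literal \<Rightarrow> nat" where
  "lit_sign (Pos v) = 1"
| "lit_sign (Neg v) = 0"

lemma encode_literal_eq: "encode_literal l = [var l, lit_sign l]"
  by (cases l) auto

text \<open>An assignment of the existential variables is a number \<open>z\<close> whose bit
  \<open>i\<close> is the value of \<open>ev ! i\<close>. The default 0 elsewhere makes plays built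
  from two numbers agree off \<open>ev\<close>.\<close>

definition ev_val :: "nat list \<Rightarrow> nat \<Rightarrow> nat \<Rightarrow> nat" where
  "ev_val ev z v = (if \<exists>i < length ev. ev ! i = v \<and> odd (z div 2 ^ i) then 1 else 0)"

text \<open>Numbers a universal variable together with the values of the listed existential
  variables to its left, by appending binary digits to \<open>u + 1\<close>. Digits for variables
  not to the left of \<open>u\<close> are 0, so all keys have equally many appended digits; starting
  from \<open>u + 1\<close> keeps 0 free.\<close>

definition key :: "nat list \<Rightarrow> nat \<Rightarrow> nat \<Rightarrow> nat" where
  "key ev z u = foldl (\<lambda>x e. 2 * x + (if e < u then ev_val ev z e else 0)) (u + 1) ev"

text \<open>Code \<open>2 * x + s\<close> says that the copy \<open>x\<close> of a universal variable takes the value falsifying a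
  literal of sign \<open>s\<close>. Copy 0 belongs to no variable: code 0 stands for a falsified existential
  literal and code 1 for a satisfied one.\<close>

definition code :: "quant list \<Rightarrow> nat list \<Rightarrow> nat \<Rightarrow> literal \<Rightarrow> nat" where
  "code Q ev z l = (if Q ! var l = Exists then (if lit_sign l = ev_val ev z (var l) then 1 else 0)
     else 2 * key ev z (var l) + lit_sign l)"

text \<open>Flips the lowest bit, which is the sign of a literal over a copy; it also exchanges the
  two special codes 0 and 1.\<close>

definition negc :: "nat \<Rightarrow> nat" where
  "negc c = (if even c then c + 1 else c - 1)"

lemma negc_negc [simp]: "negc (negc c) = c"
  by (auto simp: negc_def)

lemma negc_le_1: "negc c \<le> 1 \<longleftrightarrow> c \<le> 1"
  unfolding negc_def by presburger

definition consistent :: "nat set \<Rightarrow> bool" where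
  "consistent X \<longleftrightarrow> (\<forall>c \<in> X. negc c \<notin> X)"

lemma consistent_subset: "consistent Y \<Longrightarrow> X \<subseteq> Y \<Longrightarrow> consistent X"
  unfolding consistent_def by blast

text \<open>Binary digits are unique: parity recovers the last digit read at each stage, and the
  rest by halving.\<close>

lemma foldl_double_inj:
  assumes "\<forall>e \<in> set es. f e \<le> 1 \<and> g e \<le> (1::nat)"
    and "foldl (\<lambda>x e. 2 * x + f e) x es = foldl (\<lambda>x e. 2 * x + g e) y es"
  shows "x = y \<and> (\<forall>e \<in> set es. f e = g e)"
  using assms
proof (induction es arbitrary: x y)
  case (Cons e es)
  have "2 * x + f e = 2 * y + g e" "\<forall>e \<in> set es. f e = g e"
  proof -
    have "foldl (\<lambda>x e. 2 * x + f e) (2 * x + f e) es = foldl (\<lambda>x e. 2 * x + g e) (2 * y + g e) es"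
      using Cons.prems(2) by (simp only: foldl.simps)
    from Cons.IH[OF _ this] Cons.prems(1)
    show "2 * x + f e = 2 * y + g e" "\<forall>e \<in> set es. f e = g e" by (meson list.set_intros(2))+
  qed
  have "f e \<le> 1" "g e \<le> 1" using Cons.prems by auto
  with \<open>2 * x + f e = 2 * y + g e\<close> have "x = y" "f e = g e" by presburger+
  then show ?case using \<open>\<forall>e \<in> set es. f e = g e\<close> by simp
qed simp

text \<open>Two plays share a copy of \<open>u\<close> precisely when they do not differ at a listed
  existential variable to its left, which is when \<open>refutes\<close> forbids opposite
  signs.\<close>

lemma key_eq_iff:
  "key ev z u = key ev z' u' \<longleftrightarrow> u = u' \<and> (\<forall>e \<in> set ev. e < u \<longrightarrow> ev_val ev z e = ev_val ev z' e)"
proof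
  assume "key ev z u = key ev z' u'"
  then have "u + 1 = u' + 1 \<and> (\<forall>e \<in> set ev. (if e < u then ev_val ev z e else 0) = (if e < u' then ev_val ev z' e else 0))"
    unfolding key_def by (intro foldl_double_inj) (auto simp: ev_val_def)
  then show "u = u' \<and> (\<forall>e \<in> set ev. e < u \<longrightarrow> ev_val ev z e = ev_val ev z' e)" by force
next
  assume "u = u' \<and> (\<forall>e \<in> set ev. e < u \<longrightarrow> ev_val ev z e = ev_val ev z' e)"
  then show "key ev z u = key ev z' u'"
    unfolding key_def by (auto intro!: foldl_cong)
qed

lemma key_pos: "0 < key ev z u"
proof -
  have "0 < x \<Longrightarrow> 0 < foldl (\<lambda>x e. 2 * x + f e) x es" for x :: nat and f :: "nat \<Rightarrow> nat" and es
    by (induction es arbitrary: x) auto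
  then show ?thesis by (simp add: key_def)
qed

lemma ev_val_nth:
  assumes "distinct ev" "i < length ev"
  shows "ev_val ev z (ev ! i) = (if odd (z div 2 ^ i) then 1 else 0)"
  using assms by (auto simp: ev_val_def nth_eq_iff_index_eq)

lemma ex_bits: "\<exists>z < (2::nat) ^ k. \<forall>i < k. odd (z div 2 ^ i) \<longleftrightarrow> f i" for f :: "nat \<Rightarrow> bool"
proof (induction k arbitrary: f)
  case (Suc k)
  from Suc.IH[of "\<lambda>i. f (Suc i)"] obtain z where z: "z < (2::nat) ^ k" "\<forall>i < k. odd (z div 2 ^ i) \<longleftrightarrow> f (Suc i)" by blast
  let ?z = "2 * z + (if f 0 then 1 else 0)"
  have d: "?z div 2 = z" by auto
  have "odd (?z div 2 ^ i) \<longleftrightarrow> f i" if "i < Suc k" for i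
  proof (cases i)
    case 0
    then show ?thesis by auto
  next
    case (Suc j)
    have "?z div 2 ^ i = z div 2 ^ j" unfolding Suc power_Suc div_mult2_eq d ..
    then show ?thesis using z that Suc by simp
  qed
  moreover have "?z < 2 ^ Suc k" using z(1) by auto
  ultimately show ?case by blast
qed simp

definition codes :: "quant list \<Rightarrow> nat list \<Rightarrow> nat \<Rightarrow> clause \<Rightarrow> nat set" where
  "codes Q ev z C = code Q ev z ` set C"

lemma lit_true_sign: "lit_true \<rho> l \<longleftrightarrow> lit_sign l = (if \<rho> (var l) then 1 else 0)"
  by (cases l) auto

lemma negc_double: "s \<le> 1 \<Longrightarrow> negc (2 * x + s) = 2 * x + (1 - s)"
  by (auto simp: negc_def le_Suc_eq)

lemma lit_sign_le: "lit_sign l \<le> 1"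
  by (cases l) auto

lemma code_negc:
  assumes "code Q ev z l = negc (code Q ev z' l')"
  shows "code Q ev z l \<le> 1 \<or>
    Q ! var l = Forall \<and> Q ! var l' = Forall \<and> var l = var l' \<and> lit_sign l \<noteq> lit_sign l' \<and>
    (\<forall>e \<in> set ev. e < var l \<longrightarrow> ev_val ev z e = ev_val ev z' e)"
proof -
  have ex: "Q ! v = Exists \<or> Q ! v = Forall" for v by (cases "Q ! v") auto
  consider "Q ! var l = Exists" | "Q ! var l = Forall" "Q ! var l' = Exists" |
    "Q ! var l = Forall" "Q ! var l' = Forall" using ex by blast
  then show ?thesis
  proof cases
    case 1
    then show ?thesis by (simp add: code_def)
  next
    case 2
    then have "code Q ev z l \<le> 1" using assms by (auto simp: code_def negc_def)
    then show ?thesis ..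
  next
    case 3
    then have "2 * key ev z (var l) + lit_sign l = 2 * key ev z' (var l') + (1 - lit_sign l')"
      using assms negc_double[OF lit_sign_le] by (simp add: code_def)
    then have "key ev z (var l) = key ev z' (var l')" "lit_sign l \<noteq> lit_sign l'"
      using lit_sign_le[of l] lit_sign_le[of l'] by presburger+
    then show ?thesis using 3 by (auto simp: key_eq_iff)
  qed
qed

locale wf_formula =
  fixes Q :: "quant list" and \<phi> :: matrix
  assumes wf: "wf_qcnf (Q, \<phi>)"
begin

lemma var_less: "C \<in> set \<phi> \<Longrightarrow> l \<in> set C \<Longrightarrow> var l < length Q"
  using wf by (auto simp: wf_clause_def)

end

text \<open>Only the existential variables of the matrix have to be listed: collecting all those of
  the prefix would not fit a time bound in the size of the matrix.\<close>

locale existentials = wf_formula +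
  fixes ev :: "nat list"
  assumes distinct_ev: "distinct ev"
    and ev_Exists: "e \<in> set ev \<Longrightarrow> Q ! e = Exists"
    and ev_all: "C \<in> set \<phi> \<Longrightarrow> l \<in> set C \<Longrightarrow> Q ! var l = Exists \<Longrightarrow> var l \<in> set ev"
begin

text \<open>Inserting 0 excludes its opposite 1, the code of a satisfied existential literal. Thus
  consistency alone says both that existential literals are falsified and that universal copies
  never clash.\<close>

definition selects :: "(nat \<Rightarrow> clause) \<Rightarrow> bool" where
  "selects sel \<longleftrightarrow> (\<forall>z < 2 ^ length ev. sel z \<in> set \<phi>) \<and>
     consistent (insert 0 (\<Union>z < 2 ^ length ev. codes Q ev z (sel z)))"

text \<open>Restrict the refutation to the plays described by numbers. Code 1 cannot occur, as
  existential literals are falsified; opposite codes above 1 come from one copy, and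
  \<open>refutes_clash\<close> would make the two plays differ to its left.\<close>

lemma refutes_imp_selects:
  assumes "refutes Q \<phi> 0 \<sigma> S"
  shows "selects (\<lambda>z. S (\<lambda>v. ev_val ev z v = 1))"
  unfolding selects_def consistent_def
proof (intro conjI allI impI ballI)
  let ?r = "\<lambda>z v. ev_val ev z v = 1"
  let ?U = "insert 0 (\<Union>z < 2 ^ length ev. codes Q ev z (S (?r z)))"
  show "S (?r z) \<in> set \<phi>" for z using assms by (simp add: refutes_def)
  have no1: "1 \<notin> ?U"
  proof
    assume "1 \<in> ?U"
    then obtain z l where l: "l \<in> set (S (?r z))" "code Q ev z l = 1" by (auto simp: codes_def)
    have "Q ! var l = Exists"
    proof (rule ccontr)
      assume "Q ! var l \<noteq> Exists"
      then show False using l(2) key_pos[of ev z "var l"] by (auto simp: code_def)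
    qed
    have "lit_sign l = ev_val ev z (var l)"
      using l(2) \<open>Q ! var l = Exists\<close> by (simp add: code_def split: if_split_asm)
    then have "lit_true (?r z) l" by (auto simp: lit_true_sign ev_val_def)
    then show False using assms l \<open>Q ! var l = Exists\<close> by (auto simp: refutes_def)
  qed
  fix c assume c: "c \<in> ?U"
  show "negc c \<notin> ?U"
  proof
    assume n: "negc c \<in> ?U"
    have "c \<noteq> 1" "negc c \<noteq> 1" using no1 c n by metis+
    then have "\<not> c \<le> 1" unfolding negc_def by presburger
    then have c1: "\<not> c \<le> 1" "\<not> negc c \<le> 1" by (simp_all only: negc_le_1 not_False_eq_True)
    then obtain z l z' l' where l: "l \<in> set (S (?r z))" "c = code Q ev z l"
      "l' \<in> set (S (?r z'))" "negc c = code Q ev z' l'" using c n unfolding codes_def by (auto simp del: One_nat_def)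
    have "code Q ev z l = negc (code Q ev z' l')" using l by (metis negc_negc)
    from code_negc[OF this] c1 l have q: "Q ! var l = Forall" "var l = var l'" "lit_sign l \<noteq> lit_sign l'"
      "\<forall>e \<in> set ev. e < var l \<longrightarrow> ev_val ev z e = ev_val ev z' e" by auto
    have same: "ev_val ev z e = ev_val ev z' e" if "e < var l" for e
    proof (cases "e \<in> set ev")
      case False
      then show ?thesis by (auto simp: ev_val_def)
    qed (use q that in auto)
    have "l = Pos (var l) \<and> l' = Neg (var l) \<or> l = Neg (var l) \<and> l' = Pos (var l)"
      using q by (cases l; cases l') auto
    then have "Pos (var l) \<in> set (S (?r z)) \<and> Neg (var l) \<in> set (S (?r z')) \<or>
        Pos (var l) \<in> set (S (?r z')) \<and> Neg (var l) \<in> set (S (?r z))" using l by metis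
    then obtain e where "e < var l" "(ev_val ev z e = 1) \<noteq> (ev_val ev z' e = 1)"
      using refutes_clash[OF assms le0 q(1), of "?r z" "?r z'"]
        refutes_clash[OF assms le0 q(1), of "?r z'" "?r z"] by blast
    then show False using same by simp
  qed
qed

text \<open>Each play \<open>\<rho>\<close> uses the clause selected for the number
  \<open>z \<rho>\<close> that describes its restriction to \<open>ev\<close>.\<close>

lemma selects_imp_refutes:
  assumes "selects sel"
  shows "\<exists>S. refutes Q \<phi> 0 \<sigma> S"
proof -
  let ?k = "length ev"
  let ?U = "insert 0 (\<Union>z < 2 ^ ?k. codes Q ev z (sel z))"
  have cons: "c \<in> ?U \<Longrightarrow> negc c \<notin> ?U" for c using assms by (auto simp: selects_def consistent_def)
  have "\<exists>z < (2::nat) ^ ?k. \<forall>i < ?k. odd (z div 2 ^ i) \<longleftrightarrow> \<rho> (ev ! i)" for \<rho>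
    using ex_bits[of ?k "\<lambda>i. \<rho> (ev ! i)"] .
  then obtain z where z: "\<And>\<rho>. z \<rho> < (2::nat) ^ ?k" "\<And>\<rho> i. i < ?k \<Longrightarrow> odd (z \<rho> div 2 ^ i) \<longleftrightarrow> \<rho> (ev ! i)"
    by metis
  have v: "ev_val ev (z \<rho>) e = (if \<rho> e then 1 else 0)" if e: "e \<in> set ev" for \<rho> e
  proof -
    obtain i where i: "i < length ev" "e = ev ! i" using e by (metis in_set_conv_nth)
    show ?thesis unfolding i(2) ev_val_nth[OF distinct_ev i(1)] z(2)[OF i(1)] ..
  qed
  have inU: "l \<in> set (sel (z \<rho>)) \<Longrightarrow> code Q ev (z \<rho>) l \<in> ?U" for l \<rho>
    using z(1) by (auto simp: codes_def)
  have inphi: "sel (z \<rho>) \<in> set \<phi>" for \<rho> using assms z(1) by (auto simp: selects_def)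
  have "refutes Q \<phi> 0 \<sigma> (\<lambda>\<rho>. sel (z \<rho>))"
    unfolding refutes_def
  proof (intro conjI allI ballI impI)
    fix \<rho> l assume l: "l \<in> set (sel (z \<rho>))" "Q ! var l = Exists"
    have "code Q ev (z \<rho>) l \<noteq> 1"
      using inU[OF l(1)] cons[of 0] by (auto simp: negc_def)
    then show "\<not> lit_true \<rho> l"
      using l v[OF ev_all[OF inphi l]] by (auto simp: code_def lit_true_sign split: if_split_asm)
  next
    fix \<rho> \<rho>' u
    assume u: "Q ! u = Forall" "Pos u \<in> set (sel (z \<rho>))" "Neg u \<in> set (sel (z \<rho>'))"
    have "code Q ev (z \<rho>) (Pos u) \<noteq> negc (code Q ev (z \<rho>') (Neg u))"
      using inU[OF u(2)] inU[OF u(3)] cons by metis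
    then have "key ev (z \<rho>) u \<noteq> key ev (z \<rho>') u"
      using u(1) by (auto simp: code_def negc_def)
    then obtain e where e: "e \<in> set ev" "e < u" "ev_val ev (z \<rho>) e \<noteq> ev_val ev (z \<rho>') e"
      by (auto simp: key_eq_iff)
    then have "\<rho> e \<noteq> \<rho>' e" using v[OF e(1), of \<rho>] v[OF e(1), of \<rho>'] by (auto split: if_split_asm)
    then show "\<exists>e\<ge>0. e < u \<and> Q ! e = Exists \<and> \<rho> e \<noteq> \<rho>' e" using e ev_Exists by auto
  qed (use inphi in auto)
  then show ?thesis by blast
qed

theorem qbf_true_iff: "qbf_true (Q, \<phi>) \<longleftrightarrow> (\<nexists>sel. selects sel)"
  using not_prefix_true_iff_refutes[of \<phi> Q 0 "\<lambda>_. False"] var_less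
    refutes_imp_selects selects_imp_refutes[of _ "\<lambda>_. False"] by auto

text \<open>No clause contains a literal together with its negation, so a clause can clash with
  itself only through its existential literals, that is, through codes 0 and 1.\<close>

lemma codes_clash:
  assumes "C \<in> set \<phi>" "c \<in> codes Q ev z C" "negc c \<in> codes Q ev z C"
  shows "c \<le> 1"
proof -
  obtain l l' where l: "l \<in> set C" "c = code Q ev z l" "l' \<in> set C" "negc c = code Q ev z l'"
    using assms by (auto simp: codes_def)
  have "code Q ev z l = negc (code Q ev z l')" using l by (metis negc_negc)
  from code_negc[OF this] have "c \<le> 1 \<or> (var l = var l' \<and> lit_sign l \<noteq> lit_sign l')" using l by blast
  moreover have "\<not> (var l = var l' \<and> lit_sign l \<noteq> lit_sign l')"
  proof
    assume "var l = var l' \<and> lit_sign l \<noteq> lit_sign l'"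
    then have "l = Pos (var l) \<and> l' = Neg (var l) \<or> l = Neg (var l) \<and> l' = Pos (var l)"
      by (cases l; cases l') auto
    then have "Pos (var l) \<in> set C" "Neg (var l) \<in> set C" using l by metis+
    then show False using wf assms(1) by (auto simp: wf_clause_def)
  qed
  ultimately show ?thesis by blast
qed

end

section \<open>Consistent selections\<close>

text \<open>Abstracts the search from formulas: \<open>F z C\<close> will be the codes of clause
  \<open>C\<close> under assignment \<open>z\<close>, and \<open>m\<close> the number of
  assignments.\<close>

locale selection =
  fixes F :: "nat \<Rightarrow> 'c \<Rightarrow> nat set" and \<Phi> :: "'c set" and m d :: nat
  assumes finite_F: "finite (F z C)"
    and card_F: "C \<in> \<Phi> \<Longrightarrow> card (F z C) \<le> d"
    and clash_F: "C \<in> \<Phi> \<Longrightarrow> c \<in> F z C \<Longrightarrow> negc c \<in> F z C \<Longrightarrow> c \<le> 1"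
begin

definition solution :: "(nat \<Rightarrow> 'c) \<Rightarrow> bool" where
  "solution sel \<longleftrightarrow> (\<forall>z < m. sel z \<in> \<Phi>) \<and> consistent (insert 0 (\<Union>z < m. F z (sel z)))"

definition extendable :: "nat set \<Rightarrow> bool" where
  "extendable \<tau> \<longleftrightarrow> (\<exists>sel. solution sel \<and> \<tau> \<subseteq> insert 0 (\<Union>z < m. F z (sel z)))"

definition compat :: "nat set \<Rightarrow> nat set \<Rightarrow> bool" where
  "compat \<tau> X \<longleftrightarrow> (\<forall>c \<in> X. negc c \<notin> \<tau>)"

text \<open>The flexible indices are those that never get in the way: whatever is chosen elsewhere,
  a member of the family remains available.\<close>

definition flexible :: "nat set \<Rightarrow> nat \<Rightarrow> bool" where
  "flexible \<tau> z \<longleftrightarrow> (\<forall>X. finite X \<longrightarrow> card X \<le> m * d \<longrightarrow>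
     (\<exists>C \<in> \<Phi>. compat \<tau> (F z C) \<and> (F z C - \<tau>) \<inter> X = {}))"

text \<open>Serve the indices one after the other. The codes \<open>U\<close> chosen so far number
  at most \<open>m * d\<close>, so flexibility applied to their opposites yields a member that does
  not clash with \<open>U\<close>.\<close>

lemma flexible_solution:
  assumes "consistent \<tau>" "0 \<in> \<tau>" "\<forall>z < m. flexible \<tau> z"
  shows "\<exists>sel. solution sel"
proof -
  have "\<exists>sel. (\<forall>z < j. sel z \<in> \<Phi>) \<and> consistent (\<tau> \<union> (\<Union>z < j. F z (sel z)))" if "j \<le> m" for j
    using that
  proof (induction j)
    case 0
    then show ?case using assms by simp
  next
    case (Suc j)
    then obtain sel where sel: "\<forall>z < j. sel z \<in> \<Phi>" "consistent (\<tau> \<union> (\<Union>z < j. F z (sel z)))"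
      by auto
    define U where "U = (\<Union>z < j. F z (sel z))"
    have "card U \<le> (\<Sum>z < j. card (F z (sel z)))" unfolding U_def by (intro card_UN_le) simp
    also have "\<dots> \<le> (\<Sum>z < j. d)" using sel card_F by (intro sum_mono) auto
    also have "\<dots> \<le> m * d" using Suc.prems by simp
    finally have "card (negc ` U) \<le> m * d" using finite_F
      by (metis U_def card_image_le finite_UN finite_lessThan order_trans)
    moreover have "finite (negc ` U)" using finite_F by (auto simp: U_def)
    ultimately obtain C where C: "C \<in> \<Phi>" "compat \<tau> (F j C)" "(F j C - \<tau>) \<inter> negc ` U = {}"
      using assms(3) Suc.prems unfolding flexible_def by (meson Suc_le_lessD)
    have U: "consistent (\<tau> \<union> U)" using sel by (simp add: U_def)
    have mix: False if c: "c \<in> F j C" "negc c \<in> \<tau> \<union> U" for c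
    proof -
      have "negc c \<notin> \<tau>" using C c by (auto simp: compat_def)
      then have "negc c \<in> U" using c by auto
      then have "c \<in> negc ` U" by (metis imageI negc_negc)
      then have "c \<in> \<tau>" using C c by auto
      then show False using U c by (auto simp: consistent_def)
    qed
    have "consistent (\<tau> \<union> U \<union> F j C)"
      unfolding consistent_def
    proof (intro ballI notI)
      fix c assume c: "c \<in> \<tau> \<union> U \<union> F j C" "negc c \<in> \<tau> \<union> U \<union> F j C"
      consider "c \<in> F j C" "negc c \<in> F j C" | "c \<in> F j C" "negc c \<in> \<tau> \<union> U"
        | "c \<in> \<tau> \<union> U" "negc c \<in> F j C" | "c \<in> \<tau> \<union> U" "negc c \<in> \<tau> \<union> U" using c by blast
      then show False
      proof cases
        case 1
        \<comment> \<open>A clash inside one member involves code 1, which is incompatible with the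
          0 in \<open>\<tau>\<close>.\<close>
        then have "c \<le> 1" using clash_F C by blast
        then have "(1::nat) \<in> F j C" using 1 by (auto simp: le_Suc_eq negc_def)
        then show ?thesis using C(2) assms(2) by (auto simp: compat_def negc_def)
      next
        case 2
        then show ?thesis using mix by blast
      next
        case 3
        then show ?thesis using mix[of "negc c"] by simp
      next
        case 4
        then show ?thesis using U by (auto simp: consistent_def)
      qed
    qed
    moreover have "(\<Union>z < Suc j. F z ((sel(j := C)) z)) = U \<union> F j C"
      by (auto simp: U_def lessThan_Suc)
    ultimately show ?case using sel C
      by (intro exI[of _ "sel(j := C)"]) (auto simp: less_Suc_eq Un_assoc simp del: fun_upd_apply, auto)
  qed
  then obtain sel where "\<forall>z < m. sel z \<in> \<Phi>" "consistent (\<tau> \<union> (\<Union>z < m. F z (sel z)))" by blast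
  then have "solution sel" using assms(2) unfolding solution_def by (auto elim: consistent_subset)
  then show ?thesis by blast
qed

text \<open>\<open>H\<close> collects, with their negations, the literals of a greedily chosen family of members
  whose parts outside of \<open>\<tau>\<close> are disjoint, and \<open>n\<close> counts them; a member that lies within \<open>\<tau>\<close>
  counts as more than \<open>m * d\<close>.\<close>

definition scan_inv :: "nat set \<Rightarrow> nat \<Rightarrow> 'c set \<Rightarrow> nat set \<Rightarrow> nat \<Rightarrow> bool" where
  "scan_inv \<tau> z D H n \<longleftrightarrow>
    (\<forall>C \<in> D. compat \<tau> (F z C) \<longrightarrow> m * d < n \<or> (\<exists>c \<in> F z C. c \<notin> \<tau> \<and> c \<in> H)) \<and>
    (\<forall>X. finite X \<longrightarrow> card X < n \<longrightarrow>
       (\<exists>C \<in> D. compat \<tau> (F z C) \<and> F z C - \<tau> \<subseteq> H \<and> (F z C - \<tau>) \<inter> X = {})) \<and>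
    (\<forall>c \<in> H. c \<notin> \<tau> \<and> negc c \<notin> \<tau> \<and> negc c \<in> H)"

lemma scan_inv_init: "scan_inv \<tau> z {} {} 0"
  by (simp add: scan_inv_def)

lemma scan_invD:
  assumes "scan_inv \<tau> z D H n"
  shows "C \<in> D \<Longrightarrow> compat \<tau> (F z C) \<Longrightarrow> m * d < n \<or> (\<exists>c \<in> F z C. c \<notin> \<tau> \<and> c \<in> H)"
    and "finite X \<Longrightarrow> card X < n \<Longrightarrow>
       \<exists>C \<in> D. compat \<tau> (F z C) \<and> F z C - \<tau> \<subseteq> H \<and> (F z C - \<tau>) \<inter> X = {}"
    and "c \<in> H \<Longrightarrow> c \<notin> \<tau> \<and> negc c \<notin> \<tau> \<and> negc c \<in> H"
  using assms unfolding scan_inv_def by blast+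

lemma scan_invI:
  assumes "\<And>C. C \<in> D \<Longrightarrow> compat \<tau> (F z C) \<Longrightarrow> m * d < n \<or> (\<exists>c \<in> F z C. c \<notin> \<tau> \<and> c \<in> H)"
    and "\<And>X. finite X \<Longrightarrow> card X < n \<Longrightarrow>
       \<exists>C \<in> D. compat \<tau> (F z C) \<and> F z C - \<tau> \<subseteq> H \<and> (F z C - \<tau>) \<inter> X = {}"
    and "\<And>c. c \<in> H \<Longrightarrow> c \<notin> \<tau> \<and> negc c \<notin> \<tau> \<and> negc c \<in> H"
  shows "scan_inv \<tau> z D H n"
  using assms unfolding scan_inv_def by blast

text \<open>A member is passed over if it is incompatible with \<open>\<tau>\<close>, and then
  nothing is claimed about it, or if it meets \<open>H\<close>, which is disjoint from
  \<open>\<tau>\<close>, and then it is already hit.\<close>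

lemma scan_inv_skip:
  assumes "scan_inv \<tau> z D H n" "\<exists>c \<in> F z C. negc c \<in> \<tau> \<or> c \<in> H"
  shows "scan_inv \<tau> z (insert C D) H n"
proof (rule scan_invI)
  note inv = scan_invD[OF assms(1)]
  fix B assume B: "B \<in> insert C D" "compat \<tau> (F z B)"
  show "m * d < n \<or> (\<exists>c \<in> F z B. c \<notin> \<tau> \<and> c \<in> H)"
  proof (cases "B = C")
    case True
    then obtain c where "c \<in> F z B" "c \<in> H" using assms(2) B by (auto simp: compat_def)
    then show ?thesis using inv(3) by blast
  next
    case False
    then show ?thesis using inv(1) B by blast
  qed
qed (use scan_invD(2,3)[OF assms(1)] in blast)+

text \<open>If \<open>X\<close> misses the new member outside of \<open>\<tau>\<close>, that member
  is the witness. Otherwise, removing its codes makes \<open>X\<close> smaller, so an old member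
  avoids what is left; outside of \<open>\<tau>\<close> it lies in \<open>H\<close>, which the new
  member does not meet, so it avoids all of \<open>X\<close>. A member within \<open>\<tau>\<close>
  avoids every \<open>X\<close>, which justifies the jump of the counter.\<close>

lemma scan_inv_add:
  assumes inv: "scan_inv \<tau> z D H n" and new: "\<not> (\<exists>c \<in> F z C. negc c \<in> \<tau> \<or> c \<in> H)"
  shows "scan_inv \<tau> z (insert C D) (H \<union> (F z C - \<tau>) \<union> negc ` (F z C - \<tau>))
    (n + (if F z C \<subseteq> \<tau> then Suc (m * d) else 1))"
    (is "scan_inv _ _ _ ?H ?n")
proof -
  have compat: "compat \<tau> (F z C)" using new by (auto simp: compat_def)
  note c = scan_invD[OF inv]
  have "\<exists>B \<in> insert C D. compat \<tau> (F z B) \<and> F z B - \<tau> \<subseteq> ?H \<and> (F z B - \<tau>) \<inter> X = {}"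
    if X: "finite X" "card X < ?n" for X
  proof (cases "(F z C - \<tau>) \<inter> X = {}")
    case True
    then show ?thesis using compat by auto
  next
    case False
    then have "\<not> F z C \<subseteq> \<tau>" by auto
    then have "card X \<le> n" using X by simp
    moreover have "card (X - (F z C - \<tau>)) < card X"
      using False X by (intro psubset_card_mono) auto
    ultimately obtain B where B: "B \<in> D" "compat \<tau> (F z B)" "F z B - \<tau> \<subseteq> H"
      "(F z B - \<tau>) \<inter> (X - (F z C - \<tau>)) = {}" using c(2)[of "X - (F z C - \<tau>)"] X by auto
    then show ?thesis using new by (intro bexI[of _ B]) auto
  qed
  note avoid = this
  show ?thesis
  proof (rule scan_invI)
    fix B assume B: "B \<in> insert C D" "compat \<tau> (F z B)"
    show "m * d < ?n \<or> (\<exists>c \<in> F z B. c \<notin> \<tau> \<and> c \<in> ?H)"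
    proof (cases "B = C")
      case True
      then show ?thesis by auto
    next
      case False
      then show ?thesis using c(1)[of B] B by auto
    qed
  next
    fix c' assume c': "c' \<in> ?H"
    then consider "c' \<in> H" | "c' \<in> F z C - \<tau>" | "negc c' \<in> F z C - \<tau>" by auto
    then show "c' \<notin> \<tau> \<and> negc c' \<notin> \<tau> \<and> negc c' \<in> ?H"
    proof cases
      case 1
      then show ?thesis using c(3) by blast
    next
      case 2
      then show ?thesis using new by auto
    next
      case 3
      then show ?thesis using new by (metis DiffD1 DiffD2 UnI1 UnI2 negc_negc)
    qed
  qed (rule avoid)
qed

lemma scan_inv_flexible:
  assumes "scan_inv \<tau> z \<Phi> H n" "m * d < n"
  shows "flexible \<tau> z"
  unfolding flexible_def
proof (intro allI impI)
  fix X :: "nat set" assume X: "finite X" "card X \<le> m * d"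
  then have "card X < n" using assms(2) by simp
  then show "\<exists>C \<in> \<Phi>. compat \<tau> (F z C) \<and> (F z C - \<tau>) \<inter> X = {}"
    using scan_invD(2)[OF assms(1) X(1)] by blast
qed

text \<open>Completeness of branching: the member that a solution extending \<open>\<tau>\<close>
  uses for \<open>z\<close> is compatible with \<open>\<tau>\<close>, so with a small counter it
  contributes a code from \<open>H\<close>.\<close>

lemma scan_inv_branch:
  assumes "scan_inv \<tau> z \<Phi> H n" "n \<le> m * d" "z < m" "extendable \<tau>"
  shows "\<exists>c \<in> H. extendable (insert c \<tau>)"
proof -
  from assms(4) obtain sel where sel: "solution sel" "\<tau> \<subseteq> insert 0 (\<Union>z < m. F z (sel z))"
    by (auto simp: extendable_def)
  have "compat \<tau> (F z (sel z))" using sel assms(3) unfolding solution_def consistent_def compat_def by blast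
  moreover have "sel z \<in> \<Phi>" using sel assms(3) by (auto simp: solution_def)
  ultimately obtain c where "c \<in> F z (sel z)" "c \<in> H" using scan_invD(1)[OF assms(1)] assms(2) by (meson leD)
  then show ?thesis using sel assms(3) unfolding extendable_def by blast
qed

text \<open>Bounds the depth of the search: \<open>d\<close> codes for each of \<open>m\<close>
  indices, and one for the 0 of the root.\<close>

lemma extendable_card:
  assumes "extendable \<tau>"
  shows "card \<tau> \<le> Suc (m * d)"
proof -
  from assms obtain sel where sel: "solution sel" "\<tau> \<subseteq> insert 0 (\<Union>z < m. F z (sel z))"
    by (auto simp: extendable_def)
  let ?U = "\<Union>z < m. F z (sel z)"
  have "card ?U \<le> (\<Sum>z < m. card (F z (sel z)))" by (intro card_UN_le) simp
  also have "\<dots> \<le> (\<Sum>z < m. d)" using sel card_F by (intro sum_mono) (auto simp: solution_def)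
  finally have "card (insert 0 ?U) \<le> Suc (m * d)"
    using card_insert_le_m1 finite_F by (simp add: card_insert_if)
  then show ?thesis using card_mono[OF _ sel(2)] finite_F by auto
qed

end

section \<open>The program\<close>

text \<open>\<open>Ev\<close> lists the \<open>rK\<close> existential variables of the matrix, \<open>Wt\<close> the powers of 2, and \<open>rM\<close> is
  \<open>2 ^ rK\<close>. The bits of \<open>rZ\<close> are the values of the existential variables, unpacked in \<open>Val\<close>. The
  nodes \<open>rH, \<dots>, rT - 1\<close> of the search tree are pending; node \<open>i\<close> adds the literal \<open>Nl i\<close> to those of its
  parent \<open>Np i\<close>, where parent 0 stands for none, and \<open>rTT\<close> is the end of the list of tentative children. A literal
  belongs to the current node (\<open>Tm\<close>) or to the literals collected (\<open>Hm\<close>) if its entry equals the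
  clock \<open>rCk\<close>, so that advancing the clock clears both arrays.\<close>

abbreviation (input) "rP \<equiv> 2 :: nat"
abbreviation (input) "rC \<equiv> 3 :: nat"
abbreviation (input) "rL \<equiv> 4 :: nat"
abbreviation (input) "rD \<equiv> 5 :: nat"
abbreviation (input) "rK \<equiv> 6 :: nat"
abbreviation (input) "rM \<equiv> 7 :: nat"
abbreviation (input) "rN \<equiv> 8 :: nat"
abbreviation (input) "rH \<equiv> 9 :: nat"
abbreviation (input) "rT \<equiv> 10 :: nat"
abbreviation (input) "rZ \<equiv> 11 :: nat"
abbreviation (input) "rBr \<equiv> 12 :: nat"
abbreviation (input) "rCk \<equiv> 13 :: nat"
abbreviation (input) "rW \<equiv> 14 :: nat"
abbreviation (input) "rDep \<equiv> 15 :: nat"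
abbreviation (input) "rTT \<equiv> 16 :: nat"
abbreviation (input) "rCnt \<equiv> 17 :: nat"
abbreviation (input) "rJ \<equiv> 18 :: nat"
abbreviation (input) "rBad \<equiv> 19 :: nat"
abbreviation (input) "rX \<equiv> 20 :: nat"
abbreviation (input) "rI \<equiv> 21 :: nat"
abbreviation (input) "rA \<equiv> 22 :: nat"
abbreviation (input) "rB \<equiv> 23 :: nat"
abbreviation (input) "rNew \<equiv> 24 :: nat"

definition neq :: "exp \<Rightarrow> exp \<Rightarrow> exp" where
  "neq e f = Plus (Minus e f) (Minus f e)"

lemma eval_neq [simp]: "eval xs v a (neq e f) = 0 \<longleftrightarrow> eval xs v a e = eval xs v a f"
  by (auto simp: neq_def)

lemma ecost_neq [simp]: "ecost (neq e f) = 2 * ecost e + 2 * ecost f + 3"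
  by (simp add: neq_def)

text \<open>Leaves the code of the literal at \<open>rP\<close> in \<open>rA\<close> and the
  opposite code in \<open>rB\<close>. The loop evaluates \<open>key\<close> by Horner's scheme; the
  quantifier of variable \<open>u\<close> is looked up directly in cell
  \<open>u + 1\<close>.\<close>

definition lit_code :: com where
  "lit_code =
    rI ::= N 0 ;;
    rX ::= Plus (In (V rP)) (N 1) ;;
    While (Minus (V rK) (V rI)) (
      rX ::= Plus (V rX) (V rX) ;;
      Cond (Minus (In (V rP)) (Rd Ev (V rI))) (rX ::= Plus (V rX) (Rd Val (Rd Ev (V rI)))) Skip ;;
      rI ::= Plus (V rI) (N 1)) ;;
    rB ::= In (Plus (V rP) (N 1)) ;;
    Cond (In (Plus (In (V rP)) (N 1)))
      (Cond (neq (V rB) (Rd Val (In (V rP)))) (rA ::= N 0 ;; rB ::= N 1) (rA ::= N 1 ;; rB ::= N 0))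
      (rA ::= Plus (Plus (V rX) (V rX)) (V rB) ;;
       rB ::= Plus (Plus (V rX) (V rX)) (Minus (N 1) (V rB)))"

text \<open>The codes are buffered in \<open>La\<close> and \<open>Lb\<close>: nothing may enter
  \<open>Hm\<close> before the whole clause is known to be compatible with the node and disjoint
  from the codes collected.\<close>

definition clause_pass1 :: com where
  "clause_pass1 =
    rL ::= In (V rP) ;; rP ::= Plus (V rP) (N 1) ;; rJ ::= N 0 ;; rBad ::= N 0 ;;
    While (V rL) (
      lit_code ;;
      Write La (V rJ) (V rA) ;; Write Lb (V rJ) (V rB) ;; rJ ::= Plus (V rJ) (N 1) ;;
      Cond (neq (Rd Tm (V rB)) (V rCk)) Skip (rBad ::= N 1) ;;
      Cond (neq (Rd Hm (V rA)) (V rCk)) Skip (rBad ::= N 1) ;;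
      rP ::= Plus (V rP) (N 2) ;; rL ::= Minus (V rL) (N 1))"

text \<open>Children are written behind \<open>rT\<close> and stay tentative until
  \<open>try_index\<close> advances \<open>rT\<close>, so discarding them costs nothing. A clause
  without new codes lifts the counter above \<open>rN\<close> at once.\<close>

definition clause_pass2 :: com where
  "clause_pass2 =
    rNew ::= N 0 ;;
    While (V rJ) (
      rJ ::= Minus (V rJ) (N 1) ;; rA ::= Rd La (V rJ) ;; rB ::= Rd Lb (V rJ) ;;
      Cond (neq (Rd Tm (V rA)) (V rCk))
        (Write Hm (V rA) (V rCk) ;; Write Hm (V rB) (V rCk) ;;
         Write Nl (V rTT) (V rA) ;; Write Np (V rTT) (V rH) ;;
         Write Nl (Plus (V rTT) (N 1)) (V rB) ;; Write Np (Plus (V rTT) (N 1)) (V rH) ;;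
         rTT ::= Plus (V rTT) (N 2) ;; rNew ::= N 1)
        Skip) ;;
    Cond (V rNew) (rCnt ::= Plus (V rCnt) (N 1)) (rCnt ::= Plus (Plus (V rCnt) (V rN)) (N 1))"

definition scan :: com where
  "scan =
    rP ::= Plus (In (N 0)) (N 1) ;; rC ::= In (V rP) ;; rP ::= Plus (V rP) (N 1) ;;
    rTT ::= V rT ;; rCnt ::= N 0 ;;
    While (V rC) (clause_pass1 ;; Cond (V rBad) Skip clause_pass2 ;; rC ::= Minus (V rC) (N 1))"

text \<open>The machine cannot divide, so bits are extracted from the highest down by subtracting
  the powers in \<open>Wt\<close>. Adding 1 before the truncated subtraction turns it into the test
  that the power is at most \<open>rX\<close>.\<close>

definition decode :: com where
  "decode =
    rX ::= V rZ ;; rI ::= V rK ;;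
    While (V rI) (
      rI ::= Minus (V rI) (N 1) ;;
      Cond (Minus (Plus (V rX) (N 1)) (Rd Wt (V rI)))
        (rX ::= Minus (V rX) (Rd Wt (V rI)) ;; Write Val (Rd Ev (V rI)) (N 1))
        (Write Val (Rd Ev (V rI)) (N 0)))"

definition walk :: com where
  "walk =
    rW ::= V rH ;; rDep ::= N 0 ;;
    While (V rW) (
      Write Tm (Rd Nl (V rW)) (V rCk) ;; rW ::= Rd Np (V rW) ;; rDep ::= Plus (V rDep) (N 1))"

section \<open>Reading the encoded formula and scanning its clauses\<close>

lemma drop_Cons_nth:
  assumes "drop p xs = y # ys"
  shows "p < length xs" "xs ! p = y" "drop (Suc p) xs = ys"
proof -
  show p: "p < length xs" using assms by (metis drop_all list.distinct(1) not_le)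
  show "xs ! p = y" "drop (Suc p) xs = ys"
    using assms Cons_nth_drop_Suc[OF p] by (metis list.inject)+
qed

lemma nth_min [simp]: "p < length xs \<Longrightarrow> xs ! min p (length xs - Suc 0) = xs ! p"
  by (subst min_absorb1) auto

context wf_formula
begin

abbreviation "xs \<equiv> encode_qcnf (Q, \<phi>)"

lemma xs_0 [simp]: "xs ! 0 = length Q" "0 < length xs"
  by simp_all

lemma xs_quant:
  assumes "u < length Q"
  shows "Suc u < length xs" "xs ! Suc u = encode_quant (Q ! u)"
  using assms by (simp_all add: nth_append)

text \<open>A reading position is always specified by the suffix still to be read, so addresses of
  clauses never have to be computed.\<close>

lemma encode_literal_at:
  assumes "C \<in> set \<phi>" "l \<in> set C" "drop p xs = encode_literal l @ ys"
  shows "p < length xs" "Suc p < length xs" "xs ! p = var l" "xs ! Suc p = lit_sign l"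
    "drop (Suc (Suc p)) xs = ys" "var l < length Q"
proof -
  have d: "drop p xs = var l # lit_sign l # ys" using assms(3) by (simp add: encode_literal_eq)
  note 1 = drop_Cons_nth[OF d]
  note 2 = drop_Cons_nth[OF 1(3)]
  show "p < length xs" "Suc p < length xs" "xs ! p = var l" "xs ! Suc p = lit_sign l"
    "drop (Suc (Suc p)) xs = ys" using 1 2 by auto
  show "var l < length Q" using var_less assms by blast
qed

end

context existentials
begin

lemma wp_lit_code:
  assumes l: "C \<in> set \<phi>" "l \<in> set C" "drop (v rP) xs = encode_literal l @ ys"
    and K: "v rK = length ev" and Ev: "\<forall>i < length ev. a Ev i = ev ! i"
    and Val: "\<forall>e \<in> set ev. a Val e = ev_val ev z e"
    and R: "\<And>v' t'. v' rA = code Q ev z l \<Longrightarrow> v' rB = negc (code Q ev z l) \<Longrightarrow>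
      (\<And>x. x \<notin> {rI, rX, rA, rB} \<Longrightarrow> v' x = v x) \<Longrightarrow> t' \<le> t + 200 * (length ev + 1) \<Longrightarrow> R v' a t'"
  shows "wp xs lit_code R v a t"
proof -
  note p = encode_literal_at[OF l]
  let ?u = "var l"
  \<comment> \<open>The partial Horner values of \<open>key\<close>, held by \<open>rX\<close>
    during the loop.\<close>
  define f where "f n = foldl (\<lambda>x e. 2 * x + (if e < ?u then ev_val ev z e else 0)) (?u + 1) (take n ev)" for n
  have f: "f (Suc n) = 2 * f n + (if ev ! n < ?u then ev_val ev z (ev ! n) else 0)" if "n < length ev" for n
    using that by (simp add: f_def take_Suc_conv_app_nth)
  have f0: "f 0 = Suc ?u" and fk: "f (length ev) = key ev z ?u" by (simp_all add: f_def key_def)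
  have q: "xs ! Suc ?u = encode_quant (Q ! ?u)" "Suc ?u < length xs" using xs_quant p by auto
  define I where "I v' a' t' \<longleftrightarrow> a' = a \<and> v' rI \<le> length ev \<and> v' rX = f (v' rI) \<and>
    (\<forall>x. x \<notin> {rI, rX} \<longrightarrow> v' x = v x) \<and> t' \<le> t + 20 + 100 * v' rI" for v' a' t'
  show ?thesis
    unfolding lit_code_def
    apply (simp add: p del: encode_qcnf.simps)
    apply (rule wp_While[where I = I and T = "t + 20 + 100 * length ev"])
    subgoal by (simp add: I_def f0)
    subgoal for v' a' t'
      using p Ev Val K by (auto simp: I_def f simp del: encode_qcnf.simps)
    subgoal for v' a' t'
    proof -
      assume i: "I v' a' t'" and e: "eval xs v' a' (Minus (V rK) (V rI)) = 0"
      have s: "a' = a" "v' rX = key ev z ?u" "\<And>x. x \<notin> {rI, rX} \<Longrightarrow> v' x = v x"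
        "t' \<le> t + 20 + 100 * length ev"
        using i e K fk by (auto simp: I_def)
      have P: "v' rP = v rP" using s(3)[of rP] by simp
      show "wp xs (rB ::= In (Plus (V rP) (N 1)) ;;
        Cond (In (Plus (In (V rP)) (N 1)))
          (Cond (neq (V rB) (Rd Val (In (V rP)))) (rA ::= N 0 ;; rB ::= N 1) (rA ::= N 1 ;; rB ::= N 0))
          (rA ::= Plus (Plus (V rX) (V rX)) (V rB) ;;
           rB ::= Plus (Plus (V rX) (V rX)) (Minus (N 1) (V rB)))) R v' a'
        (t' + ecost (Minus (V rK) (V rI)) + 1)"
      proof (cases "Q ! ?u")
        case Forall
        have c: "code Q ev z l = 2 * key ev z ?u + lit_sign l" using Forall by (simp add: code_def)
        show ?thesis
          using Forall s q c negc_double[OF lit_sign_le[of l]]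
          by (auto simp: P p simp del: encode_qcnf.simps intro!: R split: if_splits)
      next
        case Exists
        have v: "a Val ?u = ev_val ev z ?u" using ev_all[OF l(1,2) Exists] Val by simp
        show ?thesis
          using Exists s q v
          by (auto simp: P p code_def negc_def simp del: encode_qcnf.simps intro!: R split: if_splits)
      qed
    qed
    done
qed

text \<open>A set stored by time stamps: entries with an outdated stamp count as absent.\<close>

definition marks :: "(nat \<Rightarrow> nat) \<Rightarrow> nat \<Rightarrow> nat set \<Rightarrow> bool" where
  "marks f n X \<longleftrightarrow> (\<forall>c. f c = n \<longleftrightarrow> c \<in> X)"

lemma marksD: "marks f n X \<Longrightarrow> f c = n \<longleftrightarrow> c \<in> X"
  by (simp add: marks_def)

lemma wp_clause_pass1:
  assumes C: "C \<in> set \<phi>" "drop (v rP) xs = encode_clause C @ ys"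
    and K: "v rK = length ev" and Ev: "\<forall>i < length ev. a Ev i = ev ! i"
    and Val: "\<forall>e \<in> set ev. a Val e = ev_val ev z e"
    and Tm: "marks (a Tm) (v rCk) \<tau>" and Hm: "marks (a Hm) (v rCk) Hs"
    and R: "\<And>v' a' t'. drop (v' rP) xs = ys \<Longrightarrow> v' rJ = length C \<Longrightarrow>
      (\<And>i. i < length C \<Longrightarrow> a' La i = code Q ev z (C ! i) \<and> a' Lb i = negc (code Q ev z (C ! i))) \<Longrightarrow>
      v' rBad \<noteq> 0 \<longleftrightarrow> (\<exists>c \<in> codes Q ev z C. negc c \<in> \<tau> \<or> c \<in> Hs) \<Longrightarrow>
      (\<And>x. x \<notin> {rP, rL, rJ, rBad, rI, rX, rA, rB} \<Longrightarrow> v' x = v x) \<Longrightarrow>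
      (\<And>b. b \<notin> {La, Lb} \<Longrightarrow> a' b = a b) \<Longrightarrow>
      t' \<le> t + 400 * (length ev + 1) * (length C + 1) \<Longrightarrow> R v' a' t'"
  shows "wp xs clause_pass1 R v a t"
proof -
  define W where "W = 200 * (length ev + 1) + 150"
  have d: "drop (v rP) xs = length C # concat (map encode_literal C) @ ys"
    using C(2) by (simp add: encode_clause_def)
  note p = drop_Cons_nth[OF d]
  define I where "I v' a' t' \<longleftrightarrow> (\<exists>ds ls. C = ds @ ls \<and>
      drop (v' rP) xs = concat (map encode_literal ls) @ ys \<and> v' rL = length ls \<and> v' rJ = length ds \<and>
      (\<forall>i < length ds. a' La i = code Q ev z (ds ! i) \<and> a' Lb i = negc (code Q ev z (ds ! i))) \<and>
      (v' rBad \<noteq> 0 \<longleftrightarrow> (\<exists>l \<in> set ds. negc (code Q ev z l) \<in> \<tau> \<or> code Q ev z l \<in> Hs)) \<and>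
      (\<forall>x. x \<notin> {rP, rL, rJ, rBad, rI, rX, rA, rB} \<longrightarrow> v' x = v x) \<and>
      (\<forall>b. b \<notin> {La, Lb} \<longrightarrow> a' b = a b) \<and> t' \<le> t + 30 + W * length ds)"
    for v' :: vars and a' :: arrs and t'
  show ?thesis
    unfolding clause_pass1_def
    apply (simp add: p del: encode_qcnf.simps)
    apply (rule wp_While[where I = I and T = "t + 30 + W * length C"])
    subgoal
      unfolding I_def
      by (rule exI[of _ "[]"], rule exI[of _ C]) (simp add: p del: encode_qcnf.simps)
    subgoal for v1 a1 t1
    proof -
      assume "I v1 a1 t1" and e: "eval xs v1 a1 (V rL) \<noteq> 0"
      then obtain ds ls where i: "C = ds @ ls" "drop (v1 rP) xs = concat (map encode_literal ls) @ ys"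
        "v1 rL = length ls" "v1 rJ = length ds"
        "\<And>i. i < length ds \<Longrightarrow> a1 La i = code Q ev z (ds ! i) \<and> a1 Lb i = negc (code Q ev z (ds ! i))"
        "v1 rBad \<noteq> 0 \<longleftrightarrow> (\<exists>l \<in> set ds. negc (code Q ev z l) \<in> \<tau> \<or> code Q ev z l \<in> Hs)"
        "\<And>x. x \<notin> {rP, rL, rJ, rBad, rI, rX, rA, rB} \<Longrightarrow> v1 x = v x"
        "\<And>b. b \<notin> {La, Lb} \<Longrightarrow> a1 b = a b" "t1 \<le> t + 30 + W * length ds"
        unfolding I_def by blast
      obtain l ls' where ls: "ls = l # ls'" using e i(3) by (cases ls) auto
      have l: "l \<in> set C" "drop (v1 rP) xs = encode_literal l @ concat (map encode_literal ls') @ ys"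
        using i ls by auto
      note q = encode_literal_at[OF C(1) l]
      have "W * length ds \<le> W * length C" using i(1) by simp
      then have T: "t1 \<le> t + 30 + W * length C" using i(9) by linarith
      have pre: "v1 rK = length ev" "\<forall>i < length ev. a1 Ev i = ev ! i"
        "\<forall>e \<in> set ev. a1 Val e = ev_val ev z e" using i K Ev Val by auto
      have mT: "\<And>c. a1 Tm c = v1 rCk \<longleftrightarrow> c \<in> \<tau>" and mH: "\<And>c. a1 Hm c = v1 rCk \<longleftrightarrow> c \<in> Hs"
        using i(7)[of rCk] i(8)[of Tm] i(8)[of Hm] marksD[OF Tm] marksD[OF Hm] by auto
      have "wp xs (lit_code ;;
          Write La (V rJ) (V rA) ;; Write Lb (V rJ) (V rB) ;; rJ ::= Plus (V rJ) (N 1) ;;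
          Cond (neq (Rd Tm (V rB)) (V rCk)) Skip (rBad ::= N 1) ;;
          Cond (neq (Rd Hm (V rA)) (V rCk)) Skip (rBad ::= N 1) ;;
          rP ::= Plus (V rP) (N 2) ;; rL ::= Minus (V rL) (N 1)) I v1 a1 (t1 + ecost (V rL) + 2)"
        apply (subst wp_Seq)
        apply (rule wp_lit_code[OF C(1) l pre])
        subgoal premises lc for v2 t2
        proof -
          have fr: "v2 x = v1 x" if "x \<notin> {rI, rX, rA, rB}" for x using lc(3) that .
          have t2: "t2 \<le> t1 + 4 + 200 * (length ev + 1)" using lc(4) by simp
          have fin: "I v3 a3 t3" if
            v3: "v3 rP = v2 rP + 2" "v3 rL = v2 rL - 1" "v3 rJ = v2 rJ + 1"
              "v3 rBad \<noteq> 0 \<longleftrightarrow> v2 rBad \<noteq> 0 \<or> negc (code Q ev z l) \<in> \<tau> \<or> code Q ev z l \<in> Hs"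
              "\<And>x. x \<notin> {rP, rL, rJ, rBad} \<Longrightarrow> v3 x = v2 x"
              "a3 = a1(La := (a1 La)(length ds := code Q ev z l), Lb := (a1 Lb)(length ds := negc (code Q ev z l)))"
              "t3 \<le> t2 + 140" for v3 a3 t3
            unfolding I_def
          proof (rule exI[of _ "ds @ [l]"], rule exI[of _ ls'], intro conjI allI impI)
            show "C = (ds @ [l]) @ ls'" using i ls by simp
            show "drop (v3 rP) xs = concat (map encode_literal ls') @ ys"
              using v3(1) fr[of rP] q(5) by simp
            show "v3 rL = length ls'" using v3(2) fr[of rL] i(3) ls by simp
            show "v3 rJ = length (ds @ [l])" using v3(3) fr[of rJ] i(4) by simp
            show "a3 La j = code Q ev z ((ds @ [l]) ! j)" if "j < length (ds @ [l])" for j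
              using that i(5)[of j] v3(6) by (auto simp: nth_append less_Suc_eq)
            show "a3 Lb j = negc (code Q ev z ((ds @ [l]) ! j))" if "j < length (ds @ [l])" for j
              using that i(5)[of j] v3(6) by (auto simp: nth_append less_Suc_eq)
            show "v3 rBad \<noteq> 0 \<longleftrightarrow> (\<exists>l \<in> set (ds @ [l]). negc (code Q ev z l) \<in> \<tau> \<or> code Q ev z l \<in> Hs)"
              unfolding v3(4) using fr[of rBad] i(6) by (simp add: disj_commute disj_left_commute)
            show "v3 x = v x" if "x \<notin> {rP, rL, rJ, rBad, rI, rX, rA, rB}" for x
              using that v3(5)[of x] fr[of x] i(7)[of x] by simp
            show "a3 b = a b" if "b \<notin> {La, Lb}" for b using that v3(6) i(8)[of b] by simp
            show "t3 \<le> t + 30 + W * length (ds @ [l])"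
              using v3(7) t2 i(9) by (simp add: W_def algebra_simps)
          qed
          show ?thesis
            using lc(1,2) fr[of rJ] fr[of rCk] i(4) mT mH
            by (auto intro!: fin simp del: encode_qcnf.simps split: if_splits)
        qed
        done
      then show ?thesis using T by blast
    qed
    subgoal premises pr for v1 a1 t1
    proof -
      have e: "v1 rL = 0" using pr(2) by simp
      from pr(1) obtain ds ls where i: "C = ds @ ls" "drop (v1 rP) xs = concat (map encode_literal ls) @ ys"
        "v1 rL = length ls" "v1 rJ = length ds"
        "\<And>i. i < length ds \<Longrightarrow> a1 La i = code Q ev z (ds ! i) \<and> a1 Lb i = negc (code Q ev z (ds ! i))"
        "v1 rBad \<noteq> 0 \<longleftrightarrow> (\<exists>l \<in> set ds. negc (code Q ev z l) \<in> \<tau> \<or> code Q ev z l \<in> Hs)"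
        "\<And>x. x \<notin> {rP, rL, rJ, rBad, rI, rX, rA, rB} \<Longrightarrow> v1 x = v x"
        "\<And>b. b \<notin> {La, Lb} \<Longrightarrow> a1 b = a b" "t1 \<le> t + 30 + W * length ds"
        unfolding I_def by blast
      have ls: "ls = []" "ds = C" using i(1,3) e by auto
      show ?thesis
      proof (rule R)
        show "drop (v1 rP) xs = ys" using i(2) ls by simp
        show "v1 rJ = length C" using i(4) ls by simp
        show "\<And>i. i < length C \<Longrightarrow> a1 La i = code Q ev z (C ! i) \<and> a1 Lb i = negc (code Q ev z (C ! i))"
          using i(5) ls by simp
        show "v1 rBad \<noteq> 0 \<longleftrightarrow> (\<exists>c \<in> codes Q ev z C. negc c \<in> \<tau> \<or> c \<in> Hs)"
          using i(6) ls by (simp add: codes_def)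
        show "t1 + ecost (V rL) + 1 \<le> t + 400 * (length ev + 1) * (length C + 1)"
          using i(9) ls by (simp add: W_def algebra_simps)
      qed (use i in auto)
    qed
    done
qed

lemma wp_clause_pass2:
  assumes J: "v rJ = length C"
    and La: "\<And>i. i < length C \<Longrightarrow> a La i = code Q ev z (C ! i) \<and> a Lb i = negc (code Q ev z (C ! i))"
    and Tm: "marks (a Tm) (v rCk) \<tau>" and Hm: "marks (a Hm) (v rCk) Hs"
    and R: "\<And>v' a' t'.
      marks (a' Hm) (v rCk) (Hs \<union> (codes Q ev z C - \<tau>) \<union> negc ` (codes Q ev z C - \<tau>)) \<Longrightarrow>
      (\<And>c. a' Hm c = a Hm c \<or> a' Hm c = v rCk) \<Longrightarrow>
      v rTT \<le> v' rTT \<Longrightarrow> v' rTT \<le> v rTT + 2 * length C \<Longrightarrow>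
      a' Nl ` {v rTT..<v' rTT} = (codes Q ev z C - \<tau>) \<union> negc ` (codes Q ev z C - \<tau>) \<Longrightarrow>
      (\<And>i. v rTT \<le> i \<Longrightarrow> i < v' rTT \<Longrightarrow> a' Np i = v rH) \<Longrightarrow>
      (\<And>i. i < v rTT \<Longrightarrow> a' Nl i = a Nl i \<and> a' Np i = a Np i) \<Longrightarrow>
      v' rCnt = v rCnt + (if codes Q ev z C \<subseteq> \<tau> then Suc (v rN) else 1) \<Longrightarrow>
      (\<And>x. x \<notin> {rJ, rA, rB, rTT, rNew, rCnt} \<Longrightarrow> v' x = v x) \<Longrightarrow>
      (\<And>b. b \<notin> {Hm, Nl, Np} \<Longrightarrow> a' b = a b) \<Longrightarrow>
      t' \<le> t + 200 * (length C + 1) \<Longrightarrow> R v' a' t'"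
  shows "wp xs clause_pass2 R v a t"
proof -
  \<comment> \<open>The loop runs backwards through the buffer, so \<open>new j\<close> consists of
    the codes outside of \<open>\<tau>\<close> met by the time position \<open>j\<close> is
    reached.\<close>
  define new where "new j = code Q ev z ` set (drop j C) - \<tau>" for j
  have new_end: "new (length C) = {}" by (simp add: new_def)
  have new_0: "new 0 = codes Q ev z C - \<tau>" by (simp add: new_def codes_def)
  have new_Suc: "new j = (if code Q ev z (C ! j) \<in> \<tau> then {} else {code Q ev z (C ! j)}) \<union> new (Suc j)"
    if "j < length C" for j
    unfolding new_def Cons_nth_drop_Suc[OF that, symmetric] by auto
  define I where "I v' a' t' \<longleftrightarrow> v' rJ \<le> length C \<and>
      marks (a' Hm) (v rCk) (Hs \<union> new (v' rJ) \<union> negc ` new (v' rJ)) \<and>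
      (\<forall>c. a' Hm c = a Hm c \<or> a' Hm c = v rCk) \<and>
      v rTT \<le> v' rTT \<and> v' rTT + 2 * v' rJ \<le> v rTT + 2 * length C \<and>
      a' Nl ` {v rTT..<v' rTT} = new (v' rJ) \<union> negc ` new (v' rJ) \<and>
      (\<forall>i. v rTT \<le> i \<longrightarrow> i < v' rTT \<longrightarrow> a' Np i = v rH) \<and>
      (\<forall>i. i < v rTT \<longrightarrow> a' Nl i = a Nl i \<and> a' Np i = a Np i) \<and>
      (v' rNew = 0 \<longleftrightarrow> new (v' rJ) = {}) \<and>
      (\<forall>x. x \<notin> {rJ, rA, rB, rTT, rNew} \<longrightarrow> v' x = v x) \<and>
      (\<forall>b. b \<notin> {Hm, Nl, Np} \<longrightarrow> a' b = a b) \<and>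
      t' + 150 * v' rJ \<le> t + 20 + 150 * length C"
    for v' :: vars and a' :: arrs and t'
  show ?thesis
    unfolding clause_pass2_def
    apply (simp del: encode_qcnf.simps)
    apply (rule wp_While[where I = I and T = "t + 20 + 150 * length C"])
    subgoal
      unfolding I_def using J Hm by (simp add: new_end)
    subgoal premises pr for v1 a1 t1
    proof -
      from pr(1) have i: "v1 rJ \<le> length C"
        "marks (a1 Hm) (v rCk) (Hs \<union> new (v1 rJ) \<union> negc ` new (v1 rJ))"
        "\<And>c. a1 Hm c = a Hm c \<or> a1 Hm c = v rCk"
        "v rTT \<le> v1 rTT" "v1 rTT + 2 * v1 rJ \<le> v rTT + 2 * length C"
        "a1 Nl ` {v rTT..<v1 rTT} = new (v1 rJ) \<union> negc ` new (v1 rJ)"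
        "\<And>i. v rTT \<le> i \<Longrightarrow> i < v1 rTT \<Longrightarrow> a1 Np i = v rH"
        "\<And>i. i < v rTT \<Longrightarrow> a1 Nl i = a Nl i \<and> a1 Np i = a Np i"
        "v1 rNew = 0 \<longleftrightarrow> new (v1 rJ) = {}"
        "\<And>x. x \<notin> {rJ, rA, rB, rTT, rNew} \<Longrightarrow> v1 x = v x"
        "\<And>b. b \<notin> {Hm, Nl, Np} \<Longrightarrow> a1 b = a b"
        "t1 + 150 * v1 rJ \<le> t + 20 + 150 * length C"
        unfolding I_def by iprover+
      obtain j where j: "v1 rJ = Suc j" using pr(2) by (cases "v1 rJ") auto
      let ?c = "code Q ev z (C ! j)"
      have jl: "j < length C" using i(1) j by simp
      have la: "a1 La j = ?c" "a1 Lb j = negc ?c" using La[OF jl] i(11)[of La] i(11)[of Lb] by auto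
      have mT: "a1 Tm c = v rCk \<longleftrightarrow> c \<in> \<tau>" for c using i(11)[of Tm] marksD[OF Tm] by simp
      have ck: "v1 rCk = v rCk" "v1 rH = v rH" using i(10) by auto
      show ?thesis
      proof (cases "?c \<in> \<tau>")
        case True
        then have "new (Suc j) = new j" using new_Suc[OF jl] by simp
        then show ?thesis using i j la mT True ck
          unfolding I_def by (auto simp del: encode_qcnf.simps)
      next
        case False
        then have n: "new j = insert ?c (new (Suc j))" using new_Suc[OF jl] by simp
        let ?t = "v1 rTT"
        let ?a = "a1(Hm := (a1 Hm)(?c := v rCk, negc ?c := v rCk), Nl := (a1 Nl)(?t := ?c, Suc ?t := negc ?c),
          Np := (a1 Np)(?t := v rH, Suc ?t := v rH))"
        have img: "?a Nl ` {v rTT..<?t + 2} = new j \<union> negc ` new j"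
        proof -
          have eq: "{v rTT..<?t + 2} = {v rTT..<?t} \<union> {?t, Suc ?t}" using i(4) by auto
          have old: "?a Nl ` {v rTT..<?t} = a1 Nl ` {v rTT..<?t}" by (rule image_cong) auto
          have "?a Nl ?t = ?c" "?a Nl (Suc ?t) = negc ?c" by simp_all
          then show ?thesis unfolding eq image_Un image_insert image_empty old i(6) n j by auto
        qed
        have mk: "marks (?a Hm) (v rCk) (Hs \<union> new j \<union> negc ` new j)"
          using i(2) n j by (auto simp: marks_def)
        have fin: "I v3 ?a t3" if
          v3: "v3 rJ = j" "v3 rTT = ?t + 2" "v3 rNew = 1"
            "\<And>x. x \<notin> {rJ, rA, rB, rTT, rNew} \<Longrightarrow> v3 x = v1 x"
            "t3 \<le> t1 + 150" for v3 t3
          unfolding I_def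
        proof (intro conjI allI impI)
          show "v3 rJ \<le> length C" using v3 jl by simp
          show "marks (?a Hm) (v rCk) (Hs \<union> new (v3 rJ) \<union> negc ` new (v3 rJ))" using mk v3 by simp
          show "?a Hm c = a Hm c \<or> ?a Hm c = v rCk" for c using i(3)[of c] by auto
          show "v rTT \<le> v3 rTT" "v3 rTT + 2 * v3 rJ \<le> v rTT + 2 * length C" using i v3 j by auto
          show "?a Nl ` {v rTT..<v3 rTT} = new (v3 rJ) \<union> negc ` new (v3 rJ)" using img v3 by simp
          show "?a Np i = v rH" if "v rTT \<le> i" "i < v3 rTT" for i
            using that i(7)[of i] v3 by auto
          show "?a Nl i' = a Nl i'" "?a Np i' = a Np i'" if "i' < v rTT" for i'
            using that i(8)[of i'] i(4) by auto
          show "v3 rNew = 0 \<longleftrightarrow> new (v3 rJ) = {}" using v3 n by simp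
          show "v3 x = v x" if "x \<notin> {rJ, rA, rB, rTT, rNew}" for x using v3(4) i(10) that by simp
          show "?a b = a b" if "b \<notin> {Hm, Nl, Np}" for b using i(11) that by simp
          show "t3 + 150 * v3 rJ \<le> t + 20 + 150 * length C" using v3 i(12) j by simp
        qed
        have "t1 \<le> t + 20 + 150 * length C" using i(12) by simp
        then show ?thesis
          apply (simp add: j la mT False ck del: encode_qcnf.simps)
          apply (rule fin)
          apply simp_all
          done
      qed
    qed
    subgoal premises pr for v1 a1 t1
    proof -
      have e: "v1 rJ = 0" using pr(2) by simp
      from pr(1) have i:
        "marks (a1 Hm) (v rCk) (Hs \<union> new 0 \<union> negc ` new 0)"
        "\<And>c. a1 Hm c = a Hm c \<or> a1 Hm c = v rCk"
        "v rTT \<le> v1 rTT" "v1 rTT \<le> v rTT + 2 * length C"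
        "a1 Nl ` {v rTT..<v1 rTT} = new 0 \<union> negc ` new 0"
        "\<And>i. v rTT \<le> i \<Longrightarrow> i < v1 rTT \<Longrightarrow> a1 Np i = v rH"
        "\<And>i. i < v rTT \<Longrightarrow> a1 Nl i = a Nl i \<and> a1 Np i = a Np i"
        "v1 rNew = 0 \<longleftrightarrow> new 0 = {}"
        "\<And>x. x \<notin> {rJ, rA, rB, rTT, rNew} \<Longrightarrow> v1 x = v x"
        "\<And>b. b \<notin> {Hm, Nl, Np} \<Longrightarrow> a1 b = a b"
        "t1 \<le> t + 20 + 150 * length C"
        unfolding I_def e by simp_all
      have cn: "v1 rCnt = v rCnt" "v1 rN = v rN" using i(9) by auto
      have sub: "codes Q ev z C \<subseteq> \<tau> \<longleftrightarrow> v1 rNew = 0" using i(8) new_0 by auto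
      have fin: "R v3 a1 t3" if "\<And>x. x \<notin> {rCnt} \<Longrightarrow> v3 x = v1 x"
        "v3 rCnt = v rCnt + (if codes Q ev z C \<subseteq> \<tau> then Suc (v rN) else 1)" "t3 \<le> t1 + 50" for v3 t3
        by (rule R) (use that i new_0 in auto)
      show ?thesis using cn sub by (auto simp del: encode_qcnf.simps intro!: fin split: if_splits)
    qed
    done
qed

end

section \<open>Nodes as chains of parent links\<close>

text \<open>The guard makes the recursion terminate for arbitrary arrays; in the search tree parents
  always precede their children, so it never cuts a chain.\<close>

function chain :: "(nat \<Rightarrow> nat) \<Rightarrow> (nat \<Rightarrow> nat) \<Rightarrow> nat \<Rightarrow> nat list" where
  "chain nl np j = (if j = 0 then [] else nl j # (if np j < j then chain nl np (np j) else []))"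
  by auto
termination by (relation "measure (\<lambda>(nl, np, j). j)") auto

declare chain.simps [simp del]

lemma chain_0 [simp]: "chain nl np 0 = []"
  by (simp add: chain.simps)

lemma chain_step: "0 < j \<Longrightarrow> np j < j \<Longrightarrow> chain nl np j = nl j # chain nl np (np j)"
  by (subst chain.simps) simp

lemma chain_cong:
  "(\<And>i. i \<le> j \<Longrightarrow> nl i = nl' i \<and> np i = np' i) \<Longrightarrow> chain nl np j = chain nl' np' j"
proof (induction j rule: less_induct)
  case (less j)
  then show ?case by (subst (1 2) chain.simps) auto
qed

context existentials
begin

text \<open>The invariant is that \<open>rX\<close> holds \<open>z mod 2 ^ rI\<close> and the bits
  from \<open>rI\<close> on are unpacked.\<close>

lemma wp_decode:
  assumes K: "v rK = length ev" and Ev: "\<forall>i < length ev. a Ev i = ev ! i"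
    and Wt: "\<forall>i < length ev. a Wt i = 2 ^ i" and Z: "v rZ < 2 ^ length ev"
    and R: "\<And>v' a' t'. (\<And>x. x \<notin> {rX, rI} \<Longrightarrow> v' x = v x) \<Longrightarrow> (\<And>b. b \<noteq> Val \<Longrightarrow> a' b = a b) \<Longrightarrow>
      \<forall>e \<in> set ev. a' Val e = ev_val ev (v rZ) e \<Longrightarrow> t' \<le> t + 100 * (length ev + 1) \<Longrightarrow> R v' a' t'"
  shows "wp xs decode R v a t"
proof -
  define I where "I v' a' t' \<longleftrightarrow> v' rI \<le> length ev \<and> v' rX = v rZ mod 2 ^ v' rI \<and>
      (\<forall>x. x \<notin> {rX, rI} \<longrightarrow> v' x = v x) \<and> (\<forall>b. b \<noteq> Val \<longrightarrow> a' b = a b) \<and>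
      (\<forall>i. v' rI \<le> i \<longrightarrow> i < length ev \<longrightarrow> a' Val (ev ! i) = ev_val ev (v rZ) (ev ! i)) \<and>
      t' + 100 * v' rI \<le> t + 20 + 100 * length ev"
    for v' :: vars and a' :: arrs and t'
  show ?thesis
    unfolding decode_def
    apply (simp del: encode_qcnf.simps)
    apply (rule wp_While[where I = I and T = "t + 20 + 100 * length ev"])
    subgoal unfolding I_def using K Z by simp
    subgoal premises pr for v1 a1 t1
    proof -
      from pr(1) have i: "v1 rI \<le> length ev" "v1 rX = v rZ mod 2 ^ v1 rI"
        "\<And>x. x \<notin> {rX, rI} \<Longrightarrow> v1 x = v x" "\<And>b. b \<noteq> Val \<Longrightarrow> a1 b = a b"
        "\<And>i. v1 rI \<le> i \<Longrightarrow> i < length ev \<Longrightarrow> a1 Val (ev ! i) = ev_val ev (v rZ) (ev ! i)"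
        "t1 + 100 * v1 rI \<le> t + 20 + 100 * length ev"
        unfolding I_def by iprover+
      obtain j where j: "v1 rI = Suc j" using pr(2) by (cases "v1 rI") auto
      have jl: "j < length ev" using i(1) j by simp
      have w: "a1 Wt j = 2 ^ j" "a1 Ev j = ev ! j" using Wt Ev jl i(4) by auto
      let ?z = "v rZ"
      have split: "?z mod 2 ^ Suc j = 2 ^ j * (?z div 2 ^ j mod 2) + ?z mod 2 ^ j"
        by (metis mod_mult2_eq mult.commute power_Suc2)
      have lt: "Suc (?z mod 2 ^ j) \<le> 2 ^ j" by (simp add: Suc_le_eq)
      have bit: "ev_val ev ?z (ev ! j) = (if odd (?z div 2 ^ j) then 1 else 0)"
        using ev_val_nth[OF distinct_ev jl] .
      have fin: "I v3 (a1(Val := (a1 Val)(ev ! j := b))) t3" if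
        "v3 rI = j" "v3 rX = ?z mod 2 ^ j" "b = ev_val ev ?z (ev ! j)"
        "\<And>x. x \<notin> {rX, rI} \<Longrightarrow> v3 x = v1 x" "t3 \<le> t1 + 100" for v3 b t3
      proof -
        have "a1 Val (ev ! i) = ev_val ev ?z (ev ! i)"
          if "j \<le> i" "i < length ev" "ev ! i \<noteq> ev ! j" for i
          using that i(5)[of i] j by (cases "i = j") auto
        then show ?thesis unfolding I_def using that i j jl by auto
      qed
      show ?thesis
      proof (cases "odd (?z div 2 ^ j)")
        case True
        then have "?z mod 2 ^ Suc j = 2 ^ j + ?z mod 2 ^ j" using split by (simp add: odd_iff_mod_2_eq_one)
        then show ?thesis using i j w bit True
          by (auto simp del: encode_qcnf.simps power_Suc intro!: fin split: if_splits)
      next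
        case False
        then have "?z mod 2 ^ Suc j = ?z mod 2 ^ j" using split by (simp add: even_iff_mod_2_eq_zero)
        then show ?thesis using i j w bit False lt
          by (auto simp del: encode_qcnf.simps power_Suc intro!: fin split: if_splits)
      qed
    qed
    subgoal premises pr for v1 a1 t1
    proof -
      have e: "v1 rI = 0" using pr(2) by simp
      show ?thesis
        by (rule R) (use pr(1) e in \<open>auto simp: I_def in_set_conv_nth\<close>)
    qed
    done
qed

text \<open>The strict bound on the stamps expresses that the clock has just been advanced: no code
  counts as marked yet.\<close>

lemma wp_walk:
  assumes np: "\<And>i. 0 < i \<Longrightarrow> i \<le> v rH \<Longrightarrow> a Np i < i"
    and Tm: "\<And>c. a Tm c < v rCk"
    and R: "\<And>v' a' t'. (\<And>x. x \<notin> {rW, rDep} \<Longrightarrow> v' x = v x) \<Longrightarrow> (\<And>b. b \<noteq> Tm \<Longrightarrow> a' b = a b) \<Longrightarrow>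
      marks (a' Tm) (v rCk) (set (chain (a Nl) (a Np) (v rH))) \<Longrightarrow> (\<And>c. a' Tm c \<le> v rCk) \<Longrightarrow>
      v' rDep = length (chain (a Nl) (a Np) (v rH)) \<Longrightarrow>
      t' \<le> t + 100 * (length (chain (a Nl) (a Np) (v rH)) + 1) \<Longrightarrow> R v' a' t'"
  shows "wp xs walk R v a t"
proof -
  let ?ch = "chain (a Nl) (a Np)"
  define I where "I v' a' t' \<longleftrightarrow> v' rW \<le> v rH \<and>
      (\<forall>x. x \<notin> {rW, rDep} \<longrightarrow> v' x = v x) \<and> (\<forall>b. b \<noteq> Tm \<longrightarrow> a' b = a b) \<and>
      (\<forall>c. a' Tm c \<le> v rCk) \<and>
      {c. a' Tm c = v rCk} \<union> set (?ch (v' rW)) = set (?ch (v rH)) \<and>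
      v' rDep + length (?ch (v' rW)) = length (?ch (v rH)) \<and>
      t' \<le> t + 20 + 100 * v' rDep"
    for v' :: vars and a' :: arrs and t'
  show ?thesis
    unfolding walk_def
    apply (simp del: encode_qcnf.simps)
    apply (rule wp_While[where I = I and T = "t + 20 + 100 * length (?ch (v rH))"])
    subgoal
    proof -
      have "a Tm c \<noteq> v rCk" "a Tm c \<le> v rCk" for c using Tm[of c] by auto
      then show ?thesis by (simp add: I_def)
    qed
    subgoal premises pr for v1 a1 t1
    proof -
      from pr(1) have i: "v1 rW \<le> v rH"
        "\<And>x. x \<notin> {rW, rDep} \<Longrightarrow> v1 x = v x" "\<And>b. b \<noteq> Tm \<Longrightarrow> a1 b = a b"
        "\<And>c. a1 Tm c \<le> v rCk"
        "{c. a1 Tm c = v rCk} \<union> set (?ch (v1 rW)) = set (?ch (v rH))"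
        "v1 rDep + length (?ch (v1 rW)) = length (?ch (v rH))"
        "t1 \<le> t + 20 + 100 * v1 rDep"
        unfolding I_def by iprover+
      have w: "0 < v1 rW" using pr(2) by simp
      have np': "a Np (v1 rW) < v1 rW" using np w i(1) by simp
      have ch: "?ch (v1 rW) = a Nl (v1 rW) # ?ch (a Np (v1 rW))" using chain_step[of "v1 rW"] w np' by simp
      have ar: "a1 Nl = a Nl" "a1 Np = a Np" "v1 rCk = v rCk" using i(2,3) by auto
      have s: "{c. c = a Nl (v1 rW) \<or> c \<noteq> a Nl (v1 rW) \<and> a1 Tm c = v rCk} = insert (a Nl (v1 rW)) {c. a1 Tm c = v rCk}" by auto
      have "I v3 (a1(Tm := (a1 Tm)(a Nl (v1 rW) := v rCk))) t3" if
        "v3 rW = a Np (v1 rW)" "v3 rDep = v1 rDep + 1"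
        "\<And>x. x \<notin> {rW, rDep} \<Longrightarrow> v3 x = v1 x" "t3 \<le> t1 + 100" for v3 t3
        unfolding I_def
      proof (intro conjI)
        show "{c. (a1(Tm := (a1 Tm)(a Nl (v1 rW) := v rCk))) Tm c = v rCk} \<union> set (?ch (v3 rW)) = set (?ch (v rH))"
          using i(5) unfolding that(1) ch by auto
      qed (use that i np' ch in auto)
      then show ?thesis using i ch by (auto simp: ar simp del: encode_qcnf.simps)
    qed
    subgoal premises pr for v1 a1 t1
    proof -
      have e: "v1 rW = 0" using pr(2) by simp
      show ?thesis
        by (rule R) (use pr(1) e in \<open>auto simp: I_def marks_def\<close>)
    qed
    done
qed

end

locale bounded_instance = existentials +
  fixes d :: nat
  assumes clause_length: "C \<in> set \<phi> \<Longrightarrow> length C \<le> d"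
begin

sublocale selection "codes Q ev" "set \<phi>" "2 ^ length ev" d
proof
  show "finite (codes Q ev z C)" for z C by (simp add: codes_def)
  show "card (codes Q ev z C) \<le> d" if "C \<in> set \<phi>" for z C
    using clause_length[OF that] card_image_le[of "set C" "code Q ev z"] card_length[of C]
    unfolding codes_def by fastforce
  show "c \<le> 1" if "C \<in> set \<phi>" "c \<in> codes Q ev z C" "negc c \<in> codes Q ev z C" for z C c
    using codes_clash that .
qed

text \<open>The collected set is kept twice, as stamps in \<open>Hm\<close> for membership tests and
  as the list of tentative children for branching. An accepted clause adds at most
  \<open>2 * d\<close> children and at least 1 to the counter, hence the bound on
  \<open>rTT\<close>.\<close>

lemma wp_scan:
  assumes K: "v rK = length ev" and Ev: "\<forall>i < length ev. a Ev i = ev ! i"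
    and Val: "\<forall>e \<in> set ev. a Val e = ev_val ev z e" and N: "v rN = 2 ^ length ev * d"
    and Tm: "marks (a Tm) (v rCk) \<tau>" and Hm: "\<And>c. a Hm c < v rCk"
    and R: "\<And>v' a' t' Hs. scan_inv \<tau> z (set \<phi>) Hs (v' rCnt) \<Longrightarrow>
      v rT \<le> v' rTT \<Longrightarrow> v' rTT \<le> v rT + 2 * d * v' rCnt \<Longrightarrow> a' Nl ` {v rT..<v' rTT} = Hs \<Longrightarrow>
      (\<And>i. v rT \<le> i \<Longrightarrow> i < v' rTT \<Longrightarrow> a' Np i = v rH) \<Longrightarrow>
      (\<And>i. i < v rT \<Longrightarrow> a' Nl i = a Nl i \<and> a' Np i = a Np i) \<Longrightarrow>
      (\<And>c. a' Hm c \<le> v rCk) \<Longrightarrow>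
      (\<And>x. x \<notin> {rP, rC, rL, rJ, rBad, rI, rX, rA, rB, rTT, rNew, rCnt} \<Longrightarrow> v' x = v x) \<Longrightarrow>
      (\<And>b. b \<notin> {La, Lb, Hm, Nl, Np} \<Longrightarrow> a' b = a b) \<Longrightarrow>
      t' \<le> t + 1000 * (length ev + 1) * matrix_size \<phi> \<Longrightarrow> R v' a' t'"
  shows "wp xs scan R v a t"
proof -
  define W where "W = 700 * (length ev + 1)"
  define enc where "enc cs = concat (map encode_clause cs)" for cs
  have dr: "drop (Suc (length Q)) xs = length \<phi> # enc \<phi>"
    by (simp add: encode_matrix_def enc_def)
  note p = drop_Cons_nth[OF dr]
  define I where "I v' a' t' \<longleftrightarrow> (\<exists>ds cs Hs. \<phi> = ds @ cs \<and> v' rC = length cs \<and> drop (v' rP) xs = enc cs \<and>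
      scan_inv \<tau> z (set ds) Hs (v' rCnt) \<and> marks (a' Hm) (v rCk) Hs \<and>
      v rT \<le> v' rTT \<and> v' rTT \<le> v rT + 2 * d * v' rCnt \<and> a' Nl ` {v rT..<v' rTT} = Hs \<and>
      (\<forall>i. v rT \<le> i \<longrightarrow> i < v' rTT \<longrightarrow> a' Np i = v rH) \<and>
      (\<forall>i. i < v rT \<longrightarrow> a' Nl i = a Nl i \<and> a' Np i = a Np i) \<and>
      (\<forall>c. a' Hm c \<le> v rCk) \<and>
      (\<forall>x. x \<notin> {rP, rC, rL, rJ, rBad, rI, rX, rA, rB, rTT, rNew, rCnt} \<longrightarrow> v' x = v x) \<and>
      (\<forall>b. b \<notin> {La, Lb, Hm, Nl, Np} \<longrightarrow> a' b = a b) \<and>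
      t' \<le> t + 100 + W * length (enc ds))"
    for v' :: vars and a' :: arrs and t'
  have len_enc: "Suc (length (enc \<phi>)) = matrix_size \<phi>"
    by (simp add: matrix_size_def encode_matrix_def enc_def)
  show ?thesis
    unfolding scan_def
    apply (simp add: p del: encode_qcnf.simps)
    apply (rule wp_While[where I = I and T = "t + 100 + W * length (enc \<phi>)"])
    subgoal
      unfolding I_def
      apply (rule exI[of _ "[]"], rule exI[of _ \<phi>], rule exI[of _ "{}"])
      apply (use p scan_inv_init Hm less_imp_neq[OF Hm] less_imp_le[OF Hm] in
          \<open>auto simp: marks_def enc_def simp del: encode_qcnf.simps\<close>)
      done
    subgoal premises pr for v1 a1 t1
    proof -
      from pr(1) obtain ds cs Hs where i: "\<phi> = ds @ cs" "v1 rC = length cs" "drop (v1 rP) xs = enc cs"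
        "scan_inv \<tau> z (set ds) Hs (v1 rCnt)" "marks (a1 Hm) (v rCk) Hs"
        "v rT \<le> v1 rTT" "v1 rTT \<le> v rT + 2 * d * v1 rCnt" "a1 Nl ` {v rT..<v1 rTT} = Hs"
        "\<And>i. v rT \<le> i \<Longrightarrow> i < v1 rTT \<Longrightarrow> a1 Np i = v rH"
        "\<And>i. i < v rT \<Longrightarrow> a1 Nl i = a Nl i \<and> a1 Np i = a Np i"
        "\<And>c. a1 Hm c \<le> v rCk"
        "\<And>x. x \<notin> {rP, rC, rL, rJ, rBad, rI, rX, rA, rB, rTT, rNew, rCnt} \<Longrightarrow> v1 x = v x"
        "\<And>b. b \<notin> {La, Lb, Hm, Nl, Np} \<Longrightarrow> a1 b = a b"
        "t1 \<le> t + 100 + W * length (enc ds)"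
        unfolding I_def by blast
      obtain C cs' where cs: "cs = C # cs'" using pr(2) i(2) by (cases cs) auto
      have Cin: "C \<in> set \<phi>" using i(1) cs by simp
      have dC: "drop (v1 rP) xs = encode_clause C @ enc cs'" using i(3) cs by (simp add: enc_def)
      have fr: "v1 rK = length ev" "v1 rCk = v rCk" "v1 rN = v rN" "v1 rH = v rH" "v1 rT = v rT"
        using i(12) K by auto
      have ar: "\<forall>i < length ev. a1 Ev i = ev ! i" "\<forall>e \<in> set ev. a1 Val e = ev_val ev z e" "a1 Tm = a Tm"
        using i(13) Ev Val by auto
      have mk: "marks (a1 Tm) (v1 rCk) \<tau>" "marks (a1 Hm) (v1 rCk) Hs" using Tm i(5) fr ar by auto
      \<comment> \<open>The header cell of a clause pays for its constant overhead, so empty clauses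
        are covered too.\<close>
      have lC: "length (encode_clause C) = 1 + 2 * length C"
        unfolding encode_clause_def by (induction C) (auto simp: encode_literal_eq)
      have tm: "t1 + 700 * (length ev + 1) * (length C + 1) \<le> t + 100 + W * length (enc (ds @ [C]))"
      proof -
        have "W * (length C + 1) \<le> W * (1 + 2 * length C)" by (intro mult_left_mono) auto
        then show ?thesis using i(14) lC by (simp add: enc_def W_def algebra_simps)
      qed
      have "W * length (enc ds) \<le> W * length (enc \<phi>)" using i(1) by (simp add: enc_def)
      then have "t1 \<le> t + 100 + W * length (enc \<phi>)" using i(14) by linarith
      moreover have "wp xs (clause_pass1 ;; Cond (V rBad) Skip clause_pass2 ;; rC ::= Minus (V rC) (N 1)) I
          v1 a1 (t1 + ecost (V rC) + 2)"
        apply (subst wp_Seq)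
        apply (rule wp_clause_pass1[OF Cin dC fr(1) ar(1,2) mk])
        subgoal premises c1 for v2 a2 t2
        proof -
          have T2: "t2 \<le> t1 + 4 + 400 * (length ev + 1) * (length C + 1)" using c1(7) by simp
          have fr2: "\<And>x. x \<notin> {rP, rL, rJ, rBad, rI, rX, rA, rB} \<Longrightarrow> v2 x = v1 x" by (rule c1(5))
          have ar2: "\<And>b. b \<notin> {La, Lb} \<Longrightarrow> a2 b = a1 b" by (rule c1(6))
          show ?thesis
          proof (cases "v2 rBad = 0")
            case False
            have inv: "scan_inv \<tau> z (set (ds @ [C])) Hs (v1 rCnt)"
              using scan_inv_skip[OF i(4)] c1(4) False by simp
            have "I v3 a2 t3" if v3: "\<And>x. x \<noteq> rC \<Longrightarrow> v3 x = v2 x" "v3 rC = v2 rC - 1" "t3 \<le> t2 + 50" for v3 t3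
              unfolding I_def
            proof (rule exI[of _ "ds @ [C]"], rule exI[of _ cs'], rule exI[of _ Hs], intro conjI)
              show "t3 \<le> t + 100 + W * length (enc (ds @ [C]))"
                using tm T2 v3(3) by (simp add: algebra_simps)
              show "scan_inv \<tau> z (set (ds @ [C])) Hs (v3 rCnt)" using inv fr2 v3(1) by simp
            qed (use i cs c1(1) v3 fr2 ar2 in auto)
            then show ?thesis using False by (auto simp del: encode_qcnf.simps)
          next
            case True
            let ?Hs = "Hs \<union> (codes Q ev z C - \<tau>) \<union> negc ` (codes Q ev z C - \<tau>)"
            have mk2: "marks (a2 Tm) (v2 rCk) \<tau>" "marks (a2 Hm) (v2 rCk) Hs"
              using mk fr2 ar2 by auto
            have new: "\<not> (\<exists>c \<in> codes Q ev z C. negc c \<in> \<tau> \<or> c \<in> Hs)" using c1(4) True by simp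
            have "wp xs (Cond (V rBad) Skip clause_pass2) (wp xs (rC ::= Minus (V rC) (N 1)) I) v2 a2 t2"
              unfolding wp_Cond
            proof (intro conjI impI)
              show "wp xs clause_pass2 (wp xs (rC ::= Minus (V rC) (N 1)) I) v2 a2 (t2 + ecost (V rBad) + 1)"
                apply (rule wp_clause_pass2[OF c1(2,3) mk2], assumption)
                subgoal premises c2 for v3 a3 t3
                proof -
                  have fr3: "\<And>x. x \<notin> {rJ, rA, rB, rTT, rNew, rCnt} \<Longrightarrow> v3 x = v2 x" by (rule c2(9))
                  have ar3: "\<And>b. b \<notin> {Hm, Nl, Np} \<Longrightarrow> a3 b = a2 b" by (rule c2(10))
                  have s: "v2 rCnt = v1 rCnt" "v2 rTT = v1 rTT" "v2 rN = 2 ^ length ev * d" "v2 rCk = v rCk"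
                    "v2 rH = v rH" "a2 Nl = a1 Nl" "a2 Np = a1 Np" "a2 Hm = a1 Hm" "v2 rC = v1 rC"
                    using fr2 fr N ar2 by auto
                  have cnt: "v3 rCnt = v1 rCnt + (if codes Q ev z C \<subseteq> \<tau> then Suc (2 ^ length ev * d) else 1)"
                    using c2(8) unfolding s .
                  have inv: "scan_inv \<tau> z (set (ds @ [C])) ?Hs (v3 rCnt)"
                    using scan_inv_add[OF i(4) new] cnt by simp
                  have img: "a3 Nl ` {v rT..<v3 rTT} = ?Hs"
                  proof -
                    have "{v rT..<v3 rTT} = {v rT..<v2 rTT} \<union> {v2 rTT..<v3 rTT}"
                      using c2(3) i(6) unfolding s by auto
                    moreover have "a3 Nl ` {v rT..<v2 rTT} = a1 Nl ` {v rT..<v2 rTT}"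
                      using c2(7) unfolding s by (auto intro!: image_cong)
                    ultimately show ?thesis using c2(5) i(8) unfolding s by (simp add: image_Un Un_assoc)
                  qed
                  have ub: "v3 rTT \<le> v rT + 2 * d * v3 rCnt"
                  proof -
                    have "v3 rTT \<le> v1 rTT + 2 * length C" using c2(4) s by simp
                    also have "\<dots> \<le> v rT + 2 * d * v1 rCnt + 2 * d"
                      using i(7) clause_length[OF Cin] by simp
                    also have "\<dots> = v rT + 2 * d * (v1 rCnt + 1)" by simp
                    also have "\<dots> \<le> v rT + 2 * d * v3 rCnt" unfolding cnt by (intro add_left_mono mult_left_mono) auto
                    finally show ?thesis .
                  qed
                  have "I v4 a3 t4" if v4: "\<And>x. x \<noteq> rC \<Longrightarrow> v4 x = v3 x" "v4 rC = v3 rC - 1" "t4 \<le> t3 + 50" for v4 t4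
                    unfolding I_def
                  proof (rule exI[of _ "ds @ [C]"], rule exI[of _ cs'], rule exI[of _ ?Hs], intro conjI allI impI)
                    have "200 * (length C + 1) \<le> 200 * (length ev + 1) * (length C + 1)"
                      by (simp add: algebra_simps)
                    moreover have "1 \<le> (length ev + 1) * (length C + 1)" by simp
                    ultimately show "t4 \<le> t + 100 + W * length (enc (ds @ [C]))"
                      using tm T2 v4(3) c2(11) by (simp add: algebra_simps)
                    show "scan_inv \<tau> z (set (ds @ [C])) ?Hs (v4 rCnt)" using inv v4(1) by simp
                    show "marks (a3 Hm) (v rCk) ?Hs" using c2(1) s by simp
                    show "v rT \<le> v4 rTT" using c2(3) i(6) s v4 by simp
                    show "v4 rTT \<le> v rT + 2 * d * v4 rCnt" using ub v4 by simp
                    show "a3 Nl ` {v rT..<v4 rTT} = ?Hs" using img v4 by simp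
                    show "a3 Np i = v rH" if "v rT \<le> i" "i < v4 rTT" for i
                      using that i(9)[of i] c2(6)[of i] c2(7)[of i] v4 s by (cases "i < v1 rTT") auto
                    show "a3 Nl j = a Nl j" "a3 Np j = a Np j" if "j < v rT" for j
                      using that i(10)[of j] c2(7)[of j] i(6) s by auto
                    show "a3 Hm c \<le> v rCk" for c using c2(2)[of c] i(11)[of c] s by auto
                    show "v4 rC = length cs'" using v4 fr3 s i(2) cs by simp
                    show "drop (v4 rP) xs = enc cs'" using v4 fr3 c1(1) by simp
                    show "\<phi> = (ds @ [C]) @ cs'" using i cs by simp
                    show "v4 x = v x" if "x \<notin> {rP, rC, rL, rJ, rBad, rI, rX, rA, rB, rTT, rNew, rCnt}" for x
                      using that v4 fr3 fr2 i(12) by simp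
                    show "a3 b = a b" if "b \<notin> {La, Lb, Hm, Nl, Np}" for b
                      using that ar3 ar2 i(13) by simp
                  qed
                  then show ?thesis by (auto simp del: encode_qcnf.simps)
                qed
                done
            qed (use True in simp)
            then show ?thesis by (simp only: wp_Seq)
          qed
        qed
        done
      ultimately show ?thesis by blast
    qed
    subgoal premises pr for v1 a1 t1
    proof -
      from pr(1) obtain ds cs Hs where i: "\<phi> = ds @ cs" "v1 rC = length cs" "drop (v1 rP) xs = enc cs"
        "scan_inv \<tau> z (set ds) Hs (v1 rCnt)" "marks (a1 Hm) (v rCk) Hs"
        "v rT \<le> v1 rTT" "v1 rTT \<le> v rT + 2 * d * v1 rCnt" "a1 Nl ` {v rT..<v1 rTT} = Hs"
        "\<And>i. v rT \<le> i \<Longrightarrow> i < v1 rTT \<Longrightarrow> a1 Np i = v rH"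
        "\<And>i. i < v rT \<Longrightarrow> a1 Nl i = a Nl i \<and> a1 Np i = a Np i"
        "\<And>c. a1 Hm c \<le> v rCk"
        "\<And>x. x \<notin> {rP, rC, rL, rJ, rBad, rI, rX, rA, rB, rTT, rNew, rCnt} \<Longrightarrow> v1 x = v x"
        "\<And>b. b \<notin> {La, Lb, Hm, Nl, Np} \<Longrightarrow> a1 b = a b"
        "t1 \<le> t + 100 + W * length (enc ds)"
        unfolding I_def by blast
      have ds: "ds = \<phi>" using pr(2) i(1,2) by simp
      show ?thesis
      proof (rule R)
        show "t1 + ecost (V rC) + 1 \<le> t + 1000 * (length ev + 1) * matrix_size \<phi>"
          using i(14) ds by (simp add: W_def len_enc[symmetric] algebra_simps)
      qed (use i ds in auto)
    qed
    done
qed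

end

section \<open>Preprocessing and control loops\<close>

text \<open>The encoded quantifier minus the entry of \<open>Seen\<close> is nonzero exactly for an
  existential variable met for the first time. Each such variable doubles \<open>rM\<close> and
  records its old value as a weight.\<close>

definition gather :: com where
  "gather =
    While (V rL) (
      rX ::= In (V rP) ;;
      Cond (Minus (In (Plus (V rX) (N 1))) (Rd Seen (V rX)))
        (Write Seen (V rX) (N 1) ;; Write Ev (V rK) (V rX) ;; Write Wt (V rK) (V rM) ;;
         rM ::= Plus (V rM) (V rM) ;; rK ::= Plus (V rK) (N 1))
        Skip ;;
      rP ::= Plus (V rP) (N 2) ;; rL ::= Minus (V rL) (N 1))"

text \<open>The last loop multiplies \<open>rM\<close> by \<open>rD\<close> through repeated
  addition; its cost, proportional to \<open>rM\<close>, is absorbed by the parameter part of the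
  time bound.\<close>

definition prepare :: com where
  "prepare =
    rK ::= N 0 ;; rM ::= N 1 ;; rD ::= N 0 ;;
    rP ::= Plus (In (N 0)) (N 1) ;; rC ::= In (V rP) ;; rP ::= Plus (V rP) (N 1) ;;
    While (V rC) (
      rL ::= In (V rP) ;; rP ::= Plus (V rP) (N 1) ;;
      Cond (Minus (V rL) (V rD)) (rD ::= V rL) Skip ;;
      gather ;;
      rC ::= Minus (V rC) (N 1)) ;;
    rN ::= N 0 ;; rI ::= V rM ;;
    While (V rI) (rN ::= Plus (V rN) (V rD) ;; rI ::= Minus (V rI) (N 1))"

text \<open>A counter above \<open>rN\<close> certifies a flexible index. Otherwise setting
  \<open>rZ\<close> to \<open>rM\<close> leaves the loop over the indices, and the children are
  adopted unless the node already has \<open>rN + 1\<close> codes, the most an extendable set can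
  have.\<close>

definition try_index :: com where
  "try_index =
    rCk ::= Plus (V rCk) (N 1) ;; decode ;; walk ;; scan ;;
    Cond (Minus (V rCnt) (V rN))
      (rZ ::= Plus (V rZ) (N 1))
      (rBr ::= N 1 ;; rZ ::= V rM ;; Cond (Minus (V rDep) (V rN)) Skip (rT ::= V rTT))"

text \<open>If no index caused branching, all are flexible and the formula is false; moving
  \<open>rH\<close> to \<open>rT\<close> then ends the search.\<close>

definition process_node :: com where
  "process_node =
    rZ ::= N 0 ;; rBr ::= N 0 ;;
    While (Minus (V rM) (V rZ)) try_index ;;
    Cond (V rBr) (rH ::= Plus (V rH) (N 1)) (0 ::= N 0 ;; rH ::= V rT)"

text \<open>The root is node 1 and carries code 0, so 0 belongs to every node. The output stays 1
  unless a node proves that a selection exists.\<close>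

definition solve :: com where
  "solve =
    Write Nl (N 1) (N 0) ;; Write Np (N 1) (N 0) ;;
    rH ::= N 1 ;; rT ::= N 2 ;; rCk ::= N 0 ;; 0 ::= N 1 ;;
    While (Minus (V rT) (V rH)) process_node"

context wf_formula
begin

text \<open>\<open>S\<close> collects the literals already read. That the remaining arrays are still
  zero makes them valid stamp tables for a clock starting at 0.\<close>

definition gathered :: "vars \<Rightarrow> arrs \<Rightarrow> nat list \<Rightarrow> literal set \<Rightarrow> bool" where
  "gathered v a E S \<longleftrightarrow> v rK = length E \<and> v rM = 2 ^ length E \<and>
    (\<forall>i < length E. a Ev i = E ! i \<and> a Wt i = 2 ^ i) \<and>
    (\<forall>x. a Seen x = (if x \<in> set E then 1 else 0)) \<and> distinct E \<and>
    (\<forall>e \<in> set E. Q ! e = Exists \<and> e < length Q) \<and>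
    (\<forall>l \<in> S. Q ! var l = Exists \<longrightarrow> var l \<in> set E) \<and>
    (\<forall>b. b \<notin> {Seen, Ev, Wt} \<longrightarrow> (\<forall>i. a b i = 0))"

text \<open>The claim about an empty clause later shows that a listed existential variable forces a
  positive clause size.\<close>

lemma wp_gather:
  assumes C: "C \<in> set \<phi>" "drop (v rP) xs = concat (map encode_literal C) @ ys" "v rL = length C"
    and g: "gathered v a E S"
    and R: "\<And>v' a' t' E'. gathered v' a' E' (S \<union> set C) \<Longrightarrow> (C = [] \<Longrightarrow> E' = E) \<Longrightarrow>
      drop (v' rP) xs = ys \<Longrightarrow> (\<And>x. x \<notin> {rX, rP, rL, rM, rK} \<Longrightarrow> v' x = v x) \<Longrightarrow>
      t' \<le> t + 150 * (length C + 1) \<Longrightarrow> R v' a' t'"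
  shows "wp xs gather R v a t"
proof -
  define I where "I v' a' t' \<longleftrightarrow> (\<exists>ds ls E'. C = ds @ ls \<and>
      drop (v' rP) xs = concat (map encode_literal ls) @ ys \<and> v' rL = length ls \<and>
      gathered v' a' E' (S \<union> set ds) \<and> (ds = [] \<longrightarrow> E' = E) \<and>
      (\<forall>x. x \<notin> {rX, rP, rL, rM, rK} \<longrightarrow> v' x = v x) \<and> t' \<le> t + 150 * length ds)"
    for v' :: vars and a' :: arrs and t'
  show ?thesis
    unfolding gather_def
  proof (rule wp_While[where I = I and T = "t + 150 * length C"])
    show "I v a t" unfolding I_def
      by (rule exI[of _ "[]"], rule exI[of _ C], rule exI[of _ E]) (use C g in auto)
  next
    fix v1 a1 t1
    assume "I v1 a1 t1" and e: "eval xs v1 a1 (V rL) \<noteq> 0"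
    then obtain ds ls E' where i: "C = ds @ ls" "drop (v1 rP) xs = concat (map encode_literal ls) @ ys"
      "v1 rL = length ls" "gathered v1 a1 E' (S \<union> set ds)" "ds = [] \<longrightarrow> E' = E"
      "\<And>x. x \<notin> {rX, rP, rL, rM, rK} \<Longrightarrow> v1 x = v x" "t1 \<le> t + 150 * length ds"
      unfolding I_def by blast
    obtain l ls' where ls: "ls = l # ls'" using e i(3) by (cases ls) auto
    have l: "l \<in> set C" "drop (v1 rP) xs = encode_literal l @ concat (map encode_literal ls') @ ys"
      using i ls by auto
    note q = encode_literal_at[OF C(1) l]
    have qq: "xs ! Suc (var l) = encode_quant (Q ! var l)" "Suc (var l) < length xs"
      using xs_quant q by auto
    have seen: "a1 Seen (var l) = (if var l \<in> set E' then 1 else 0)" using i(4) by (simp add: gathered_def)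
    have fin: "I v3 a3 t3" if v3: "v3 rP = v1 rP + 2" "v3 rL = v1 rL - 1" "gathered v3 a3 E'' (S \<union> set (ds @ [l]))"
      "\<And>x. x \<notin> {rX, rP, rL, rM, rK} \<Longrightarrow> v3 x = v1 x" "t3 \<le> t1 + 150" for v3 a3 t3 E''
      unfolding I_def
      by (rule exI[of _ "ds @ [l]"], rule exI[of _ ls'], rule exI[of _ E''])
        (use v3 i ls q(5) in auto)
    have b: "wp xs (rX ::= In (V rP) ;;
      Cond (Minus (In (Plus (V rX) (N 1))) (Rd Seen (V rX)))
        (Write Seen (V rX) (N 1) ;; Write Ev (V rK) (V rX) ;; Write Wt (V rK) (V rM) ;;
         rM ::= Plus (V rM) (V rM) ;; rK ::= Plus (V rK) (N 1))
        Skip ;;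
      rP ::= Plus (V rP) (N 2) ;; rL ::= Minus (V rL) (N 1)) I v1 a1 (t1 + ecost (V rL) + 2)"
    proof (cases "Q ! var l = Exists \<and> var l \<notin> set E'")
      case True
      let ?a = "a1(Seen := (a1 Seen)(var l := 1), Ev := (a1 Ev)(length E' := var l), Wt := (a1 Wt)(length E' := 2 ^ length E'))"
      have "gathered v3 ?a (E' @ [var l]) (S \<union> set (ds @ [l]))"
        if "v3 rK = v1 rK + 1" "v3 rM = v1 rM + v1 rM" for v3
        using i(4) True that q(6) by (auto simp: gathered_def nth_append less_Suc_eq)
      moreover have "v1 rK = length E'" "v1 rM = 2 ^ length E'" using i(4) by (auto simp: gathered_def)
      ultimately show ?thesis using True seen qq q
        by (auto simp del: encode_qcnf.simps intro!: fin[where E'' = "E' @ [var l]"] split: if_splits)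
    next
      case False
      have "gathered v3 a1 E' (S \<union> set (ds @ [l]))"
        if "v3 rK = v1 rK" "v3 rM = v1 rM" for v3
        using i(4) False that q(6) by (auto simp: gathered_def)
      moreover have "xs ! Suc (var l) - a1 Seen (var l) = 0" using False qq seen by (cases "Q ! var l") auto
      ultimately show ?thesis using qq q
        by (auto simp del: encode_qcnf.simps intro!: fin[where E'' = E'] split: if_splits)
    qed
    have "t1 \<le> t + 150 * length C" using i(1,7) by simp
    then show "t1 \<le> t + 150 * length C \<and> wp xs (rX ::= In (V rP) ;;
      Cond (Minus (In (Plus (V rX) (N 1))) (Rd Seen (V rX)))
        (Write Seen (V rX) (N 1) ;; Write Ev (V rK) (V rX) ;; Write Wt (V rK) (V rM) ;;
         rM ::= Plus (V rM) (V rM) ;; rK ::= Plus (V rK) (N 1))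
        Skip ;;
      rP ::= Plus (V rP) (N 2) ;; rL ::= Minus (V rL) (N 1)) I v1 a1 (t1 + ecost (V rL) + 2)" using b by blast
  next
    fix v1 a1 t1
    assume "I v1 a1 t1" and e: "eval xs v1 a1 (V rL) = 0"
    then obtain ds ls E' where i: "C = ds @ ls" "drop (v1 rP) xs = concat (map encode_literal ls) @ ys"
      "v1 rL = length ls" "gathered v1 a1 E' (S \<union> set ds)" "ds = [] \<longrightarrow> E' = E"
      "\<And>x. x \<notin> {rX, rP, rL, rM, rK} \<Longrightarrow> v1 x = v x" "t1 \<le> t + 150 * length ds"
      unfolding I_def by blast
    have ds: "ls = []" "ds = C" using e i(1,3) by auto
    show "R v1 a1 (t1 + ecost (V rL) + 1)"
    proof (rule R[of v1 a1 E'])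
      show "gathered v1 a1 E' (S \<union> set C)" using i(4) unfolding ds .
      show "C = [] \<Longrightarrow> E' = E" using i(5) unfolding ds by iprover
      show "drop (v1 rP) xs = ys" using i(2) unfolding ds by simp
      show "t1 + ecost (V rL) + 1 \<le> t + 150 * (length C + 1)" using i(7) unfolding ds by simp
    qed (rule i(6))
  qed
qed

text \<open>The maximal clause size enters as an upper bound that is below every other one, which is
  the form needed to compare it with an arbitrary given \<open>d\<close>.\<close>

lemma wp_prepare:
  assumes R: "\<And>v a t E. existentials Q \<phi> E \<Longrightarrow> (\<forall>e \<in> set E. e < length Q) \<Longrightarrow>
      v rK = length E \<Longrightarrow> v rM = 2 ^ length E \<Longrightarrow> v rN = 2 ^ length E * v rD \<Longrightarrow>
      \<forall>i < length E. a Ev i = E ! i \<Longrightarrow> \<forall>i < length E. a Wt i = 2 ^ i \<Longrightarrow>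
      (\<And>b i. b \<notin> {Seen, Ev, Wt} \<Longrightarrow> a b i = 0) \<Longrightarrow>
      (\<forall>C \<in> set \<phi>. length C \<le> v rD) \<Longrightarrow> (\<And>d. \<forall>C \<in> set \<phi>. length C \<le> d \<Longrightarrow> v rD \<le> d) \<Longrightarrow>
      (E \<noteq> [] \<Longrightarrow> 0 < v rD) \<Longrightarrow>
      t \<le> 300 * matrix_size \<phi> + 50 * 2 ^ length E + 100 \<Longrightarrow> R v a t"
  shows "wp xs prepare R v0 (\<lambda>_ _. 0) 0"
proof -
  define enc where "enc cs = concat (map encode_clause cs)" for cs
  have dr: "drop (Suc (length Q)) xs = length \<phi> # enc \<phi>"
    by (simp add: encode_matrix_def enc_def)
  note p = drop_Cons_nth[OF dr]
  have len_enc: "Suc (length (enc \<phi>)) = matrix_size \<phi>"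
    by (simp add: matrix_size_def encode_matrix_def enc_def)
  define I where "I v' a' t' \<longleftrightarrow> (\<exists>ds cs E. \<phi> = ds @ cs \<and> drop (v' rP) xs = enc cs \<and> v' rC = length cs \<and>
      gathered v' a' E (\<Union> (set ` set ds)) \<and> (\<forall>C \<in> set ds. length C \<le> v' rD) \<and>
      (\<forall>d. (\<forall>C \<in> set \<phi>. length C \<le> d) \<longrightarrow> v' rD \<le> d) \<and> (E \<noteq> [] \<longrightarrow> 0 < v' rD) \<and>
      t' \<le> 50 + 250 * length (enc ds))"
    for v' :: vars and a' :: arrs and t'
  show ?thesis
    unfolding prepare_def
    apply (simp add: p del: encode_qcnf.simps)
    apply (rule wp_While[where I = I and T = "50 + 250 * length (enc \<phi>)"])
    subgoal
      unfolding I_def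
      apply (rule exI[of _ "[]"], rule exI[of _ \<phi>], rule exI[of _ "[]"])
      apply (simp add: p gathered_def enc_def[of "[]"] del: encode_qcnf.simps)
      done
    subgoal premises pr for v1 a1 t1
    proof -
      from pr(1) obtain ds cs E where i: "\<phi> = ds @ cs" "drop (v1 rP) xs = enc cs" "v1 rC = length cs"
        "gathered v1 a1 E (\<Union> (set ` set ds))" "\<forall>C \<in> set ds. length C \<le> v1 rD"
        "\<And>d. \<forall>C \<in> set \<phi>. length C \<le> d \<Longrightarrow> v1 rD \<le> d" "E \<noteq> [] \<longrightarrow> 0 < v1 rD"
        "t1 \<le> 50 + 250 * length (enc ds)"
        unfolding I_def by blast
      obtain C cs' where cs: "cs = C # cs'" using pr(2) i(3) by (cases cs) auto
      have Cin: "C \<in> set \<phi>" using i(1) cs by simp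
      have dC: "drop (v1 rP) xs = length C # concat (map encode_literal C) @ enc cs'"
        using i(2) cs by (simp add: enc_def encode_clause_def)
      note q = drop_Cons_nth[OF dC]
      have lC: "length (encode_clause C) = 1 + 2 * length C"
        unfolding encode_clause_def by (induction C) (auto simp: encode_literal_eq)
      have T: "t1 \<le> 50 + 250 * length (enc \<phi>)" using i(1,8) by (simp add: enc_def)
      have "wp xs (gather ;; rC ::= Minus (V rC) (N 1)) I v2 a1 t2"
        if v2: "v2 rP = Suc (v1 rP)" "v2 rL = length C" "v2 rD = max (v1 rD) (length C)"
          "\<And>x. x \<notin> {rP, rL, rD} \<Longrightarrow> v2 x = v1 x" "t2 \<le> t1 + 50" for v2 t2
      proof -
        have g: "gathered v2 a1 E (\<Union> (set ` set ds))"
          using i(4) v2(4)[of rK] v2(4)[of rM] by (simp add: gathered_def)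
        have dr2: "drop (v2 rP) xs = concat (map encode_literal C) @ enc cs'" using q(3) v2(1) by simp
        show ?thesis
          apply (subst wp_Seq)
          apply (rule wp_gather[OF Cin dr2 v2(2) g])
          subgoal premises c for v3 a3 t3 E'
          proof -
            have "I v4 a3 t4" if v4: "\<And>x. x \<noteq> rC \<Longrightarrow> v4 x = v3 x" "v4 rC = v3 rC - 1" "t4 \<le> t3 + 20" for v4 t4
              unfolding I_def
            proof (rule exI[of _ "ds @ [C]"], rule exI[of _ cs'], rule exI[of _ E'], intro conjI allI impI)
              show "gathered v4 a3 E' (\<Union> (set ` set (ds @ [C])))"
                using c(1) v4(1) by (simp add: gathered_def Un_commute)
              show "v4 rD \<le> d" if "\<forall>C \<in> set \<phi>. length C \<le> d" for d
                using v4 c(4)[of rD] v2(3) i(6)[OF that] that Cin by simp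
              show "0 < v4 rD" if "E' \<noteq> []"
              proof (cases "C = []")
                case True
                then show ?thesis using v4 c(2) c(4)[of rD] v2(3) i(7) that by simp
              next
                case False
                then show ?thesis using v4 c(4)[of rD] v2(3) by (simp add: max_def)
              qed
              show "t4 \<le> 50 + 250 * length (enc (ds @ [C]))"
                using v4(3) c(5) v2(5) i(8) lC by (simp add: enc_def)
            qed (use v4 c v2 i cs in \<open>auto simp: le_max_iff_disj\<close>)
            then show ?thesis by simp
          qed
          done
      qed
      then show ?thesis using T q by (auto simp: max_def simp del: encode_qcnf.simps split: if_splits)
    qed
    subgoal premises pr for v1 a1 t1
    proof -
      from pr(1) obtain ds cs E where i: "\<phi> = ds @ cs" "drop (v1 rP) xs = enc cs" "v1 rC = length cs"
        "gathered v1 a1 E (\<Union> (set ` set ds))" "\<forall>C \<in> set ds. length C \<le> v1 rD"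
        "\<And>d. \<forall>C \<in> set \<phi>. length C \<le> d \<Longrightarrow> v1 rD \<le> d" "E \<noteq> [] \<longrightarrow> 0 < v1 rD"
        "t1 \<le> 50 + 250 * length (enc ds)"
        unfolding I_def by blast
      have ds: "ds = \<phi>" using pr(2) i(1,3) by simp
      note g = i(4)[unfolded gathered_def]
      have ex: "existentials Q \<phi> E"
        using g ds wf unfolding existentials_def existentials_axioms_def wf_formula_def by blast
      \<comment> \<open>The product computed so far plus the part still to be added stays
        constant.\<close>
      define J where "J v' a' t' \<longleftrightarrow> a' = a1 \<and> (\<forall>x. x \<notin> {rN, rI} \<longrightarrow> v' x = v1 x) \<and>
        v' rN + v' rI * v1 rD = 2 ^ length E * v1 rD \<and> v' rI \<le> 2 ^ length E \<and>
        t' + 40 * v' rI \<le> 70 + 250 * length (enc \<phi>) + 40 * 2 ^ length E"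
        for v' :: vars and a' :: arrs and t'
      have M: "v1 rM = 2 ^ length E" using g by simp
      have "wp xs (While (V rI) (rN ::= Plus (V rN) (V rD) ;; rI ::= Minus (V rI) (N 1))) R
          (v1(rN := 0, rI := 2 ^ length E)) a1 t2" if "t2 \<le> t1 + 20" for t2
        apply (rule wp_While[where I = J and T = "70 + 250 * length (enc \<phi>) + 40 * 2 ^ length E"])
        subgoal using i(8) ds that by (simp add: J_def)
        subgoal premises pj for v2 a2 t2
        proof -
          obtain n where n: "v2 rI = Suc n" using pj(2) by (cases "v2 rI") auto
          show ?thesis using pj(1) n by (auto simp: J_def algebra_simps)
        qed
        subgoal premises pj for v2 a2 t2
        proof -
          have e: "v2 rI = 0" using pj(2) by simp
          note j = pj(1)[unfolded J_def e]
          have fr: "\<And>x. x \<notin> {rN, rI} \<Longrightarrow> v2 x = v1 x" using j by blast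
          show ?thesis
          proof (rule R[OF ex])
            show "t2 + ecost (V rI) + 1 \<le> 300 * matrix_size \<phi> + 50 * 2 ^ length E + 100"
              using j len_enc by simp
            show "v2 rD \<le> d" if "\<forall>C \<in> set \<phi>. length C \<le> d" for d using i(6)[OF that] fr by simp
          qed (use j g i(5,7) ds fr in auto)
        qed
        done
      then show ?thesis using M by (simp del: encode_qcnf.simps)
    qed
    done
qed

end

section \<open>The search\<close>

lemma negc_neq: "negc c \<noteq> c"
  unfolding negc_def by presburger

context bounded_instance
begin

abbreviation "m \<equiv> 2 ^ length ev :: nat"

definition env :: "vars \<Rightarrow> arrs \<Rightarrow> bool" where
  "env v a \<longleftrightarrow> v rK = length ev \<and> v rM = m \<and> v rN = m * d \<and>
    (\<forall>i < length ev. a Ev i = ev ! i) \<and> (\<forall>i < length ev. a Wt i = 2 ^ i) \<and>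
    (\<forall>c. a Tm c \<le> v rCk) \<and> (\<forall>c. a Hm c \<le> v rCk)"

definition node :: "arrs \<Rightarrow> nat \<Rightarrow> nat list" where
  "node a i = chain (a Nl) (a Np) i"

definition good :: "nat list \<Rightarrow> bool" where
  "good \<tau> \<longleftrightarrow> distinct \<tau> \<and> 0 \<in> set \<tau> \<and> consistent (set \<tau>) \<and> length \<tau> \<le> Suc (m * d)"

definition tree :: "arrs \<Rightarrow> nat \<Rightarrow> bool" where
  "tree a n \<longleftrightarrow> (\<forall>i. 0 < i \<longrightarrow> i < n \<longrightarrow> a Np i < i \<and> good (node a i))"

definition same_below :: "nat \<Rightarrow> arrs \<Rightarrow> arrs \<Rightarrow> bool" where
  "same_below n a a' \<longleftrightarrow> (\<forall>i < n. a' Nl i = a Nl i \<and> a' Np i = a Np i)"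

text \<open>\<open>n\<close> and \<open>n'\<close> are the ends of the queue before and after the
  node \<open>\<tau>\<close> with index \<open>h\<close> is expanded. The last conjunct carries the
  completeness of the search.\<close>

definition branched :: "nat list \<Rightarrow> nat \<Rightarrow> nat \<Rightarrow> arrs \<Rightarrow> nat \<Rightarrow> bool" where
  "branched \<tau> h n a n' \<longleftrightarrow> n \<le> n' \<and> n' \<le> n + 2 * d * (m * d) \<and> (length \<tau> = Suc (m * d) \<longrightarrow> n' = n) \<and>
    (\<forall>i. n \<le> i \<longrightarrow> i < n' \<longrightarrow> a Np i = h \<and> a Nl i \<notin> set \<tau> \<and> negc (a Nl i) \<notin> set \<tau>) \<and>
    (extendable (set \<tau>) \<longrightarrow> (\<exists>i. n \<le> i \<and> i < n' \<and> extendable (insert (a Nl i) (set \<tau>))))"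

lemma node_same: "same_below n a a' \<Longrightarrow> i < n \<Longrightarrow> node a' i = node a i"
  unfolding node_def by (rule chain_cong) (auto simp: same_below_def)

lemma tree_same: "same_below n a a' \<Longrightarrow> tree a n \<Longrightarrow> tree a' n"
  unfolding tree_def using node_same by (simp add: same_below_def)

definition index_time :: nat where
  "index_time = 100 * (length ev + 1) + 100 * (m * d + 2) + 1000 * (length ev + 1) * matrix_size \<phi> + 100"

lemma wp_try_index:
  assumes env: "env v a" and tree: "tree a (v rT)" and H: "0 < v rH" "v rH < v rT" and Z: "v rZ < m"
    and R: "\<And>v' a' t'. env v' a' \<Longrightarrow> same_below (v rT) a a' \<Longrightarrow> v' rH = v rH \<Longrightarrow> v' 0 = v 0 \<Longrightarrow>
      (v' rZ = v rZ + 1 \<and> v' rBr = v rBr \<and> v' rT = v rT \<and> flexible (set (node a (v rH))) (v rZ)) \<or>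
      (v' rZ = m \<and> v' rBr = 1 \<and> branched (node a (v rH)) (v rH) (v rT) a' (v' rT)) \<Longrightarrow>
      t' \<le> t + index_time \<Longrightarrow> R v' a' t'"
  shows "wp xs try_index R v a t"
proof -
  let ?\<tau> = "node a (v rH)"
  let ?ck = "Suc (v rCk)"
  let ?v = "v(rCk := ?ck)"
  have e: "v rK = length ev" "v rM = m" "v rN = m * d" "\<forall>i < length ev. a Ev i = ev ! i"
    "\<forall>i < length ev. a Wt i = 2 ^ i" "\<And>c. a Tm c \<le> v rCk" "\<And>c. a Hm c \<le> v rCk"
    using env unfolding env_def by blast+
  have np: "\<And>i. 0 < i \<Longrightarrow> i \<le> v rH \<Longrightarrow> a Np i < i" and gd: "good ?\<tau>"
    using tree H by (auto simp: tree_def)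
  show ?thesis
    unfolding try_index_def
    apply (simp del: encode_qcnf.simps)
    apply (rule wp_decode)
    subgoal using e by simp
    subgoal using e by simp
    subgoal using e by simp
    subgoal using Z by simp
    subgoal premises c1 for v1 a1 t1
    proof -
      have f1: "\<And>x. x \<notin> {rX, rI} \<Longrightarrow> v1 x = ?v x" by (rule c1(1))
      have g1: "\<And>b. b \<noteq> Val \<Longrightarrow> a1 b = a b" by (rule c1(2))
      have val: "\<forall>e \<in> set ev. a1 Val e = ev_val ev (v rZ) e" using c1(3) by simp
      show ?thesis
        apply (subst wp_Seq)
        apply (rule wp_walk)
        subgoal using np f1 g1 by simp
        subgoal using e(6) f1 g1 by (simp add: le_imp_less_Suc)
        subgoal premises c2 for v2 a2 t2
        proof -
          have f2: "\<And>x. x \<notin> {rX, rI, rW, rDep} \<Longrightarrow> v2 x = ?v x" using c2(1) f1 by simp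
          have g2: "\<And>b. b \<notin> {Val, Tm} \<Longrightarrow> a2 b = a b" "a2 Val = a1 Val" using c2(2) g1 by auto
          have nd: "chain (a1 Nl) (a1 Np) (v1 rH) = ?\<tau>" using f1 g1 by (simp add: node_def)
          have mk: "marks (a2 Tm) (v2 rCk) (set ?\<tau>)" using c2(3) nd f1 f2 by simp
          have dep: "v2 rDep = length ?\<tau>" using c2(5) nd by simp
          have l: "length ?\<tau> \<le> Suc (m * d)" using gd by (simp add: good_def)
          have t2: "t2 \<le> t + 6 + 100 * (length ev + 1) + 100 * (m * d + 2)"
            using c2(6) c1(4) l unfolding nd by simp
          show ?thesis
            apply (subst wp_Seq)
            apply (rule wp_scan[where z = "v rZ" and \<tau> = "set ?\<tau>"])
            subgoal using e f2 by simp
            subgoal using e g2 by simp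
            subgoal using val g2 by simp
            subgoal using e f2 by simp
            subgoal by (rule mk)
            subgoal using e(7) f2 g2 by (simp add: le_imp_less_Suc)
            subgoal premises c3 for v3 a3 t3 Hs
            proof -
              have f3: "\<And>x. x \<notin> {rX, rI, rW, rDep, rP, rC, rL, rJ, rBad, rI, rX, rA, rB, rTT, rNew, rCnt, rCk} \<Longrightarrow> v3 x = v x"
                using c3(8) f2 by simp
              have f3': "v3 rCk = ?ck" "v3 rDep = length ?\<tau>" using c3(8) f2 dep by simp_all
              have g3: "\<And>b. b \<notin> {La, Lb, Hm, Nl, Np, Val, Tm} \<Longrightarrow> a3 b = a b" using c3(9) g2 by simp
              have env3: "env v3 a3"
                unfolding env_def
              proof (intro conjI allI impI)
                show "a3 Tm c \<le> v3 rCk" for c using c3(9)[of Tm] c2(4)[of c] f1 f3' by simp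
                show "a3 Hm c \<le> v3 rCk" for c using c3(7)[of c] f2 f3' by simp
              qed (use e f3 g3 in auto)
              have T2: "v2 rT = v rT" "v2 rH = v rH" using f2 by simp_all
              have same: "same_below (v rT) a a3"
                using c3(6) g2 unfolding same_below_def T2 by simp
              have t3: "t3 + 50 \<le> t + index_time" using t2 c3(10) by (simp add: index_time_def)
              have env4: "env v4 a3" if "\<And>x. x \<notin> {rZ, rBr, rT} \<Longrightarrow> v4 x = v3 x" for v4
                using env3 that by (simp add: env_def)
              show ?thesis
              proof (cases "m * d < v3 rCnt")
                case True
                have fl: "flexible (set ?\<tau>) (v rZ)" using scan_inv_flexible[OF c3(1) True] .
                show ?thesis using True f3[of rN] e
                  apply (simp del: encode_qcnf.simps)
                  apply (rule R)
                  subgoal by (rule env4) simp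
                  subgoal by (rule same)
                  subgoal using f3 by simp
                  subgoal using f3 by simp
                  subgoal using f3 fl by simp
                  subgoal using t3 by simp
                  done
              next
                case False
                then have cnt: "v3 rCnt \<le> m * d" by simp
                have Hs: "\<And>c. c \<in> Hs \<Longrightarrow> c \<notin> set ?\<tau> \<and> negc c \<notin> set ?\<tau>"
                  using scan_invD(3)[OF c3(1)] by blast
                have br: "branched ?\<tau> (v rH) (v rT) a3 (if length ?\<tau> \<le> m * d then v3 rTT else v rT)"
                  unfolding branched_def
                proof (intro conjI allI impI)
                  let ?n = "if length ?\<tau> \<le> m * d then v3 rTT else v rT"
                  show "v rT \<le> ?n" using c3(2) T2 by simp
                  have "2 * d * v3 rCnt \<le> 2 * d * (m * d)" using cnt by (intro mult_left_mono) auto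
                  then have "v3 rTT \<le> v rT + 2 * d * (m * d)" using c3(3) T2(1) by linarith
                  then show "?n \<le> v rT + 2 * d * (m * d)" by simp
                  show "?n = v rT" if "length ?\<tau> = Suc (m * d)" using that by simp
                  fix i assume i: "v rT \<le> i" "i < ?n"
                  then have i': "v2 rT \<le> i" "i < v3 rTT" using T2 by (auto split: if_splits)
                  then show "a3 Np i = v rH" using c3(5)[of i] T2 by simp
                  have "a3 Nl i \<in> Hs" using i' c3(4) by auto
                  then show "a3 Nl i \<notin> set ?\<tau>" "negc (a3 Nl i) \<notin> set ?\<tau>" using Hs by auto
                next
                  let ?n = "if length ?\<tau> \<le> m * d then v3 rTT else v rT"
                  assume "extendable (set ?\<tau>)"
                  then obtain c where c: "c \<in> Hs" "extendable (insert c (set ?\<tau>))"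
                    using scan_inv_branch[OF c3(1) cnt Z] by blast
                  \<comment> \<open>A node of full size has no children, and rightly so: the new
                    code would make an extendable set too large.\<close>
                  have "card (insert c (set ?\<tau>)) = Suc (length ?\<tau>)"
                    using Hs[OF c(1)] gd by (simp add: good_def distinct_card)
                  then have le: "length ?\<tau> \<le> m * d" using extendable_card[OF c(2)] by simp
                  obtain i where "i \<in> {v2 rT..<v3 rTT}" "c = a3 Nl i" using c(1) c3(4) by blast
                  then show "\<exists>i. v rT \<le> i \<and> i < ?n \<and> extendable (insert (a3 Nl i) (set ?\<tau>))"
                    using c(2) le T2 by (intro exI[of _ i]) simp
                qed
                have dn: "length ?\<tau> - m * d = 0 \<longleftrightarrow> length ?\<tau> \<le> m * d" by auto
                have N3: "v3 rN = m * d" "v3 rM = m" using f3 e by simp_all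
                show ?thesis
                proof (cases "length ?\<tau> \<le> m * d")
                  case True
                  show ?thesis using cnt True
                    apply (simp add: N3 f3' del: encode_qcnf.simps)
                    apply (rule R)
                    subgoal by (rule env4) simp
                    subgoal by (rule same)
                    subgoal using f3 by simp
                    subgoal using f3 by simp
                    subgoal using br by simp
                    subgoal using t3 by simp
                    done
                next
                  case False
                  show ?thesis using cnt False
                    apply (simp add: N3 f3' del: encode_qcnf.simps)
                    apply (rule R)
                    subgoal by (rule env4) simp
                    subgoal by (rule same)
                    subgoal using f3 by simp
                    subgoal using f3 by simp
                    subgoal using br f3 by simp
                    subgoal using t3 by simp
                    done
                qed
              qed
            qed
            done
        qed
        done
    qed
    done
qed

definition node_time :: nat where
  "node_time = (index_time + 20) * m + 100"

text \<open>Stopping is sound whether or not the node is extendable: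
  \<open>flexible_solution\<close> builds a solution from the flexible indices alone.\<close>

lemma wp_process_node:
  assumes env: "env v a" and tree: "tree a (v rT)" and H: "0 < v rH" "v rH < v rT"
    and R: "\<And>v' a' t'. env v' a' \<Longrightarrow> same_below (v rT) a a' \<Longrightarrow>
      (v' rH = v rH + 1 \<and> v' 0 = v 0 \<and> branched (node a (v rH)) (v rH) (v rT) a' (v' rT)) \<or>
      (v' rH = v' rT \<and> v' 0 = 0 \<and> (\<exists>sel. solution sel)) \<Longrightarrow>
      t' \<le> t + node_time \<Longrightarrow> R v' a' t'"
  shows "wp xs process_node R v a t"
proof -
  let ?\<tau> = "node a (v rH)"
  define I where "I v' a' t' \<longleftrightarrow> env v' a' \<and> same_below (v rT) a a' \<and> v' rH = v rH \<and> v' 0 = v 0 \<and> v' rZ \<le> m \<and>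
      ((v' rBr = 0 \<and> v' rT = v rT \<and> (\<forall>z < v' rZ. flexible (set ?\<tau>) z)) \<or>
       (v' rBr = 1 \<and> v' rZ = m \<and> branched ?\<tau> (v rH) (v rT) a' (v' rT))) \<and>
      t' \<le> t + 20 + (index_time + 20) * v' rZ"
    for v' :: vars and a' :: arrs and t'
  show ?thesis
    unfolding process_node_def
    apply (simp del: encode_qcnf.simps)
    apply (rule wp_While[where I = I and T = "t + 20 + (index_time + 20) * m"])
    subgoal using env by (simp add: I_def env_def same_below_def)
    subgoal premises pr for v1 a1 t1
    proof -
      note i = pr(1)[unfolded I_def]
      have M: "v1 rM = m" using i by (simp add: env_def)
      have Z: "v1 rZ < m" using pr(2) M by simp
      have i': "env v1 a1" "same_below (v rT) a a1" "v1 rH = v rH" "v1 0 = v 0" "v1 rBr = 0" "v1 rT = v rT"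
        "\<forall>z < v1 rZ. flexible (set ?\<tau>) z" "t1 \<le> t + 20 + (index_time + 20) * v1 rZ" using i Z by auto
      have nd: "node a1 (v1 rH) = ?\<tau>" using node_same[OF i'(2) H(2)] i'(3) by simp
      have tr: "tree a1 (v1 rT)" using tree_same[OF i'(2) tree] i'(6) by simp
      have "(index_time + 20) * v1 rZ \<le> (index_time + 20) * m" using Z by (intro mult_left_mono) auto
      then have "t1 \<le> t + 20 + (index_time + 20) * m" using i'(8) by linarith
      moreover have "wp xs try_index I v1 a1 (t1 + ecost (Minus (V rM) (V rZ)) + 2)"
      proof (rule wp_try_index[OF i'(1) tr _ _ Z], goal_cases)
        case 1
        then show ?case using H i' by simp
      next
        case 2
        then show ?case using H i' by simp
      next
        case (3 v2 a2 t2)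
        have same: "same_below (v rT) a a2" using 3(2) i'(2,6) by (simp add: same_below_def)
        have t2: "t2 \<le> t1 + 7 + index_time" using 3(6) by simp
        from 3(5) consider
          "v2 rZ = v1 rZ + 1" "v2 rBr = v1 rBr" "v2 rT = v1 rT" "flexible (set ?\<tau>) (v1 rZ)"
          | "v2 rZ = m" "v2 rBr = 1" "branched ?\<tau> (v rH) (v rT) a2 (v2 rT)"
          unfolding nd[unfolded i'(3)] i'(3,6) by blast
        then show ?case
        proof cases
          case 1
          have "(index_time + 20) * v2 rZ = (index_time + 20) * v1 rZ + (index_time + 20)" using 1 by simp
          then have "t2 \<le> t + 20 + (index_time + 20) * v2 rZ" using t2 i'(8) by linarith
          then show ?thesis using 1 3 i' same Z by (auto simp: I_def less_Suc_eq)
        next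
          case 2
          have "(index_time + 20) * (v1 rZ + 1) \<le> (index_time + 20) * m" using Z by (intro mult_left_mono) auto
          then have "t2 \<le> t + 20 + (index_time + 20) * v2 rZ" unfolding 2(1) using t2 i'(8) by simp
          then show ?thesis using 2 3 i' same by (auto simp: I_def)
        qed
      qed
      ultimately show ?thesis by blast
    qed
    subgoal premises pr for v1 a1 t1
    proof -
      note i = pr(1)[unfolded I_def]
      have M: "v1 rM = m" using i by (simp add: env_def)
      have Z: "v1 rZ = m" using pr(2) M i by simp
      have env': "env v2 a1" if "\<And>x. x \<notin> {0, rH} \<Longrightarrow> v2 x = v1 x" for v2
        using i that by (simp add: env_def)
      have t1: "t1 + 50 \<le> t + node_time" using i Z by (simp add: node_time_def algebra_simps)
      show ?thesis
      proof (cases "v1 rBr = 0")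
        case True
        then have fl: "\<forall>z < m. flexible (set ?\<tau>) z" using i Z by simp
        have "good ?\<tau>" using tree H by (simp add: tree_def)
        then have sol: "\<exists>sel. solution sel"
          using flexible_solution[OF _ _ fl] unfolding good_def by blast
        show ?thesis using True
          apply (simp del: encode_qcnf.simps)
          apply (rule R)
          subgoal by (rule env') simp
          subgoal using i by simp
          subgoal using sol by simp
          subgoal using t1 by simp
          done
      next
        case False
        then have br: "branched ?\<tau> (v rH) (v rT) a1 (v1 rT)" using i by auto
        show ?thesis using False
          apply (simp del: encode_qcnf.simps)
          apply (rule R)
          subgoal by (rule env') simp
          subgoal using i by simp
          subgoal using br i by simp
          subgoal using t1 by simp
          done
      qed
    qed
    done
qed

text \<open>Bounds the number of nodes below a node that can grow by \<open>r\<close> more literals.\<close>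

primrec tree_size :: "nat \<Rightarrow> nat" where
  "tree_size 0 = 1"
| "tree_size (Suc r) = 1 + 2 * d * (m * d) * tree_size r"

lemma consistent_insert:
  "consistent X \<Longrightarrow> negc c \<notin> X \<Longrightarrow> consistent (insert c X)"
  unfolding consistent_def using negc_neq negc_negc by (metis insert_iff)

text \<open>Every pending node owns a budget for its subtree; processing it pays for the node and
  hands the rest to the children, so elapsed time plus budgets never exceeds \<open>TT\<close>. If a
  solution exists, some pending node is extendable, so the queue cannot run empty.\<close>

lemma wp_solve:
  assumes v: "v rK = length ev" "v rM = m" "v rN = m * d" "\<forall>i < length ev. a Ev i = ev ! i"
    "\<forall>i < length ev. a Wt i = 2 ^ i" "\<And>b i. b \<notin> {Seen, Ev, Wt} \<Longrightarrow> a b i = 0"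
    and R: "\<And>v' a' t'. v' 0 = (if \<exists>sel. solution sel then 0 else 1) \<Longrightarrow>
      t' \<le> t + 100 + (node_time + 20) * tree_size (m * d) \<Longrightarrow> R v' a' t'"
  shows "wp xs solve R v a t"
proof -
  define TT where "TT = t + 80 + (node_time + 20) * tree_size (m * d)"
  \<comment> \<open>A node may still grow up to \<open>m * d + 1\<close> codes; the root has one, so
    its budget uses \<open>tree_size (m * d)\<close>.\<close>
  define cost where "cost \<tau> = (node_time + 20) * tree_size (Suc (m * d) - length \<tau>)" for \<tau> :: "nat list"
  define I where "I v' a' t' \<longleftrightarrow> env v' a' \<and> t' \<le> TT \<and>
    ((v' 0 = 1 \<and> tree a' (v' rT) \<and> 0 < v' rH \<and> v' rH \<le> v' rT \<and>
      ((\<exists>sel. solution sel) \<longrightarrow> (\<exists>i. v' rH \<le> i \<and> i < v' rT \<and> extendable (set (node a' i)))) \<and>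
      t' + (\<Sum>i \<in> {v' rH..<v' rT}. cost (node a' i)) \<le> TT) \<or>
     (v' 0 = 0 \<and> v' rH = v' rT \<and> (\<exists>sel. solution sel)))"
    for v' :: vars and a' :: arrs and t'
  have a0: "a Nl i = 0" "a Np i = 0" "a Tm i = 0" "a Hm i = 0" for i using v(6) by simp_all
  show ?thesis
    unfolding solve_def
    apply (simp del: encode_qcnf.simps)
    apply (rule wp_While[where I = I and T = TT])
    subgoal premises
    proof -
      let ?a = "a(Nl := (a Nl)(Suc 0 := 0), Np := (a Np)(Suc 0 := 0))"
      have nd: "node ?a (Suc 0) = [0]"
        by (simp add: node_def chain_step)
      have "tree ?a 2"
        by (auto simp: tree_def nd good_def consistent_def negc_def less_2_cases_iff)
      moreover have "{1..<2} = {1::nat}" by auto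
      moreover have "(\<exists>sel. solution sel) \<longrightarrow> extendable {0}" by (auto simp: extendable_def)
      ultimately show ?thesis using v a0 nd
        by (auto simp: I_def env_def TT_def cost_def intro!: exI[of _ "Suc 0"])
    qed
    subgoal premises pr for v1 a1 t1
    proof -
      have lt: "v1 rH < v1 rT" using pr(2) by simp
      from pr(1) lt have i: "env v1 a1" "v1 0 = 1" "tree a1 (v1 rT)" "0 < v1 rH"
        "(\<exists>sel. solution sel) \<Longrightarrow> (\<exists>i. v1 rH \<le> i \<and> i < v1 rT \<and> extendable (set (node a1 i)))"
        "t1 + (\<Sum>i \<in> {v1 rH..<v1 rT}. cost (node a1 i)) \<le> TT" "t1 \<le> TT"
        unfolding I_def by auto
      let ?\<tau> = "node a1 (v1 rH)"
      let ?S = "\<lambda>A. \<Sum>i \<in> A. cost (node a1 i)"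
      have head: "?S {v1 rH..<v1 rT} = cost ?\<tau> + ?S {Suc (v1 rH)..<v1 rT}"
        using lt by (simp add: sum.atLeast_Suc_lessThan)
      have good: "good ?\<tau>" using i(3,4) lt by (simp add: tree_def)
      have cge: "node_time + 20 \<le> cost ?\<tau>"
      proof -
        have "1 \<le> tree_size r" for r by (cases r) auto
        then show ?thesis unfolding cost_def
          using mult_le_mono2[of 1 _ "node_time + 20"] by simp
      qed
      have "wp xs process_node I v1 a1 (t1 + ecost (Minus (V rT) (V rH)) + 2)"
      proof (rule wp_process_node[OF i(1,3,4) lt], goal_cases)
        case (1 v2 a2 t2)
        have t2: "t2 \<le> t1 + 7 + node_time" using 1(4) by simp
        then have t2': "t2 \<le> TT" using i(6) head cge by linarith
        have nd: "\<And>i. i < v1 rT \<Longrightarrow> node a2 i = node a1 i" using node_same[OF 1(2)] .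
        from 1(3) show ?case
        proof
          assume "v2 rH = v2 rT \<and> v2 0 = 0 \<and> (\<exists>sel. solution sel)"
          then show ?thesis using 1(1) t2' by (simp add: I_def)
        next
          assume br: "v2 rH = v1 rH + 1 \<and> v2 0 = v1 0 \<and> branched ?\<tau> (v1 rH) (v1 rT) a2 (v2 rT)"
          then have b: "v1 rT \<le> v2 rT" "v2 rT \<le> v1 rT + 2 * d * (m * d)"
            "length ?\<tau> = Suc (m * d) \<Longrightarrow> v2 rT = v1 rT"
            "\<And>i. v1 rT \<le> i \<Longrightarrow> i < v2 rT \<Longrightarrow> a2 Np i = v1 rH \<and> a2 Nl i \<notin> set ?\<tau> \<and> negc (a2 Nl i) \<notin> set ?\<tau>"
            "extendable (set ?\<tau>) \<Longrightarrow> (\<exists>i. v1 rT \<le> i \<and> i < v2 rT \<and> extendable (insert (a2 Nl i) (set ?\<tau>)))"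
            unfolding branched_def by blast+
          have child: "node a2 i = a2 Nl i # ?\<tau>" if "v1 rT \<le> i" "i < v2 rT" for i
          proof -
            have "a2 Np i < i" "0 < i" using b(4)[OF that] that lt by auto
            then have "node a2 i = a2 Nl i # node a2 (a2 Np i)" unfolding node_def by (rule chain_step[rotated])
            then show ?thesis using b(4)[OF that] nd[OF lt] by simp
          qed
          have tr: "tree a2 (v2 rT)"
            unfolding tree_def
          proof (intro allI impI)
            fix i assume i': "0 < i" "i < v2 rT"
            show "a2 Np i < i \<and> good (node a2 i)"
            proof (cases "i < v1 rT")
              case True
              then show ?thesis using tree_same[OF 1(2) i(3)] i' by (simp add: tree_def)
            next
              case False
              then have c: "v1 rT \<le> i" by simp
              have "length ?\<tau> \<noteq> Suc (m * d)" using b(3) c i' by auto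
              then have "length (node a2 i) \<le> Suc (m * d)" using child[OF c i'(2)] good by (simp add: good_def)
              then show ?thesis using child[OF c i'(2)] b(4)[OF c i'(2)] good lt c
                by (auto simp: good_def intro: consistent_insert)
            qed
          qed
          have ext: "\<exists>i. Suc (v1 rH) \<le> i \<and> i < v2 rT \<and> extendable (set (node a2 i))"
            if sol: "\<exists>sel. solution sel"
          proof -
            obtain j where j: "v1 rH \<le> j" "j < v1 rT" "extendable (set (node a1 j))" using i(5)[OF sol] by blast
            show ?thesis
            proof (cases "j = v1 rH")
              case True
              then obtain j' where "v1 rT \<le> j'" "j' < v2 rT" "extendable (insert (a2 Nl j') (set ?\<tau>))"
                using b(5) j by blast
              then show ?thesis using child[of j'] lt by (intro exI[of _ j']) simp
            next
              case False
              then show ?thesis using j nd[of j] b(1) by (intro exI[of _ j]) simp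
            qed
          qed
          have sum: "(\<Sum>i \<in> {Suc (v1 rH)..<v2 rT}. cost (node a2 i)) + (node_time + 20) \<le> cost ?\<tau> + ?S {Suc (v1 rH)..<v1 rT}"
          proof -
            have "(\<Sum>i \<in> {Suc (v1 rH)..<v2 rT}. cost (node a2 i)) =
                (\<Sum>i \<in> {Suc (v1 rH)..<v1 rT}. cost (node a2 i)) + (\<Sum>i \<in> {v1 rT..<v2 rT}. cost (node a2 i))"
              using lt b(1) by (intro sum.atLeastLessThan_concat[symmetric]) auto
            also have "(\<Sum>i \<in> {Suc (v1 rH)..<v1 rT}. cost (node a2 i)) = ?S {Suc (v1 rH)..<v1 rT}"
              using nd by (intro sum.cong) auto
            finally have "(\<Sum>i \<in> {Suc (v1 rH)..<v2 rT}. cost (node a2 i)) =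
                ?S {Suc (v1 rH)..<v1 rT} + (\<Sum>i \<in> {v1 rT..<v2 rT}. cost (node a2 i))" .
            \<comment> \<open>This is the recursion of \<open>tree_size\<close>: one node, and at
              most \<open>2 * d * (m * d)\<close> children with one code less to grow.\<close>
            moreover have "(\<Sum>i \<in> {v1 rT..<v2 rT}. cost (node a2 i)) + (node_time + 20) \<le> cost ?\<tau>"
            proof (cases "length ?\<tau> = Suc (m * d)")
              case True
              then show ?thesis using b(3) cge by simp
            next
              case False
              then obtain r where r: "Suc (m * d) - length ?\<tau> = Suc r" using good
                by (metis Suc_diff_le diff_Suc_Suc good_def le_neq_implies_less less_Suc_eq_le)
              then have "m * d - length ?\<tau> = r" by linarith
              then have "(\<Sum>i \<in> {v1 rT..<v2 rT}. cost (node a2 i)) = (\<Sum>i \<in> {v1 rT..<v2 rT}. (node_time + 20) * tree_size r)"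
                using child by (intro sum.cong) (auto simp: cost_def)
              also have "\<dots> = (v2 rT - v1 rT) * ((node_time + 20) * tree_size r)" by simp
              also have "\<dots> \<le> 2 * d * (m * d) * ((node_time + 20) * tree_size r)"
                using b(2) by (intro mult_right_mono) auto
              finally show ?thesis unfolding cost_def r by (simp add: algebra_simps)
            qed
            ultimately show ?thesis by linarith
          qed
          have "t2 + (\<Sum>i \<in> {Suc (v1 rH)..<v2 rT}. cost (node a2 i)) \<le> TT"
            using sum t2 i(6) head by linarith
          then show ?thesis using br 1(1) t2' tr ext i(2) lt b(1) by (simp add: I_def)
        qed
      qed
      then show ?thesis using i(7) by blast
    qed
    subgoal premises pr for v1 a1 t1
    proof (rule R)
      have le: "v1 rT \<le> v1 rH" using pr(2) by simp
      \<comment> \<open>With answer 1 and an empty queue there is no pending extendable node, hence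
        no solution.\<close>
      show "v1 0 = (if \<exists>sel. solution sel then 0 else 1)"
        using pr(1) le unfolding I_def by auto
      show "t1 + ecost (Minus (V rT) (V rH)) + 1 \<le> t + 100 + (node_time + 20) * tree_size (m * d)"
        using pr(1) by (simp add: I_def TT_def)
    qed
    done
qed

lemma solution_iff_selects: "solution sel \<longleftrightarrow> selects sel"
  by (simp add: solution_def selects_def)

end

section \<open>Running time\<close>

lemma num_exists_card: "num_exists (Q, \<phi>) = card {i. i < length Q \<and> Q ! i = Exists}"
  by (simp add: count_list_eq_length_filter length_filter_conv_card eq_commute[of Exists])

text \<open>Here \<open>n\<close> is \<open>m * d\<close>. The power bounds the size of the tree, as
  \<open>d\<close> is at most \<open>n\<close>; the square covers the \<open>m\<close> indices tried
  at a node and the cost of each per unit of matrix size.\<close>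

definition bound :: "nat \<Rightarrow> nat" where
  "bound n = 3000 * (n + 2) ^ 2 * (2 * n ^ 2 + 1) ^ n"

lemma bound_mono: "n \<le> n' \<Longrightarrow> bound n \<le> bound n'"
  unfolding bound_def
  by (intro mult_le_mono power_mono order_trans[OF power_mono power_increasing] add_le_mono) auto

context bounded_instance
begin

lemma tree_size_le: "tree_size r \<le> (2 * d * (m * d) + 1) ^ r"
proof (induction r)
  case (Suc r)
  let ?B = "2 * d * (m * d)"
  have "tree_size (Suc r) \<le> 1 + ?B * (?B + 1) ^ r" using Suc.IH by (simp add: mult_le_mono2)
  also have "\<dots> \<le> (?B + 1) ^ r + ?B * (?B + 1) ^ r" by (simp del: mult_is_0)
  finally show ?case by simp
qed simp

text \<open>If \<open>d = 0\<close>, then \<open>m * d\<close> says nothing about \<open>m\<close>;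
  the assumption then gives an empty \<open>ev\<close> and \<open>m = 1\<close>. The summand 2 in
  \<open>y\<close> covers this case.\<close>

lemma total_time:
  assumes pos: "ev \<noteq> [] \<Longrightarrow> 0 < d"
  shows "300 * matrix_size \<phi> + 50 * m + 200 + (node_time + 20) * tree_size (m * d) + 2
    \<le> bound (m * d) * matrix_size \<phi>"
proof -
  define n where "n = m * d"
  define y where "y = n + 2"
  define s where "s = matrix_size \<phi>"
  define e where "e = length ev + 1"
  have s: "1 \<le> s" by (simp add: s_def matrix_size_def encode_matrix_def)
  have m: "m \<le> y" "e \<le> y" "d \<le> n"
  proof -
    have "length ev < 2 ^ length ev" by (rule less_exp)
    moreover have "m \<le> m * d" if "0 < d" using that by simp
    ultimately show "m \<le> y" "e \<le> y" using pos unfolding y_def n_def e_def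
      by (cases "ev = []"; simp; linarith)+
    show "d \<le> n" by (simp add: n_def)
  qed
  have y2: "2 \<le> y" by (simp add: y_def)
  have ys: "y \<le> y * s" "s \<le> y * s" "1 \<le> y * s" using s y2 by auto
  have es: "e * s \<le> y * s" using m by (intro mult_right_mono) auto
  have it: "index_time + 20 \<le> 1400 * (y * s)"
    unfolding index_time_def n_def[symmetric] e_def[symmetric] s_def[symmetric] y_def[symmetric]
    using ys es m y2 by linarith
  have "(index_time + 20) * m \<le> 1400 * (y * s) * y" using it m by (intro mult_mono) auto
  then have nt: "node_time + 20 \<le> 1600 * (y * y * s)"
  proof -
    have "1 * 1 \<le> (y * s) * y" using ys y2 by (intro mult_mono) auto
    moreover have "node_time + 20 = (index_time + 20) * m + 120" by (simp add: node_time_def)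
    ultimately show ?thesis using \<open>(index_time + 20) * m \<le> _\<close>
      by (simp only: mult.assoc mult.commute mult.left_commute)
  qed
  define G where "G = (2 * n ^ 2 + 1) ^ n"
  have "2 * d * n \<le> 2 * n ^ 2" using m by (simp add: power2_eq_square)
  then have "(2 * d * n + 1) ^ n \<le> G" unfolding G_def by (intro power_mono) auto
  then have ts: "tree_size n \<le> G" using tree_size_le[of n] unfolding n_def[symmetric] by linarith
  have G1: "1 \<le> G" by (simp add: G_def)
  have "(node_time + 20) * tree_size n \<le> 1600 * (y * y * s) * G" using nt ts by (intro mult_mono) auto
  moreover have "s * 1 \<le> (y * y * s) * G" "y * 1 \<le> (y * y * s) * G" "1 * 1 \<le> (y * y * s) * G"
    using s y2 G1 by (intro mult_mono; simp)+
  ultimately have "300 * s + 50 * y + 200 + (node_time + 20) * tree_size n + 2 \<le> 3000 * ((y * y * s) * G)"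
    by linarith
  moreover have "3000 * ((y * y * s) * G) = bound n * s"
    unfolding bound_def y_def[symmetric] G_def[symmetric] by (simp add: power2_eq_square)
  ultimately show ?thesis using m unfolding n_def[symmetric] s_def[symmetric] by linarith
qed

end

definition decider :: com where
  "decider = prepare ;; solve"

text \<open>The program determines its own variable list and clause size, which are at most those of
  the bound, so monotonicity of \<open>bound\<close> carries the time over to any admissible
  \<open>d\<close>.\<close>

lemma decider_correct:
  assumes wf: "wf_qcnf (Q, \<phi>)" and d: "\<forall>C \<in> set \<phi>. length C \<le> d"
    and T: "bound (2 ^ num_exists (Q, \<phi>) * d) * matrix_size \<phi> \<le> T"
  shows "decides_within (machine decider) (encode_qcnf (Q, \<phi>)) T (qbf_true (Q, \<phi>))"
proof -
  interpret wf_formula Q \<phi> by unfold_locales (rule wf)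
  show ?thesis
    unfolding decides_within_def
  proof (rule outputs_machine)
    show "xs \<noteq> []" by simp
    show "wp xs decider (\<lambda>v a t. v 0 = (if qbf_true (Q, \<phi>) then 1 else 0) \<and> t + 2 \<le> T)
        ((\<lambda>_. 0)(0 := length xs)) (\<lambda>_ _. 0) 0"
      unfolding decider_def wp_Seq
    proof (rule wp_prepare, goal_cases)
      case (1 v a t E)
      interpret existentials Q \<phi> E by (rule 1(1))
      interpret bounded_instance Q \<phi> E "v rD" by unfold_locales (use 1(9) in blast)
      have "card (set E) \<le> card {i. i < length Q \<and> Q ! i = Exists}"
        using 1(2) ev_Exists by (intro card_mono) auto
      then have "length E \<le> num_exists (Q, \<phi>)"
        unfolding num_exists_card using distinct_card[OF distinct_ev] by simp
      then have "m * v rD \<le> 2 ^ num_exists (Q, \<phi>) * d"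
        using 1(10)[OF d] by (intro mult_le_mono power_increasing) auto
      then have "bound (m * v rD) * matrix_size \<phi> \<le> bound (2 ^ num_exists (Q, \<phi>) * d) * matrix_size \<phi>"
        by (intro mult_right_mono bound_mono) auto
      then have TT: "bound (m * v rD) * matrix_size \<phi> \<le> T" using T by (rule order_trans)
      show ?case
      proof (rule wp_solve[OF 1(3,4,5,6,7)], goal_cases)
        case (1 b i)
        then show ?case using \<open>\<And>b i. b \<notin> {Seen, Ev, Wt} \<Longrightarrow> a b i = 0\<close> by blast
      next
        case (2 v' a' t')
        have "v' 0 = (if qbf_true (Q, \<phi>) then 1 else 0)"
          unfolding qbf_true_iff 2(1) solution_iff_selects by simp
        moreover have "t' + 2 \<le> T" using 2(2) 1(12) total_time[OF 1(11)] TT by linarith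
        ultimately show ?case by blast
      qed
    qed
  qed
qed

text \<open>The constant is dictated by small \<open>n\<close>: the bound is 12000 at 0, where
  \<open>0 ^ 0 = 1\<close>, and 81000 at 1. From 2 on, \<open>n + 2 \<le> n ^ 2\<close> and
  \<open>2 * n ^ 2 + 1 \<le> n ^ 4\<close> give the exponent \<open>4 + 4 * n\<close>.\<close>

lemma bound_le: "bound n \<le> 100000 * n ^ (100000 * n)"
proof -
  consider "n = 0" | "n = 1" | "2 \<le> n" by linarith
  then show ?thesis
  proof cases
    case 3
    have n2: "2 * n \<le> n ^ 2" using 3 by (simp add: power2_eq_square)
    have n4: "n ^ 4 = n ^ 2 * n ^ 2" by (simp flip: power_add)
    have "4 \<le> n ^ 2" using power_mono[OF 3, of 2] by simp
    then have "4 * n ^ 2 \<le> n ^ 4" unfolding n4 by (rule mult_right_mono) simp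
    then have base: "2 * n ^ 2 + 1 \<le> n ^ 4" using \<open>4 \<le> n ^ 2\<close> by linarith
    have "n + 2 \<le> n ^ 2" using n2 3 by linarith
    then have "(n + 2) ^ 2 \<le> (n ^ 2) ^ 2" by (rule power_mono) simp
    moreover have "(2 * n ^ 2 + 1) ^ n \<le> (n ^ 4) ^ n" using base by (rule power_mono) simp
    ultimately have "bound n \<le> 3000 * (n ^ 2) ^ 2 * (n ^ 4) ^ n"
      unfolding bound_def by (intro mult_mono) auto
    also have "\<dots> = 3000 * n ^ (4 + 4 * n)" by (simp add: power_add flip: power_mult)
    also have "\<dots> \<le> 100000 * n ^ (100000 * n)"
      using 3 by (intro mult_mono power_increasing) auto
    finally show ?thesis .
  qed (simp_all add: bound_def power2_eq_square)
qed

definition doubling :: "nat \<Rightarrow> nat \<Rightarrow> com" where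
  "doubling x y = While (V x) (y ::= Plus (V y) (V y) ;; x ::= Minus (V x) (N 1))"

lemma wp_doubling:
  assumes "x \<noteq> y"
    and R: "\<And>t'. t' \<le> t + 30 * (v x + 1) \<Longrightarrow> R (v(x := 0, y := v y * 2 ^ v x)) a t'"
  shows "wp xs (doubling x y) R v a t"
proof -
  define I where "I v' a' t' \<longleftrightarrow> a' = a \<and> (\<forall>z. z \<notin> {x, y} \<longrightarrow> v' z = v z) \<and>
      v' y * 2 ^ v' x = v y * 2 ^ v x \<and> t' + 30 * v' x \<le> t + 30 * v x"
    for v' :: vars and a' :: arrs and t'
  show ?thesis
    unfolding doubling_def
  proof (rule wp_While[where I = I and T = "t + 30 * v x"], goal_cases)
    case 1
    then show ?case by (simp add: I_def)
  next
    case (2 v' a' t')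
    then obtain n where "v' x = Suc n" by (cases "v' x") auto
    then show ?case using 2 assms(1) by (auto simp: I_def algebra_simps)
  next
    case (3 v' a' t')
    then have "v' = v(x := 0, y := v y * 2 ^ v x)" using assms(1) by (auto simp: I_def fun_eq_iff)
    then show ?case using R[of "t' + ecost (V x) + 1"] 3 by (simp add: I_def)
  qed
qed

text \<open>A double exponential suits a machine without multiplication: two doubling loops in
  succession, the first one counting for the second.\<close>

lemma computable_double_exp: "computable (\<lambda>n. 2 ^ 2 ^ (4 * n + 18))"
proof -
  define c where "c = 2 ::= In (N 0) ;; 2 ::= Plus (V 2) (V 2) ;; 2 ::= Plus (Plus (V 2) (V 2)) (N 18) ;;
    3 ::= N 1 ;; doubling 2 3 ;; 0 ::= N 1 ;; doubling 3 0"
  have "\<exists>T. outputs_within (machine c) [n] T (2 ^ 2 ^ (4 * n + 18))" for n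
  proof -
    define T where "T = 200 + 30 * (4 * n + 18) + 30 * 2 ^ (4 * n + 18) + (30::nat)"
    have "wp [n] c (\<lambda>v a t. v 0 = 2 ^ 2 ^ (4 * n + 18) \<and> t + 2 \<le> T) ((\<lambda>_. 0)(0 := length [n])) (\<lambda>_ _. 0) 0"
      unfolding c_def
      apply simp
      apply (rule wp_doubling)
       apply simp
      apply simp
      apply (rule wp_doubling)
       apply simp
      apply (simp add: T_def)
      done
    then show ?thesis using outputs_machine[of "[n]"] by blast
  qed
  then show ?thesis unfolding computable_def by blast
qed

text \<open>Both \<open>2 ^ k\<close> and \<open>d\<close> are at most \<open>2 ^ n\<close>, so
  \<open>x = 2 ^ (2 * n)\<close> bounds their product. With 100000 below \<open>2 ^ 17\<close> and
  \<open>2 * n\<close> below \<open>x\<close>, the exponent is at most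
  \<open>17 + 2 ^ 17 * x * x\<close>, and one further doubling absorbs the 17.\<close>

lemma bound_le_double_exp:
  assumes "k + d \<le> n"
  shows "bound (2 ^ k * d) \<le> 2 ^ 2 ^ (4 * n + 18)"
proof -
  define x :: nat where "x = 2 ^ (2 * n)"
  have "2 ^ k * d \<le> 2 ^ n * 2 ^ n"
  proof (rule mult_le_mono)
    show "(2::nat) ^ k \<le> 2 ^ n" using assms by (intro power_increasing) auto
    have "d < 2 ^ d" by (rule less_exp)
    also have "(2::nat) ^ d \<le> 2 ^ n" using assms by (intro power_increasing) auto
    finally show "d \<le> 2 ^ n" by simp
  qed
  then have "2 ^ k * d \<le> x" by (simp add: x_def mult_2 power_add)
  then have "bound (2 ^ k * d) \<le> bound x" by (rule bound_mono)
  also have "\<dots> \<le> 100000 * x ^ (100000 * x)" by (rule bound_le)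
  also have "\<dots> \<le> 2 ^ 17 * 2 ^ (2 * n * (2 ^ 17 * x))"
  proof (rule mult_le_mono)
    have "x ^ (100000 * x) \<le> x ^ (2 ^ 17 * x)" by (intro power_increasing) (auto simp: x_def)
    then show "x ^ (100000 * x) \<le> 2 ^ (2 * n * (2 ^ 17 * x))" by (simp only: power_mult x_def)
  qed simp
  also have "\<dots> = 2 ^ (17 + 2 * n * (2 ^ 17 * x))" by (simp only: power_add)
  also have "\<dots> \<le> 2 ^ 2 ^ (4 * n + 18)"
  proof (rule power_increasing)
    have "2 * n < x" unfolding x_def by (rule less_exp)
    then have "2 * n * (2 ^ 17 * x) \<le> x * (2 ^ 17 * x)" by (intro mult_le_mono) auto
    also have "\<dots> = 2 ^ (4 * n + 17)"
      by (simp only: x_def power_add[symmetric]) (rule arg_cong[where f = "(^) 2"], simp)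
    finally have "2 * n * (2 ^ 17 * x) \<le> 2 ^ (4 * n + 17)" .
    moreover have "17 \<le> (2::nat) ^ (4 * n + 17)"
      using power_increasing[of 17 "4 * n + 17" "2::nat"] by simp
    moreover have "(2::nat) ^ (4 * n + 18) = 2 ^ (4 * n + 17) + 2 ^ (4 * n + 17)"
      by (simp add: power_add)
    ultimately show "17 + 2 * n * (2 ^ 17 * x) \<le> 2 ^ (4 * n + 18)" by linarith
  qed simp
  finally show ?thesis .
qed

theorem theorem9:
  shows "fpt encode_qcnf {F. wf_qcnf F} qbf_true (\<lambda>F. num_exists F + max_clause_size F) \<and>
    (\<exists>P c. \<forall>Q \<phi> k d.
       wf_qcnf (Q, \<phi>) \<longrightarrow> k = num_exists (Q, \<phi>) \<longrightarrow> (\<forall>C \<in> set \<phi>. length C \<le> d) \<longrightarrow>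
       decides_within P (encode_qcnf (Q, \<phi>))
         (c * (2 ^ k * d) ^ (c * (2 ^ k * d)) * matrix_size \<phi>)
         (qbf_true (Q, \<phi>)))"
proof
  let ?f = "\<lambda>n. 2 ^ 2 ^ (4 * n + 18) :: nat"
  let ?\<kappa> = "\<lambda>F. num_exists F + max_clause_size F"
  have "decides_within (machine decider) (encode_qcnf F) (?f (?\<kappa> F) * length (encode_qcnf F) ^ 1) (qbf_true F)"
    if wf: "wf_qcnf F" for F
  proof -
    obtain Q \<phi> where F: "F = (Q, \<phi>)" by (cases F)
    have d: "\<forall>C \<in> set \<phi>. length C \<le> max_clause_size F" by (simp add: F)
    show ?thesis
      unfolding F
    proof (rule decider_correct)
      show "wf_qcnf (Q, \<phi>)" using wf F by simp
      show "\<forall>C \<in> set \<phi>. length C \<le> max_clause_size F" by (rule d)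
      \<comment> \<open>The matrix is part of the input, so the exponent 1 suffices for the input
        length.\<close>
      show "bound (2 ^ num_exists (Q, \<phi>) * max_clause_size F) * matrix_size \<phi>
          \<le> ?f (?\<kappa> (Q, \<phi>)) * length (encode_qcnf (Q, \<phi>)) ^ 1"
        unfolding F by (intro mult_le_mono bound_le_double_exp) (auto simp: matrix_size_def)
    qed
  qed
  then show "fpt encode_qcnf {F. wf_qcnf F} qbf_true ?\<kappa>"
    unfolding fpt_def using computable_double_exp by blast
next
  show "\<exists>P c. \<forall>Q \<phi> k d.
       wf_qcnf (Q, \<phi>) \<longrightarrow> k = num_exists (Q, \<phi>) \<longrightarrow> (\<forall>C \<in> set \<phi>. length C \<le> d) \<longrightarrow>
       decides_within P (encode_qcnf (Q, \<phi>))
         (c * (2 ^ k * d) ^ (c * (2 ^ k * d)) * matrix_size \<phi>)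
         (qbf_true (Q, \<phi>))"
  proof (intro exI allI impI)
    fix Q \<phi> k d
    assume "wf_qcnf (Q, \<phi>)" "k = num_exists (Q, \<phi>)" "\<forall>C \<in> set \<phi>. length C \<le> d"
    then show "decides_within (machine decider) (encode_qcnf (Q, \<phi>))
        (100000 * (2 ^ k * d) ^ (100000 * (2 ^ k * d)) * matrix_size \<phi>) (qbf_true (Q, \<phi>))"
      using bound_le by (intro decider_correct mult_right_mono) auto
  qed
qed

end
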